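(* Let $1\le k\le n$ be integers, and let $\mu\vdash k$ and $\lambda\vdash n$ be partitions such that $\lambda/\mu$ is a horizontal strip. Let $s$ and $t$ be the standard Young tableaux of shapes $\mu$ and $\lambda$ described in the context, and let $C_t\le S_n$ be the column-stabilizer of $t$. Let $\omega^{\mu\otimes\lambda}$ be the $(\mu\otimes\lambda)$-spherical function of the Gelfand pair $(G_{k,n},K_{k,n})=(S_k\times S_n,\ \mathrm{diag}(S_k)\times S_{n-k})$, and let $P$ be the character table of the $(k,n)$-injection scheme. Then for every cycle-path type $(\gamma|\rho)$, \[ \omega^{\mu \otimes \lambda}_{(\gamma|\rho)} = \frac{1}{|C_{(\gamma|\rho)}|} \sum_{\sigma \in C_{(\gamma|\rho)}}\ \sum_{\pi \in C_t} \mathrm{sgn}(\pi)\,1_{\{s\}, \{\pi t\}}(\sigma) \] and \[ P_{\mu \otimes \lambda,\, (\gamma|\rho)} = \sum_{\sigma \in C_{(\gamma|\rho)}}\ \sum_{\pi \in C_t} \mathrm{sgn}(\pi)\,1_{\{s\}, \{\pi t\}}(\sigma). \]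
   Context: Partitions and tableaux: partitions are drawn as left-justified arrays with $\lambda_i$ cells in row $i$ (row 1 on top). For $\mu\vdash k$, $\lambda\vdash n$ with $\mu_i\le\lambda_i$ for all $i$, the skew diagram $\lambda/\mu$ is the set of cells of $\lambda$ not in $\mu$; it is a horizontal strip if no two of its cells lie in the same column (in particular "$\lambda/\mu$ is a horizontal strip" includes $\mu_i\le\lambda_i$ for all $i$). A Young tableau of shape $\lambda\vdash n$ is a bijective filling of the cells by $1,\dots,n$; it is standard if entries increase along rows and down columns. The tabloid $\{t\}$ is $t$ with each row regarded as an unordered set. A permutation $\pi$ acts on $t$ by replacing each entry $i$ by $\pi(i)$. The column-stabilizer $C_t$ is the group of permutations preserving (setwise) the set of entries of each column of $t$. The tableaux $s,t$: $s$ is the standard tableau of shape $\mu$ obtained by writing $1,2,\dots,k$ into the rows from left to right, top row to bottom row. $t$ is the standard tableau of shape $\lambda$ that agrees with $s$ on the cells of $\mu$ and whose cells in the horizontal strip $\lambda/\mu$ are labelled $k+1,k+2,\dots,n$ from left to right (in order of increasing column). Injections: $S_{k,n}$ is the set of injections $\sigma:[k]\to[n]$. For a $\mu$-tabloid $\{s\}$ and a $\lambda$-tabloid $\{t\}$, the pair $\{s\},\{t\}$ covers $\sigma\in S_{k,n}$ if, for every $1\le i\le k$, the index of the row of $\{s\}$ containing $i$ equals the index of the row of $\{t\}$ containing $\sigma(i)$. $1_{\{s\},\{t\}}:S_{k,n}\to\{0,1\}$ is the indicator function of the set of injections covered by $\{s\},\{t\}$. Gelfand pair: $G_{k,n}=S_k\times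 S_n$ acts on $S_{k,n}$ by $(\pi,\rho)\cdot\sigma=\rho\circ\sigma\circ\pi^{-1}$. The stabilizer of the identity injection $e$ ($i\mapsto i$) is $K_{k,n}=\mathrm{diag}(S_k)\times S_{n-k}=\{(a,ab): a\in S_k,\ b\in \mathrm{Sym}(\{k+1,\dots,n\})\}$, where $S_k\le S_n$ acts on $\{1,\dots,k\}$. So $S_{k,n}\cong G_{k,n}/K_{k,n}$. The permutation representation of $G_{k,n}$ on $\mathbb{C}[S_{k,n}]$ is multiplicity-free and is isomorphic to $\bigoplus V_\mu\otimes V_\lambda$ over all $\mu\vdash k,\lambda\vdash n$ with $\lambda/\mu$ a horizontal strip, where $V_\mu,V_\lambda$ are the irreducible (Specht) representations of $S_k,S_n$. The $(\mu\otimes\lambda)$-spherical function is $\omega^{\mu\otimes\lambda}(g)=\frac1{|K_{k,n}|}\sum_{h\in K_{k,n}}\chi_{\mu\otimes\lambda}(g^{-1}h)$ for $g\in G_{k,n}$, where $\chi_{\mu\otimes\lambda}$ is the character of $V_\mu\otimes V_\lambda$; it is constant on double cosets of $K_{k,n}$. Cycle-path types and spheres: regard each injection as a maximum matching of the complete bipartite graph with parts $[k]$ and $[n]$. The multigraph union of two injections $\sigma,\sigma'$ is a disjoint union of even cycles (a doubled edge being a cycle of length 2) and paths with an even number of edges (an isolated vertex being a path of length $0$); its cycle-path type is $(\gamma|\rho)$ if the cycles have lengths $2\gamma_1,2\gamma_2,\dots$ and the paths have lengths $2\rho_1,2\rho_2,\dots$. The sphere $C_{(\gamma|\rho)}\subseteq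 S_{k,n}$ is the set of injections whose union with the identity injection $e$ has type $(\gamma|\rho)$; the spheres are the $K_{k,n}$-orbits on $S_{k,n}$, and so correspond to double cosets $K_{k,n}\backslash G_{k,n}/K_{k,n}$. $\omega^{\mu\otimes\lambda}_{(\gamma|\rho)}$ denotes the value of $\omega^{\mu\otimes\lambda}$ on the double coset corresponding to $C_{(\gamma|\rho)}$, i.e. at any $g$ with $g\cdot e\in C_{(\gamma|\rho)}$. Cycle-path types $(\gamma|\rho)$ range over those with $C_{(\gamma|\rho)}\neq\emptyset$. Injection scheme: the $(k,n)$-injection scheme is the symmetric association scheme on $S_{k,n}$ consisting of the $0/1$ matrices $A_{(\gamma|\rho)}$ with $(\sigma,\sigma')$ entry equal to $1$ exactly when the union of $\sigma$ and $\sigma'$ has type $(\gamma|\rho)$. Its character table has entries $P_{\mu\otimes\lambda,(\gamma|\rho)}$, the eigenvalue of $A_{(\gamma|\rho)}$ on the irreducible subspace of $\mathbb{C}[S_{k,n}]$ isomorphic to $V_\mu\otimes V_\lambda$. *)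

theory Defs
  imports
    Complex_Main
    "HOL-Library.FuncSet"
    "HOL-Library.Multiset"
    "HOL-Library.Function_Algebras"
    "HOL-Combinatorics.Permutations"
    "HOL-Algebra.Sym_Groups"
begin

section \<open>Complex vector spaces of functions\<close>

definition cscale :: "complex \<Rightarrow> ('x \<Rightarrow> complex) \<Rightarrow> 'x \<Rightarrow> complex" where
  "cscale c f = (\<lambda>x. c * f x)"

global_interpretation cfun: vector_space cscale
  by unfold_locales (auto simp: cscale_def fun_eq_iff algebra_simps)

text \<open>The trace of an operator \<open>T\<close> on a finite-dimensional subspace \<open>V\<close> that it
  preserves: the sum of the diagonal entries of its matrix with respect to a basis of \<open>V\<close>.\<close>

definition trace_on :: "('x \<Rightarrow> complex) set \<Rightarrow> (('x \<Rightarrow> complex) \<Rightarrow> 'x \<Rightarrow> complex) \<Rightarrow> complex" where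
  "trace_on V T =
     (let B = (SOME B. cfun.independent B \<and> cfun.span B = V)
      in \<Sum>b\<in>B. cfun.representation B (T b) b)"


section \<open>Permutation representations\<close>

text \<open>The linear action on \<open>\<complex>[X]\<close> induced by an action \<open>a\<close> of \<open>G\<close> on \<open>X\<close>.  Elements of
  \<open>\<complex>[X]\<close> are functions vanishing outside \<open>X\<close>; a point \<open>x\<close> corresponds to its indicator
  function, and \<open>g\<close> maps the indicator of \<open>x\<close> to that of \<open>a g x\<close>.\<close>

definition free_space :: "'x set \<Rightarrow> ('x \<Rightarrow> complex) set" where
  "free_space X = {f. \<forall>x. x \<notin> X \<longrightarrow> f x = 0}"

definition perm_rep ::
  "('g, 'm) monoid_scheme \<Rightarrow> ('g \<Rightarrow> 'x \<Rightarrow> 'x) \<Rightarrow> 'x set \<Rightarrow> 'g \<Rightarrow> ('x \<Rightarrow> complex) \<Rightarrow> 'x \<Rightarrow> complex" where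
  "perm_rep G a X g f = (\<lambda>x. if x \<in> X then f (a (inv\<^bsub>G\<^esub> g) x) else 0)"

definition subrep ::
  "('g, 'm) monoid_scheme \<Rightarrow> ('g \<Rightarrow> ('x \<Rightarrow> complex) \<Rightarrow> 'x \<Rightarrow> complex) \<Rightarrow> ('x \<Rightarrow> complex) set \<Rightarrow> bool" where
  "subrep G r W \<longleftrightarrow> cfun.subspace W \<and> (\<forall>g\<in>carrier G. \<forall>f\<in>W. r g f \<in> W)"

definition rep_iso ::
  "('g, 'm) monoid_scheme \<Rightarrow>
   ('g \<Rightarrow> ('x \<Rightarrow> complex) \<Rightarrow> 'x \<Rightarrow> complex) \<Rightarrow> ('x \<Rightarrow> complex) set \<Rightarrow>
   ('g \<Rightarrow> ('y \<Rightarrow> complex) \<Rightarrow> 'y \<Rightarrow> complex) \<Rightarrow> ('y \<Rightarrow> complex) set \<Rightarrow> bool" where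
  "rep_iso G r V r' W \<longleftrightarrow>
     (\<exists>\<phi>. bij_betw \<phi> V W \<and>
          (\<forall>u\<in>V. \<forall>v\<in>V. \<phi> (u + v) = \<phi> u + \<phi> v) \<and>
          (\<forall>c. \<forall>v\<in>V. \<phi> (cscale c v) = cscale c (\<phi> v)) \<and>
          (\<forall>g\<in>carrier G. \<forall>v\<in>V. \<phi> (r g v) = r' g (\<phi> v)))"


section \<open>Partitions, tableaux and tabloids\<close>

text \<open>Partitions are lists of positive parts; rows and columns are numbered from 0.\<close>

definition partition_of :: "nat \<Rightarrow> nat list \<Rightarrow> bool" where
  "partition_of n lam \<longleftrightarrow> sorted_wrt (\<ge>) lam \<and> 0 \<notin> set lam \<and> sum_list lam = n"

definition diagram :: "nat list \<Rightarrow> (nat \<times> nat) set" where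
  "diagram lam = {(i, j). i < length lam \<and> j < lam ! i}"

definition skew_diagram :: "nat list \<Rightarrow> nat list \<Rightarrow> (nat \<times> nat) set" where
  "skew_diagram lam mu = diagram lam - diagram mu"

definition horizontal_strip :: "nat list \<Rightarrow> nat list \<Rightarrow> bool" where
  "horizontal_strip lam mu \<longleftrightarrow> diagram mu \<subseteq> diagram lam \<and> inj_on snd (skew_diagram lam mu)"

text \<open>A tableau is a function on cells; its values outside the diagram are irrelevant.\<close>

type_synonym tableau = "nat \<times> nat \<Rightarrow> nat"

definition is_tableau :: "nat list \<Rightarrow> tableau \<Rightarrow> bool" where
  "is_tableau lam t \<longleftrightarrow> bij_betw t (diagram lam) {1..sum_list lam}"

text \<open>A tabloid maps each row index to the set of entries of that row.\<close>

type_synonym tabloid = "nat \<Rightarrow> nat set"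

definition tabloid_of :: "nat list \<Rightarrow> tableau \<Rightarrow> tabloid" where
  "tabloid_of lam t = (\<lambda>i. t ` {c \<in> diagram lam. fst c = i})"

definition tabloids :: "nat list \<Rightarrow> tabloid set" where
  "tabloids lam = {tabloid_of lam t | t. is_tableau lam t}"

definition tabloid_act :: "(nat \<Rightarrow> nat) \<Rightarrow> tabloid \<Rightarrow> tabloid" where
  "tabloid_act \<pi> T = (\<lambda>i. \<pi> ` T i)"

definition column_entries :: "nat list \<Rightarrow> tableau \<Rightarrow> nat \<Rightarrow> nat set" where
  "column_entries lam t j = t ` {c \<in> diagram lam. snd c = j}"

definition column_stabilizer :: "nat list \<Rightarrow> tableau \<Rightarrow> (nat \<Rightarrow> nat) set" where
  "column_stabilizer lam t =
     {\<pi> \<in> carrier (sym_group (sum_list lam)).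
        \<forall>j. \<pi> ` column_entries lam t j = column_entries lam t j}"

text \<open>The tableaux \<open>s\<close> and \<open>t\<close>.  Since no two cells of a horizontal strip share a column, the
  count below is the rank of the cell \<open>c\<close> in the strip, read from left to right.\<close>

definition row_tableau :: "nat list \<Rightarrow> tableau" where
  "row_tableau mu = (\<lambda>(i, j). sum_list (take i mu) + j + 1)"

definition strip_tableau :: "nat list \<Rightarrow> nat list \<Rightarrow> tableau" where
  "strip_tableau lam mu = (\<lambda>c.
     if c \<in> diagram mu then row_tableau mu c
     else sum_list mu + card {c' \<in> skew_diagram lam mu. snd c' \<le> snd c})"


section \<open>Specht modules\<close>

definition polytabloid :: "nat list \<Rightarrow> tableau \<Rightarrow> tabloid \<Rightarrow> complex" where
  "polytabloid lam t = (\<lambda>T. \<Sum>\<pi>\<in>column_stabilizer lam t.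
     of_int (sign \<pi>) * (if tabloid_of lam (\<pi> \<circ> t) = T then 1 else 0))"

definition specht :: "nat list \<Rightarrow> (tabloid \<Rightarrow> complex) set" where
  "specht lam = cfun.span {polytabloid lam t | t. is_tableau lam t}"


section \<open>The Gelfand pair\<close>

definition injections :: "nat \<Rightarrow> nat \<Rightarrow> (nat \<Rightarrow> nat) set" where
  "injections k n = {\<sigma> \<in> {1..k} \<rightarrow>\<^sub>E {1..n}. inj_on \<sigma> {1..k}}"

definition id_injection :: "nat \<Rightarrow> nat \<Rightarrow> nat" where
  "id_injection k = restrict id {1..k}"

definition gelfand_G :: "nat \<Rightarrow> nat \<Rightarrow> ((nat \<Rightarrow> nat) \<times> (nat \<Rightarrow> nat)) monoid" where
  "gelfand_G k n = sym_group k \<times>\<times> sym_group n"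

definition gelfand_K :: "nat \<Rightarrow> nat \<Rightarrow> ((nat \<Rightarrow> nat) \<times> (nat \<Rightarrow> nat)) set" where
  "gelfand_K k n = {(a, a \<circ> b) | a b. a permutes {1..k} \<and> b permutes {k+1..n}}"

definition inj_act :: "nat \<Rightarrow> (nat \<Rightarrow> nat) \<times> (nat \<Rightarrow> nat) \<Rightarrow> (nat \<Rightarrow> nat) \<Rightarrow> nat \<Rightarrow> nat" where
  "inj_act k = (\<lambda>(\<pi>, \<rho>) \<sigma>. restrict (\<rho> \<circ> \<sigma> \<circ> inv' \<pi>) {1..k})"

definition inj_rep ::
  "nat \<Rightarrow> nat \<Rightarrow> (nat \<Rightarrow> nat) \<times> (nat \<Rightarrow> nat) \<Rightarrow> ((nat \<Rightarrow> nat) \<Rightarrow> complex) \<Rightarrow> (nat \<Rightarrow> nat) \<Rightarrow> complex" where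
  "inj_rep k n = perm_rep (gelfand_G k n) (inj_act k) (injections k n)"

text \<open>\<open>V\<^sub>\<mu> \<otimes> V\<^sub>\<lambda>\<close>, realised inside \<open>\<complex>[X] \<otimes> \<complex>[Y] = \<complex>[X \<times> Y]\<close> where \<open>X\<close> and \<open>Y\<close> are the sets of
  \<open>\<mu>\<close>- and \<open>\<lambda>\<close>-tabloids: \<open>f \<otimes> h\<close> is the function \<open>(T, U) \<mapsto> f T * h U\<close>.\<close>

definition specht_tensor :: "nat list \<Rightarrow> nat list \<Rightarrow> (tabloid \<times> tabloid \<Rightarrow> complex) set" where
  "specht_tensor mu lam =
     cfun.span {\<lambda>(T, U). f T * h U | f h. f \<in> specht mu \<and> h \<in> specht lam}"

definition tensor_rep ::
  "nat list \<Rightarrow> nat list \<Rightarrow> (nat \<Rightarrow> nat) \<times> (nat \<Rightarrow> nat) \<Rightarrow>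
   (tabloid \<times> tabloid \<Rightarrow> complex) \<Rightarrow> tabloid \<times> tabloid \<Rightarrow> complex" where
  "tensor_rep mu lam =
     perm_rep (gelfand_G (sum_list mu) (sum_list lam))
       (\<lambda>(\<pi>, \<rho>) (T, U). (tabloid_act \<pi> T, tabloid_act \<rho> U)) (tabloids mu \<times> tabloids lam)"

definition tensor_character :: "nat list \<Rightarrow> nat list \<Rightarrow> (nat \<Rightarrow> nat) \<times> (nat \<Rightarrow> nat) \<Rightarrow> complex" where
  "tensor_character mu lam g = trace_on (specht_tensor mu lam) (tensor_rep mu lam g)"

definition spherical_function ::
  "nat \<Rightarrow> nat \<Rightarrow> nat list \<Rightarrow> nat list \<Rightarrow> (nat \<Rightarrow> nat) \<times> (nat \<Rightarrow> nat) \<Rightarrow> complex" where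
  "spherical_function k n mu lam g =
     1 / of_nat (card (gelfand_K k n)) *
     (\<Sum>h\<in>gelfand_K k n. tensor_character mu lam (inv\<^bsub>gelfand_G k n\<^esub> g \<otimes>\<^bsub>gelfand_G k n\<^esub> h))"


section \<open>Cycle-path types\<close>

text \<open>The multigraph union of two injections has vertices \<open>Inl i\<close> (\<open>i \<le> k\<close>) and \<open>Inr j\<close>
  (\<open>j \<le> n\<close>).  The edge \<open>(b, i)\<close> is the edge at \<open>Inl i\<close> of the first (\<open>b = False\<close>) or second
  (\<open>b = True\<close>) injection, so a common edge is counted twice.\<close>

definition union_verts :: "nat \<Rightarrow> nat \<Rightarrow> (nat + nat) set" where
  "union_verts k n = {1..k} <+> {1..n}"

definition union_edges :: "nat \<Rightarrow> (bool \<times> nat) set" where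
  "union_edges k = UNIV \<times> {1..k}"

definition edge_ends :: "(nat \<Rightarrow> nat) \<Rightarrow> (nat \<Rightarrow> nat) \<Rightarrow> bool \<times> nat \<Rightarrow> (nat + nat) set" where
  "edge_ends \<sigma> \<sigma>' = (\<lambda>(b, i). {Inl i, Inr (if b then \<sigma>' i else \<sigma> i)})"

definition union_degree ::
  "nat \<Rightarrow> (nat \<Rightarrow> nat) \<Rightarrow> (nat \<Rightarrow> nat) \<Rightarrow> nat + nat \<Rightarrow> nat" where
  "union_degree k \<sigma> \<sigma>' v = card {e \<in> union_edges k. v \<in> edge_ends \<sigma> \<sigma>' e}"

definition union_adjacency ::
  "nat \<Rightarrow> (nat \<Rightarrow> nat) \<Rightarrow> (nat \<Rightarrow> nat) \<Rightarrow> ((nat + nat) \<times> (nat + nat)) set" where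
  "union_adjacency k \<sigma> \<sigma>' = {(u, v). \<exists>e\<in>union_edges k. edge_ends \<sigma> \<sigma>' e = {u, v}}"

definition union_components ::
  "nat \<Rightarrow> nat \<Rightarrow> (nat \<Rightarrow> nat) \<Rightarrow> (nat \<Rightarrow> nat) \<Rightarrow> (nat + nat) set set" where
  "union_components k n \<sigma> \<sigma>' = (\<lambda>v. (union_adjacency k \<sigma> \<sigma>')\<^sup>* `` {v}) ` union_verts k n"

definition component_length ::
  "nat \<Rightarrow> (nat \<Rightarrow> nat) \<Rightarrow> (nat \<Rightarrow> nat) \<Rightarrow> (nat + nat) set \<Rightarrow> nat" where
  "component_length k \<sigma> \<sigma>' C = card {e \<in> union_edges k. edge_ends \<sigma> \<sigma>' e \<subseteq> C}"

text \<open>A component is a cycle if it is 2-regular (counting multiplicities) and a path otherwise.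
  All component lengths are even.  The second multiset of a type contains a 0 for every
  isolated vertex.\<close>

definition is_cycle_component ::
  "nat \<Rightarrow> (nat \<Rightarrow> nat) \<Rightarrow> (nat \<Rightarrow> nat) \<Rightarrow> (nat + nat) set \<Rightarrow> bool" where
  "is_cycle_component k \<sigma> \<sigma>' C \<longleftrightarrow> (\<forall>v\<in>C. union_degree k \<sigma> \<sigma>' v = 2)"

definition cycle_path_type ::
  "nat \<Rightarrow> nat \<Rightarrow> (nat \<Rightarrow> nat) \<Rightarrow> (nat \<Rightarrow> nat) \<Rightarrow> nat multiset \<times> nat multiset" where
  "cycle_path_type k n \<sigma> \<sigma>' =
     (image_mset (\<lambda>C. component_length k \<sigma> \<sigma>' C div 2)
        (mset_set {C \<in> union_components k n \<sigma> \<sigma>'. is_cycle_component k \<sigma> \<sigma>' C}),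
      image_mset (\<lambda>C. component_length k \<sigma> \<sigma>' C div 2)
        (mset_set {C \<in> union_components k n \<sigma> \<sigma>'. \<not> is_cycle_component k \<sigma> \<sigma>' C}))"

definition injection_sphere :: "nat \<Rightarrow> nat \<Rightarrow> nat multiset \<times> nat multiset \<Rightarrow> (nat \<Rightarrow> nat) set" where
  "injection_sphere k n \<tau> = {\<sigma> \<in> injections k n. cycle_path_type k n \<sigma> (id_injection k) = \<tau>}"

text \<open>The common value of the spherical function at all \<open>g\<close> with \<open>g \<cdot> e\<close> in the sphere.\<close>

definition spherical_value ::
  "nat \<Rightarrow> nat \<Rightarrow> nat list \<Rightarrow> nat list \<Rightarrow> nat multiset \<times> nat multiset \<Rightarrow> complex" where
  "spherical_value k n mu lam \<tau> =
     (THE z. \<forall>g\<in>carrier (gelfand_G k n).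
        inj_act k g (id_injection k) \<in> injection_sphere k n \<tau> \<longrightarrow> spherical_function k n mu lam g = z)"


section \<open>The injection scheme\<close>

definition scheme_matrix ::
  "nat \<Rightarrow> nat \<Rightarrow> nat multiset \<times> nat multiset \<Rightarrow> (nat \<Rightarrow> nat) \<Rightarrow> (nat \<Rightarrow> nat) \<Rightarrow> complex" where
  "scheme_matrix k n \<tau> \<sigma> \<sigma>' = (if cycle_path_type k n \<sigma> \<sigma>' = \<tau> then 1 else 0)"

definition scheme_operator ::
  "nat \<Rightarrow> nat \<Rightarrow> nat multiset \<times> nat multiset \<Rightarrow>
   ((nat \<Rightarrow> nat) \<Rightarrow> complex) \<Rightarrow> (nat \<Rightarrow> nat) \<Rightarrow> complex" where
  "scheme_operator k n \<tau> f = (\<lambda>\<sigma>. if \<sigma> \<in> injections k n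
     then \<Sum>\<sigma>'\<in>injections k n. scheme_matrix k n \<tau> \<sigma> \<sigma>' * f \<sigma>' else 0)"

text \<open>The subspace of \<open>\<complex>[S\<^bsub>k,n\<^esub>]\<close> isomorphic to \<open>V\<^sub>\<mu> \<otimes> V\<^sub>\<lambda>\<close>; it is unique because \<open>\<complex>[S\<^bsub>k,n\<^esub>]\<close> is
  multiplicity-free, and irreducible because \<open>V\<^sub>\<mu> \<otimes> V\<^sub>\<lambda>\<close> is.\<close>

definition scheme_subspace ::
  "nat \<Rightarrow> nat \<Rightarrow> nat list \<Rightarrow> nat list \<Rightarrow> ((nat \<Rightarrow> nat) \<Rightarrow> complex) set" where
  "scheme_subspace k n mu lam =
     (THE W. W \<subseteq> free_space (injections k n) \<and>
             subrep (gelfand_G k n) (inj_rep k n) W \<and>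
             rep_iso (gelfand_G k n) (tensor_rep mu lam) (specht_tensor mu lam) (inj_rep k n) W)"

definition character_table ::
  "nat \<Rightarrow> nat \<Rightarrow> nat list \<Rightarrow> nat list \<Rightarrow> nat multiset \<times> nat multiset \<Rightarrow> complex" where
  "character_table k n mu lam \<tau> =
     (THE c. \<forall>f\<in>scheme_subspace k n mu lam. scheme_operator k n \<tau> f = cscale c f)"


section \<open>Covered injections\<close>

definition row_index :: "tabloid \<Rightarrow> nat \<Rightarrow> nat" where
  "row_index T x = (THE i. x \<in> T i)"

definition covers :: "nat \<Rightarrow> tabloid \<Rightarrow> tabloid \<Rightarrow> (nat \<Rightarrow> nat) \<Rightarrow> bool" where
  "covers k S T \<sigma> \<longleftrightarrow> (\<forall>i\<in>{1..k}. row_index S i = row_index T (\<sigma> i))"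

definition cover_indicator :: "nat \<Rightarrow> tabloid \<Rightarrow> tabloid \<Rightarrow> (nat \<Rightarrow> nat) \<Rightarrow> complex" where
  "cover_indicator k S T \<sigma> = (if covers k S T \<sigma> then 1 else 0)"

end

theory Submission
  imports Defs "HOL-Library.Disjoint_Sets"
begin

text \<open>
  Sending a pair of tabloids to the indicator of the injections it covers extends to an equivariant
  map \<open>\<Phi>\<close> from \<open>\<complex>[X \<times> Y]\<close> to \<open>\<complex>[S\<^bsub>k,n\<^esub>]\<close>; composed with evaluation at the identity
  injection it is a \<open>K\<close>-invariant functional on \<open>V = V\<^sub>\<mu> \<otimes> V\<^sub>\<lambda>\<close>.  Let \<open>v\<close> be the \<open>K\<close>-average of
  \<open>{s} \<otimes> e\<^sub>t\<close>.  Because the column stabilizer of \<open>s\<close> lies in that of \<open>t\<close>, \<open>v\<close> is a multiple of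
  the \<open>K\<close>-average of \<open>e\<^sub>s \<otimes> e\<^sub>t\<close>, so it lies in \<open>V\<close>; and since only \<open>\<pi> = id\<close> contributes at the
  identity injection (\<open>\<lambda>/\<mu>\<close> being a horizontal strip), the functional takes the value 1 at \<open>v\<close>.

  An operator on \<open>\<complex>[X \<times> Y]\<close> that commutes with the group is a scalar on \<open>V\<close>, as column
  antisymmetrization sends every vector to a multiple of \<open>e\<^sub>s \<otimes> e\<^sub>t\<close>.  Two injections of the same
  cycle-path type are \<open>K\<close>-conjugate, hence \<open>K g K = K g\<inverse> K\<close>.  Together these facts show that the
  \<open>K\<close>-invariants of \<open>V\<close> are spanned by \<open>v\<close>.  Therefore the spherical function is \<open>g \<mapsto> \<Phi> v (g e)\<close>,
  \<open>\<Phi>\<close> embeds \<open>V\<close> as the only copy of \<open>V\<close> in \<open>\<complex>[S\<^bsub>k,n\<^esub>]\<close>, and the scheme operators act on it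
  by the sums of \<open>\<Phi> v\<close> over spheres.
\<close>

section \<open>Traces and permutation representations\<close>

text \<open>The objects of the statement are fixed by choice operators: the trace by some basis, and
  the spherical value, the copy of \<open>V\<close> and the eigenvalue by \<open>THE\<close>. Each
  needs a uniqueness argument, and all of these rest on the \<open>K\<close>-invariants of
  \<open>V\<close> being a line. Schur's lemma contributes scalars, the symmetry of double cosets
  contributes Gelfand's trick for matrix coefficients, and the positivity of a sum of real squares
  at the real vector \<open>v\<close> allows division by the scalar that appears.

  The line is used in two dual ways. Averaging over \<open>K\<close> is the rank-one map
  \<open>x \<mapsto> cscale (ev x) v\<close> on \<open>V\<close>, so the averaged character has a
  trace that is read off without a basis. And every \<open>K\<close>-invariant functional on
  \<open>V\<close> is a multiple of \<open>ev\<close>: for an arbitrary embedding of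
  \<open>V\<close> followed by evaluation at the identity injection this gives uniqueness of the
  copy, and for summation over a sphere it gives the eigenvalue.

  The vector \<open>v\<close> serves the representation theory, while the signed sum of the theorem
  comes from \<open>{s} \<otimes> e\<^sub>t\<close>; both have the same sums over spheres, because
  spheres are stable under \<open>K\<close>.\<close>

lemma sum_fun_apply: "(\<Sum>i\<in>I. f i) x = (\<Sum>i\<in>I. f i x :: 'b :: comm_monoid_add)"
  by (induction I rule: infinite_finite_induct) auto

lemma cscale_apply [simp]: "cscale c f x = c * f x"
  by (simp add: cscale_def)

lemma free_space_subspace: "cfun.subspace (free_space X)"
  by (auto simp: cfun.subspace_def free_space_def)

definition delta :: "'x \<Rightarrow> 'x \<Rightarrow> complex" where
  "delta x = (\<lambda>y. if y = x then 1 else 0)"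

lemma free_space_span:
  assumes "finite X" shows "free_space X \<subseteq> cfun.span (delta ` X)"
proof
  fix f :: "'a \<Rightarrow> complex" assume f: "f \<in> free_space X"
  have "f x = (\<Sum>y\<in>X. cscale (f y) (delta y)) x" for x
    using assms f
    by (cases "x \<in> X") (auto simp: sum_fun_apply free_space_def delta_def if_distrib cong: if_cong)
  then have "f = (\<Sum>y\<in>X. cscale (f y) (delta y))" ..
  also have "\<dots> \<in> cfun.span (delta ` X)"
    by (intro cfun.span_sum cfun.span_scale cfun.span_base imageI)
  finally show "f \<in> cfun.span (delta ` X)" .
qed

lemma finite_independent_free_space:
  assumes "finite X" "B \<subseteq> free_space X" "cfun.independent B"
  shows "finite B"
  using cfun.independent_span_bound[of "delta ` X" B] free_space_span[OF assms(1)] assms by blast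

text \<open>Pins down the basis behind \<open>SOME\<close> once and for all. Finiteness is part of
  the conclusion because a sum over an infinite basis would silently be 0.\<close>

lemma trace_on_basis:
  assumes "finite X" "cfun.subspace V" "V \<subseteq> free_space X"
  obtains B where "finite B" "cfun.independent B" "cfun.span B = V"
    "\<And>T. trace_on V T = (\<Sum>b\<in>B. cfun.representation B (T b) b)"
proof -
  define B where "B = (SOME B. cfun.independent B \<and> cfun.span B = V)"
  have "\<exists>B. cfun.independent B \<and> cfun.span B = V"
    by (meson cfun.basis_exists cfun.span_minimal assms(2) subset_antisym)
  then have B: "cfun.independent B" "cfun.span B = V"
    unfolding B_def by (metis (mono_tags, lifting) someI_ex)+
  moreover have "finite B"
    using finite_independent_free_space[OF assms(1) _ B(1)] B(2) assms(3) cfun.span_superset by blast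
  ultimately show ?thesis
    using that by (simp add: trace_on_def B_def[symmetric] Let_def)
qed

lemma trace_on_sum:
  assumes "finite X" "cfun.subspace V" "V \<subseteq> free_space X"
    and "\<And>h x. h \<in> K \<Longrightarrow> x \<in> V \<Longrightarrow> T h x \<in> V"
  shows "trace_on V (\<lambda>x. \<Sum>h\<in>K. T h x) = (\<Sum>h\<in>K. trace_on V (T h))"
proof -
  obtain B where B: "finite B" "cfun.independent B" "cfun.span B = V"
    and tr: "\<And>T. trace_on V T = (\<Sum>b\<in>B. cfun.representation B (T b) b)"
    using trace_on_basis[OF assms(1-3)] by blast
  have BV: "B \<subseteq> V" using B(3) cfun.span_superset by blast
  have "cfun.representation B (\<Sum>h\<in>K. T h b) b = (\<Sum>h\<in>K. cfun.representation B (T h b) b)" if "b \<in> B" for b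
    using that BV assms(4) by (subst cfun.representation_sum[OF B(2)]) (auto simp: B(3))
  then show ?thesis unfolding tr by (subst sum.swap) simp
qed

text \<open>The diagonal entry at a basis vector \<open>b\<close> is \<open>l b\<close> times the
  coordinate of \<open>w\<close> at \<open>b\<close>, and these products add up to \<open>l\<close>
  applied to the expansion of \<open>w\<close>.\<close>

lemma trace_on_rank_one:
  assumes "finite X" "cfun.subspace V" "V \<subseteq> free_space X" "w \<in> V"
    and add: "\<And>x y. x \<in> V \<Longrightarrow> y \<in> V \<Longrightarrow> l (x + y) = l x + l y"
    and scale: "\<And>c x. x \<in> V \<Longrightarrow> l (cscale c x) = c * l x"
    and T: "\<And>x. x \<in> V \<Longrightarrow> T x = cscale (l x) w"
  shows "trace_on V T = l w"
proof -
  obtain B where B: "finite B" "cfun.independent B" "cfun.span B = V"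
    and tr: "\<And>T. trace_on V T = (\<Sum>b\<in>B. cfun.representation B (T b) b)"
    using trace_on_basis[OF assms(1-3)] by blast
  have BV: "B \<subseteq> V" using B(3) cfun.span_superset by blast
  let ?r = "cfun.representation B w"
  have l0: "l 0 = 0"
    using scale[of 0 0] cfun.subspace_0[OF assms(2)] by (simp only: cfun.scale_zero_left mult_zero_left)
  have lsum: "(\<Sum>b\<in>A. cscale (c b) b) \<in> V \<and> l (\<Sum>b\<in>A. cscale (c b) b) = (\<Sum>b\<in>A. c b * l b)"
    if "finite A" "A \<subseteq> V" for A c
    using that
    by (induction A rule: finite_induct)
       (auto simp: l0 add scale cfun.subspace_0 cfun.subspace_add cfun.subspace_scale assms(2))
  have "trace_on V T = (\<Sum>b\<in>B. l b * ?r b)"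
    unfolding tr using BV by (intro sum.cong refl) (auto simp: T cfun.representation_scale B assms(4) subset_iff)
  also have "\<dots> = l (\<Sum>b\<in>B. cscale (?r b) b)"
    using lsum[OF B(1) BV] by (simp add: mult.commute)
  also have "(\<Sum>b\<in>B. cscale (?r b) b) = w"
    by (rule cfun.sum_representation_eq) (use B assms(4) in auto)
  finally show ?thesis .
qed

section \<open>Permutation modules and their invariant bilinear form\<close>

locale perm_action = group G for G (structure) +
  fixes a :: "'a \<Rightarrow> 'x \<Rightarrow> 'x" and X :: "'x set"
  assumes finite_carrier: "finite (carrier G)" and finite_points: "finite X"
    and act_closed: "\<And>g x. g \<in> carrier G \<Longrightarrow> x \<in> X \<Longrightarrow> a g x \<in> X"
    and act_one: "\<And>x. x \<in> X \<Longrightarrow> a \<one> x = x"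
    and act_mult: "\<And>g h x. g \<in> carrier G \<Longrightarrow> h \<in> carrier G \<Longrightarrow> x \<in> X \<Longrightarrow> a (g \<otimes> h) x = a g (a h x)"
begin

abbreviation "rep \<equiv> perm_rep G a X"

lemma act_inv [simp]: "g \<in> carrier G \<Longrightarrow> x \<in> X \<Longrightarrow> a (inv g) (a g x) = x"
  by (metis act_mult act_one inv_closed l_inv)

lemma act_inv' [simp]: "g \<in> carrier G \<Longrightarrow> x \<in> X \<Longrightarrow> a g (a (inv g) x) = x"
  by (metis act_mult act_one inv_closed r_inv)

lemma bij_act: "g \<in> carrier G \<Longrightarrow> bij_betw (a g) X X"
  by (rule bij_betw_byWitness[where f' = "a (inv g)"]) (auto simp: act_closed)

lemma sum_act: "g \<in> carrier G \<Longrightarrow> (\<Sum>x\<in>X. f (a g x)) = (\<Sum>x\<in>X. f x)"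
  by (rule sum.reindex_bij_betw[OF bij_act])

lemma rep_free_space: "rep g f \<in> free_space X"
  by (simp add: perm_rep_def free_space_def)

lemma rep_one: "f \<in> free_space X \<Longrightarrow> rep \<one> f = f"
  by (auto simp: perm_rep_def free_space_def act_one)

lemma rep_mult:
  "g \<in> carrier G \<Longrightarrow> h \<in> carrier G \<Longrightarrow> rep (g \<otimes> h) f = rep g (rep h f)"
  by (auto simp: perm_rep_def inv_mult_group act_mult act_closed)

lemma rep_add: "rep g (f + f') = rep g f + rep g f'"
  by (auto simp: perm_rep_def)

lemma rep_scale: "rep g (cscale c f) = cscale c (rep g f)"
  by (auto simp: perm_rep_def)

lemma rep_sum: "rep g (\<Sum>i\<in>I. f i) = (\<Sum>i\<in>I. rep g (f i))"
  by (auto simp: perm_rep_def sum_fun_apply)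

lemma rep_inv_rep: "g \<in> carrier G \<Longrightarrow> f \<in> free_space X \<Longrightarrow> rep (inv g) (rep g f) = f"
  by (metis inv_closed l_inv rep_mult rep_one)

lemma rep_delta:
  assumes "g \<in> carrier G" "x \<in> X"
  shows "rep g (delta x) = delta (a g x)"
proof
  fix y
  show "rep g (delta x) y = delta (a g x) y"
    using assms act_inv'[of g y] by (cases "y \<in> X") (auto simp: perm_rep_def act_closed delta_def)
qed

text \<open>Bilinear rather than Hermitian: this keeps it symmetric and linear in both arguments.
  The price is that \<open>form f f\<close> is positive only for real vectors, whence the assumption
  \<open>v_real\<close> below.\<close>

definition form :: "('x \<Rightarrow> complex) \<Rightarrow> ('x \<Rightarrow> complex) \<Rightarrow> complex" where
  "form f h = (\<Sum>x\<in>X. f x * h x)"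

lemma form_commute: "form f h = form h f"
  by (simp add: form_def mult.commute)

lemma form_add: "form (f + f') h = form f h + form f' h"
  by (simp add: form_def sum.distrib algebra_simps)

lemma form_scale: "form (cscale c f) h = c * form f h"
  by (simp add: form_def sum_distrib_left algebra_simps)

lemma form_sum: "form (\<Sum>i\<in>I. f i) h = (\<Sum>i\<in>I. form (f i) h)"
  unfolding form_def sum_fun_apply sum_distrib_right by (rule sum.swap)

lemma form_rep: "g \<in> carrier G \<Longrightarrow> form (rep g f) (rep g h) = form f h"
  using sum_act[of "inv g" "\<lambda>x. f x * h x"] by (simp add: form_def perm_rep_def)

lemma form_rep_left:
  assumes "g \<in> carrier G" "h \<in> free_space X"
  shows "form (rep g f) h = form f (rep (inv g) h)"
  using form_rep[of "inv g" "rep g f" h] form_rep[of g f "rep (inv g) h"] assms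
  by (metis inv_closed inv_inv rep_inv_rep)

end

section \<open>Averaging over a subgroup\<close>

locale subgroup_average = perm_action G a X
  for G (structure) and a :: "'a \<Rightarrow> 'x \<Rightarrow> 'x" and X +
  fixes K
  assumes subgroup: "subgroup K G"
begin

lemma K_carrier: "h \<in> K \<Longrightarrow> h \<in> carrier G"
  by (rule subgroup.mem_carrier[OF subgroup])

lemma finite_K: "finite K"
  by (rule finite_subset[OF _ finite_carrier]) (auto intro: K_carrier)

lemma card_K_pos: "card K > 0"
  using subgroup.one_closed[OF subgroup] finite_K by (auto simp: card_gt_0_iff)

definition avg :: "('x \<Rightarrow> complex) \<Rightarrow> 'x \<Rightarrow> complex" where
  "avg f = cscale (1 / of_nat (card K)) (\<Sum>h\<in>K. rep h f)"

lemma scale_avg: "(\<Sum>h\<in>K. rep h f) = cscale (of_nat (card K)) (avg f)"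
  using card_K_pos by (auto simp: avg_def)

lemma sum_translate_K:
  assumes "h \<in> K"
  shows "(\<Sum>k\<in>K. f (h \<otimes> k)) = (\<Sum>k\<in>K. f k)" "(\<Sum>k\<in>K. f (k \<otimes> h)) = (\<Sum>k\<in>K. f k)"
proof -
  have h: "h \<in> carrier G" "inv h \<in> K" "inv h \<in> carrier G"
    using assms K_carrier subgroup.m_inv_closed[OF subgroup] by auto
  have "bij_betw (\<lambda>k. h \<otimes> k) K K"
    by (rule bij_betw_byWitness[where f' = "\<lambda>k. inv h \<otimes> k"])
       (use h assms K_carrier in \<open>auto simp: m_assoc[symmetric] intro: subgroup.m_closed[OF subgroup]\<close>)
  then show "(\<Sum>k\<in>K. f (h \<otimes> k)) = (\<Sum>k\<in>K. f k)"
    by (rule sum.reindex_bij_betw)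
  have "bij_betw (\<lambda>k. k \<otimes> h) K K"
    by (rule bij_betw_byWitness[where f' = "\<lambda>k. k \<otimes> inv h"])
       (use h assms K_carrier in \<open>auto simp: m_assoc intro: subgroup.m_closed[OF subgroup]\<close>)
  then show "(\<Sum>k\<in>K. f (k \<otimes> h)) = (\<Sum>k\<in>K. f k)"
    by (rule sum.reindex_bij_betw)
qed

lemma rep_avg: "h \<in> K \<Longrightarrow> rep h (avg f) = avg f"
  using sum_translate_K(1)[of h "\<lambda>k. rep k f"]
  by (simp add: avg_def rep_scale rep_sum rep_mult[symmetric] K_carrier)

lemma avg_rep: "h \<in> K \<Longrightarrow> avg (rep h f) = avg f"
  using sum_translate_K(2)[of h "\<lambda>k. rep k f"]
  by (simp add: avg_def rep_mult[symmetric] K_carrier)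

lemma avg_in_subrep:
  assumes "subrep G rep V" "x \<in> V"
  shows "avg x \<in> V"
proof -
  have V: "cfun.subspace V" using assms(1) by (simp add: subrep_def)
  show ?thesis
    unfolding avg_def using assms K_carrier
    by (intro cfun.subspace_scale[OF V] cfun.subspace_sum[OF V]) (simp add: subrep_def)
qed

lemma avg_sum: "avg (\<Sum>i\<in>I. f i) = (\<Sum>i\<in>I. avg (f i))"
  unfolding avg_def rep_sum by (subst sum.swap) (rule cfun.scale_sum_right)

text \<open>Invariance of the form moves every \<open>h\<close> in \<open>K\<close> to the other
  argument, where \<open>v\<close> absorbs it.\<close>

lemma avg_const_form:
  assumes "v \<in> free_space X" "\<And>h. h \<in> K \<Longrightarrow> rep h v = v"
  shows "form (avg f) v = form f v"
proof -
  have "form (avg f) v = 1 / of_nat (card K) * (\<Sum>h\<in>K. form (rep h f) v)"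
    by (simp add: avg_def form_scale form_sum)
  also have "(\<Sum>h\<in>K. form (rep h f) v) = (\<Sum>h\<in>K. form f v)"
    by (rule sum.cong[OF refl]) (metis assms(2) K_carrier form_rep)
  finally show ?thesis using card_K_pos by simp
qed

end

section \<open>Modules whose \<open>K\<close>-invariants form a line\<close>

locale spherical_module = subgroup_average G a X K
  for G (structure) and a :: "'a \<Rightarrow> 'x \<Rightarrow> 'x" and X K +
  fixes V ev v
  assumes V_subrep: "subrep G rep V" and V_free: "V \<subseteq> free_space X"
    and symmetric: "\<And>g. g \<in> carrier G \<Longrightarrow> \<exists>h\<in>K. \<exists>h'\<in>K. inv g = h \<otimes> g \<otimes> h'"
    and schur: "\<And>T. (\<And>f f'. T (f + f') = T f + T f') \<Longrightarrow> (\<And>c f. T (cscale c f) = cscale c (T f)) \<Longrightarrow>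
      (\<And>f. f \<in> free_space X \<Longrightarrow> T f \<in> free_space X) \<Longrightarrow>
      (\<And>g f. g \<in> carrier G \<Longrightarrow> f \<in> free_space X \<Longrightarrow> T (rep g f) = rep g (T f)) \<Longrightarrow>
      \<exists>c. \<forall>f\<in>V. T f = cscale c f"
    and ev_add: "\<And>f f'. ev (f + f') = ev f + ev f'"
    and ev_scale: "\<And>c f. ev (cscale c f) = c * ev f"
    and ev_rep: "\<And>h f. h \<in> K \<Longrightarrow> f \<in> free_space X \<Longrightarrow> ev (rep h f) = ev f"
    and v_in: "v \<in> V" and v_inv: "\<And>h. h \<in> K \<Longrightarrow> rep h v = v" and ev_v: "ev v = 1"
    and v_real: "\<And>x. v x \<in> \<real>"
begin

lemma ev_zero: "ev 0 = 0"
  using ev_scale[of 0 0] by (simp only: cfun.scale_zero_left mult_zero_left)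

lemma V_subspace: "cfun.subspace V"
  using V_subrep by (simp add: subrep_def)

lemma rep_in_V: "g \<in> carrier G \<Longrightarrow> x \<in> V \<Longrightarrow> rep g x \<in> V"
  using V_subrep by (simp add: subrep_def)

text \<open>Up to the factor \<open>card (carrier G)\<close>, the average over \<open>g\<close> of
  the rank-one operator \<open>f \<mapsto> cscale (form f u) v\<close> conjugated by
  \<open>rep g\<close>; such an average commutes with the group.\<close>

definition intertwiner :: "('x \<Rightarrow> complex) \<Rightarrow> ('x \<Rightarrow> complex) \<Rightarrow> 'x \<Rightarrow> complex" where
  "intertwiner u f = (\<Sum>g\<in>carrier G. cscale (form f (rep g u)) (rep g v))"

text \<open>Evaluating \<open>intertwiner v u\<close> for a \<open>K\<close>-invariant vector \<open>u\<close> and using that the matrix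
  coefficients are symmetric gives \<open>intertwiner v u = intertwiner u v\<close>; as both operators are
  scalars, \<open>u\<close> is a multiple of \<open>v\<close>.\<close>

lemma intertwiner_scalar:
  assumes "u \<in> V" shows "\<exists>c. \<forall>f\<in>V. intertwiner u f = cscale c f"
proof (rule schur)
  show "intertwiner u (f + f') = intertwiner u f + intertwiner u f'" for f f'
    by (simp add: intertwiner_def form_add cfun.scale_left_distrib sum.distrib)
  show "intertwiner u (cscale c f) = cscale c (intertwiner u f)" for c f
    by (simp add: intertwiner_def form_scale cfun.scale_sum_right)
  show "intertwiner u f \<in> free_space X" for f
    unfolding intertwiner_def
    by (intro cfun.subspace_sum[OF free_space_subspace] cfun.subspace_scale[OF free_space_subspace] rep_free_space)
  fix g f assume g: "g \<in> carrier G" and f: "f \<in> free_space X"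
  have "bij_betw (\<lambda>h. g \<otimes> h) (carrier G) (carrier G)"
    by (rule bij_betw_byWitness[where f' = "\<lambda>h. inv g \<otimes> h"]) (use g in \<open>auto simp: m_assoc[symmetric]\<close>)
  then have "intertwiner u (rep g f) =
      (\<Sum>h\<in>carrier G. cscale (form (rep g f) (rep (g \<otimes> h) u)) (rep (g \<otimes> h) v))"
    unfolding intertwiner_def by (rule sum.reindex_bij_betw[symmetric])
  also have "\<dots> = rep g (intertwiner u f)"
    using g by (simp add: intertwiner_def rep_sum rep_scale rep_mult form_rep)
  finally show "intertwiner u (rep g f) = rep g (intertwiner u f)" .
qed

text \<open>Moving \<open>g\<close> across the form replaces it by its inverse. Writing that inverse
  as \<open>h \<otimes> g \<otimes> h'\<close>, the two factors from \<open>K\<close> are absorbed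
  by the invariant vectors, which leaves \<open>g\<close> again: Gelfand's trick on matrix
  coefficients.\<close>

lemma form_symmetric:
  assumes "g \<in> carrier G" "u \<in> V" "u' \<in> V"
    and "\<And>h. h \<in> K \<Longrightarrow> rep h u = u" "\<And>h. h \<in> K \<Longrightarrow> rep h u' = u'"
  shows "form u (rep g u') = form u' (rep g u)"
proof -
  have free: "u \<in> free_space X" "u' \<in> free_space X" using assms V_free by auto
  obtain h h' where h: "h \<in> K" "h' \<in> K" "inv g = h \<otimes> g \<otimes> h'"
    using symmetric assms(1) by blast
  then have hc: "h \<in> carrier G" "h' \<in> carrier G" using K_carrier by auto
  have "form u (rep g u') = form (rep (inv g) u) u'"
    using form_rep_left[of "inv g" u' u] assms(1) free by simp
  also have "\<dots> = form (rep h (rep g u)) (rep h u')"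
    using h hc assms by (simp add: rep_mult)
  finally show ?thesis using form_rep hc form_commute by simp
qed

text \<open>Pairing \<open>intertwiner v v\<close> with \<open>v\<close> gives on one side
  \<open>c * form v v\<close> and on the other the sum of the squares of the real numbers
  \<open>form v (rep g v)\<close>. The term at the unit element is positive, so \<open>c\<close>
  cannot vanish.\<close>

lemma intertwiner_v_nonzero:
  obtains c where "c \<noteq> 0" "\<And>f. f \<in> V \<Longrightarrow> intertwiner v f = cscale c f"
proof -
  obtain c where c: "\<forall>f\<in>V. intertwiner v f = cscale c f"
    using intertwiner_scalar[OF v_in] by blast
  have vfree: "v \<in> free_space X" using v_in V_free by auto
  have real: "form v (rep g v) \<in> \<real>" for g
    by (auto simp: form_def perm_rep_def v_real intro!: sum_in_Reals Reals_mult)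
  have sq: "Re (form v (rep g v) ^ 2) = (Re (form v (rep g v))) ^ 2" for g
    using real[of g] by (auto elim!: Reals_cases simp flip: of_real_power)
  have "c * form v v = form (intertwiner v v) v"
    using c v_in by (simp add: form_scale)
  also have "\<dots> = (\<Sum>g\<in>carrier G. form v (rep g v) ^ 2)"
    unfolding intertwiner_def form_sum form_scale power2_eq_square
    by (simp add: form_commute[of _ v])
  finally have eq: "Re (c * form v v) = (\<Sum>g\<in>carrier G. (Re (form v (rep g v))) ^ 2)"
    by (simp add: sq)
  have "v \<noteq> 0" using ev_v ev_zero by (metis zero_neq_one)
  then obtain x where x: "v x \<noteq> 0" by (auto simp: fun_eq_iff)
  then have xX: "x \<in> X" using vfree by (auto simp: free_space_def)
  have "Re (form v v) = (\<Sum>y\<in>X. (Re (v y)) ^ 2)"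
    unfolding form_def Re_sum
    by (intro sum.cong refl) (use v_real in \<open>auto simp: complex_is_Real_iff power2_eq_square\<close>)
  also have "\<dots> > 0"
  proof (rule sum_pos2[OF finite_points xX])
    show "0 < (Re (v x))\<^sup>2" using x v_real[of x] by (auto simp: complex_is_Real_iff complex_eq_iff)
  qed simp
  finally have "Re (form v v) > 0" .
  then have "(\<Sum>g\<in>carrier G. (Re (form v (rep g v))) ^ 2) > 0"
    using rep_one[OF vfree] by (intro sum_pos2[OF finite_carrier one_closed]) simp_all
  then have "c \<noteq> 0" using eq by auto
  with c that show ?thesis by blast
qed

lemma invariant_multiple:
  assumes "u \<in> V" "\<And>h. h \<in> K \<Longrightarrow> rep h u = u"
  shows "u = cscale (ev u) v"
proof -
  obtain c where c: "c \<noteq> 0" "\<And>f. f \<in> V \<Longrightarrow> intertwiner v f = cscale c f"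
    using intertwiner_v_nonzero by blast
  obtain d where d: "\<forall>f\<in>V. intertwiner u f = cscale d f"
    using intertwiner_scalar[OF assms(1)] by blast
  have "cscale c u = intertwiner v u" using c assms by simp
  also have "\<dots> = intertwiner u v"
    unfolding intertwiner_def
    by (intro sum.cong refl) (simp add: form_symmetric[OF _ assms(1) v_in assms(2) v_inv])
  also have "\<dots> = cscale d v" using d v_in by simp
  finally have eq: "cscale c u = cscale d v" .
  \<comment> \<open>Since \<open>ev v = 1\<close>, evaluation expresses the unknown \<open>d\<close>
    through \<open>c\<close>, which then cancels.\<close>
  have "c * ev u = d" using arg_cong[OF eq, of ev] by (simp add: ev_scale ev_v)
  then have "cscale c u = cscale c (cscale (ev u) v)" using eq by auto
  with c(1) show ?thesis by (simp only: cfun.scale_left_imp_eq)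
qed

text \<open>An average is invariant, hence a multiple of \<open>v\<close>, and \<open>ev\<close>
  does not notice averaging. On \<open>V\<close> the average is thus a projection of rank one, which
  is what turns traces into values of \<open>ev\<close>.\<close>

lemma avg_eq_ev:
  assumes "x \<in> V" shows "avg x = cscale (ev x) v"
proof -
  have "ev (\<Sum>h\<in>K'. rep h x) = (\<Sum>h\<in>K'. ev (rep h x))" if "finite K'" for K'
    using that by (induction K' rule: finite_induct) (simp_all only: sum.empty sum.insert ev_add ev_zero simp_thms)
  then have "ev (avg x) = 1 / of_nat (card K) * (\<Sum>h\<in>K. ev (rep h x))"
    by (simp only: avg_def ev_scale finite_K)
  also have "(\<Sum>h\<in>K. ev (rep h x)) = (\<Sum>h\<in>K. ev x)"
    using assms V_free by (intro sum.cong refl ev_rep) auto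
  finally have "ev (avg x) = ev x"
    using card_K_pos by simp
  then show ?thesis
    using invariant_multiple[OF avg_in_subrep[OF V_subrep assms] rep_avg] by (simp only:)
qed

text \<open>If \<open>ev\<close> kills all translates of \<open>x\<close>, their averages vanish, so
  \<open>x\<close> is orthogonal to the whole orbit of \<open>v\<close>. Then
  \<open>intertwiner v x = 0\<close>, although this operator is a nonzero scalar on
  \<open>V\<close>. This will make \<Phi> injective on \<open>V\<close>.\<close>

lemma ev_separates:
  assumes "x \<in> V" "\<And>g. g \<in> carrier G \<Longrightarrow> ev (rep g x) = 0"
  shows "x = 0"
proof -
  obtain c where c: "c \<noteq> 0" "\<And>f. f \<in> V \<Longrightarrow> intertwiner v f = cscale c f"
    using intertwiner_v_nonzero by blast
  have vfree: "v \<in> free_space X" using v_in V_free by auto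
  have "form x (rep g v) = 0" if g: "g \<in> carrier G" for g
  proof -
    have "form x (rep g v) = form (rep (inv g) x) v"
      using form_rep_left[of "inv g" v x] g vfree by simp
    also have "\<dots> = form (avg (rep (inv g) x)) v"
      using avg_const_form[OF vfree v_inv] by simp
    also have "\<dots> = 0"
      using avg_eq_ev[OF rep_in_V[OF _ assms(1)], of "inv g"] assms(2)[of "inv g"] g by (simp add: form_def)
    finally show ?thesis .
  qed
  then have "cscale c x = 0"
    using c(2)[OF assms(1)] by (simp add: intertwiner_def)
  with c(1) show ?thesis by (simp add: fun_eq_iff)
qed

text \<open>An invariant functional has the same value at \<open>x\<close> and at its average
  \<open>cscale (ev x) v\<close>. Linearity is asked for on \<open>V\<close> alone, since the maps
  provided by \<open>rep_iso\<close> are known to be linear only there.\<close>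

lemma functional_multiple:
  assumes "x \<in> V"
    and "\<And>x y. x \<in> V \<Longrightarrow> y \<in> V \<Longrightarrow> f (x + y) = f x + f y"
    and "\<And>c x. x \<in> V \<Longrightarrow> f (cscale c x) = c * f x"
    and "\<And>h x. h \<in> K \<Longrightarrow> x \<in> V \<Longrightarrow> f (rep h x) = f x"
  shows "f x = f v * ev x"
proof -
  have f0: "f 0 = 0"
    using assms(3)[of 0 0] cfun.subspace_0[OF V_subspace] by (simp only: cfun.scale_zero_left mult_zero_left)
  have "f (\<Sum>h\<in>K'. rep h x) = (\<Sum>h\<in>K'. f (rep h x))" if "finite K'" "K' \<subseteq> K" for K'
    using that
  proof (induction K' rule: finite_induct)
    case (insert h K')
    have "(\<Sum>h\<in>K'. rep h x) \<in> V"
      using insert.prems by (intro cfun.subspace_sum[OF V_subspace] rep_in_V K_carrier assms(1)) auto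
    with insert assms(1,2) rep_in_V K_carrier show ?case
      by (simp only: sum.insert insert_subset simp_thms)
  qed (simp only: f0 sum.empty)
  then have sum: "f (\<Sum>h\<in>K. rep h x) = (\<Sum>h\<in>K. f (rep h x))"
    using finite_K by blast
  have "(\<Sum>h\<in>K. rep h x) \<in> V"
    using assms(1) by (intro cfun.subspace_sum[OF V_subspace] rep_in_V K_carrier)
  then have "f (avg x) = 1 / of_nat (card K) * (\<Sum>h\<in>K. f (rep h x))"
    unfolding avg_def sum[symmetric] by (rule assms(3))
  also have "(\<Sum>h\<in>K. f (rep h x)) = (\<Sum>h\<in>K. f x)"
    using assms(1) by (intro sum.cong refl assms(4))
  finally have "f (avg x) = f x"
    using card_K_pos by simp
  then show ?thesis
    using assms(3)[OF v_in, of "ev x"] by (simp only: avg_eq_ev[OF assms(1)] mult.commute)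
qed

text \<open>Summing before taking the trace leaves \<open>rep (inv g)\<close> after
  \<open>card K\<close> times the average: the rank-one operator with functional
  \<open>card K * ev\<close> and vector \<open>rep (inv g) v\<close>.\<close>

lemma average_trace:
  assumes g: "g \<in> carrier G"
  shows "1 / of_nat (card K) * (\<Sum>h\<in>K. trace_on V (rep (inv g \<otimes> h))) = ev (rep (inv g) v)"
proof -
  have "(\<Sum>h\<in>K. trace_on V (rep (inv g \<otimes> h))) = trace_on V (\<lambda>x. \<Sum>h\<in>K. rep (inv g \<otimes> h) x)"
    using g by (intro trace_on_sum[symmetric, OF finite_points V_subspace V_free] rep_in_V) (auto simp: K_carrier)
  also have "\<dots> = of_nat (card K) * ev (rep (inv g) v)"
  proof (rule trace_on_rank_one[OF finite_points V_subspace V_free, where l = "\<lambda>x. of_nat (card K) * ev x"])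
    show "rep (inv g) v \<in> V" using g v_in by (simp add: rep_in_V)
    fix x assume "x \<in> V"
    then show "(\<Sum>h\<in>K. rep (inv g \<otimes> h) x) = cscale (of_nat (card K) * ev x) (rep (inv g) v)"
      using g by (simp add: rep_mult K_carrier rep_sum[symmetric] scale_avg avg_eq_ev rep_scale)
  qed (auto simp: ev_add ev_scale algebra_simps)
  finally show ?thesis using card_K_pos by simp
qed

end

section \<open>Cycle-path types and conjugacy\<close>

text \<open>Serves to pair off the cycles, and likewise the paths, of two unions of equal type. The
  induction removes one element on the left together with an element on the right that carries the
  same label.\<close>

lemma image_mset_mset_set_eq_bij:
  assumes "finite A" "finite B" "image_mset f (mset_set A) = image_mset g (mset_set B)"
  obtains h where "bij_betw h A B" "\<And>x. x \<in> A \<Longrightarrow> g (h x) = f x"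
proof -
  have "\<exists>h. bij_betw h A B \<and> (\<forall>x\<in>A. g (h x) = f x)"
    using assms
  proof (induction A arbitrary: B rule: finite_induct)
    case empty
    then have "B = {}" by (simp add: mset_set_empty_iff)
    then show ?case by (simp add: bij_betw_def)
  next
    case (insert a A)
    have "f a \<in># image_mset g (mset_set B)"
      using insert.prems(2) insert.hyps by (metis image_eqI insertI1 finite_insert finite_set_mset_mset_set set_image_mset)
    then obtain b where b: "b \<in> B" "g b = f a"
      using insert.prems(1) by auto
    have B: "B = insert b (B - {b})" using b by auto
    have "mset_set B = add_mset b (mset_set (B - {b}))"
      by (subst B, rule mset_set.insert) (use insert.prems(1) in auto)
    then have "image_mset f (mset_set A) = image_mset g (mset_set (B - {b}))"
      using insert b by simp
    then obtain h where h: "bij_betw h A (B - {b})" "\<forall>x\<in>A. g (h x) = f x"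
      using insert.IH[of "B - {b}"] insert.prems(1) by auto
    define h' where "h' = h(a := b)"
    have "bij_betw h' A (B - {b})"
      using h(1) insert.hyps(2) by (subst bij_betw_cong[of _ _ h]) (auto simp: h'_def)
    then have "bij_betw h' (insert a A) (insert b (B - {b}))"
      using insert.hyps(2) notIn_Un_bij_betw[of a A h' "B - {b}"] by (simp add: h'_def)
    moreover have "\<forall>x\<in>insert a A. g (h' x) = f x"
      using h(2) b insert.hyps(2) by (auto simp: h'_def)
    ultimately show ?case
      using B by metis
  qed
  with that show ?thesis by blast
qed

text \<open>An isomorphism of multigraphs, with the bijection of edges as separate data because a
  common edge of the two injections counts twice. It covers both the exchange of the two injections
  and the action of the group.\<close>

lemma cycle_path_type_iso:
  assumes \<phi>: "bij \<phi>" "\<phi> ` union_verts k n = union_verts k n"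
    and \<epsilon>: "bij_betw \<epsilon> (union_edges k) (union_edges k)"
    and ends: "\<And>e. e \<in> union_edges k \<Longrightarrow> edge_ends \<tau> \<tau>' (\<epsilon> e) = \<phi> ` edge_ends \<sigma> \<sigma>' e"
  shows "cycle_path_type k n \<tau> \<tau>' = cycle_path_type k n \<sigma> \<sigma>'"
proof -
  let ?A = "union_adjacency k \<sigma> \<sigma>'" and ?A' = "union_adjacency k \<tau> \<tau>'"
  have inj: "inj \<phi>" using \<phi>(1) by (rule bij_is_inj)
  have edges: "union_edges k = \<epsilon> ` union_edges k"
    using \<epsilon> by (auto simp: bij_betw_def)
  have adj: "(\<phi> u, \<phi> v) \<in> ?A' \<longleftrightarrow> (u, v) \<in> ?A" for u v
  proof -
    have "(\<phi> u, \<phi> v) \<in> ?A' \<longleftrightarrow> (\<exists>e\<in>\<epsilon> ` union_edges k. edge_ends \<tau> \<tau>' e = \<phi> ` {u, v})"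
      unfolding edges[symmetric] by (simp add: union_adjacency_def)
    also have "\<dots> \<longleftrightarrow> (\<exists>e\<in>union_edges k. \<phi> ` edge_ends \<sigma> \<sigma>' e = \<phi> ` {u, v})"
      using ends by (metis (no_types, lifting) imageE image_eqI)
    also have "\<dots> \<longleftrightarrow> (u, v) \<in> ?A"
      unfolding inj_image_eq_iff[OF inj] by (simp add: union_adjacency_def)
    finally show ?thesis .
  qed
  have reach: "(\<phi> u, \<phi> v) \<in> ?A'\<^sup>* \<longleftrightarrow> (u, v) \<in> ?A\<^sup>*" for u v
  proof
    assume "(u, v) \<in> ?A\<^sup>*"
    then show "(\<phi> u, \<phi> v) \<in> ?A'\<^sup>*"
      by induction (auto simp: adj intro: rtrancl_into_rtrancl)
  next
    have "(x, y) \<in> ?A'\<^sup>* \<Longrightarrow> (inv' \<phi> x, inv' \<phi> y) \<in> ?A\<^sup>*" for x y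
    proof (induction rule: rtrancl_induct)
      case (step y z)
      have "(inv' \<phi> y, inv' \<phi> z) \<in> ?A"
        using step(2) adj[of "inv' \<phi> y" "inv' \<phi> z"] by (simp add: surj_f_inv_f bij_is_surj \<phi>(1))
      with step(3) show ?case by (rule rtrancl_into_rtrancl)
    qed simp
    from this[of "\<phi> u" "\<phi> v"] show "(\<phi> u, \<phi> v) \<in> ?A'\<^sup>* \<Longrightarrow> (u, v) \<in> ?A\<^sup>*"
      by (simp add: inv_f_f inj)
  qed
  have "?A'\<^sup>* `` {\<phi> v} = \<phi> ` (?A\<^sup>* `` {v})" for v
  proof (rule Set.set_eqI)
    fix w
    obtain u where "w = \<phi> u" using bij_is_surj[OF \<phi>(1)] by (meson surjD)
    then show "w \<in> ?A'\<^sup>* `` {\<phi> v} \<longleftrightarrow> w \<in> \<phi> ` (?A\<^sup>* `` {v})"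
      by (auto simp: reach inj_eq[OF inj])
  qed
  then have comps: "union_components k n \<tau> \<tau>' = (`) \<phi> ` union_components k n \<sigma> \<sigma>'"
    unfolding union_components_def by (subst \<phi>(2)[symmetric]) (simp add: image_image)
  \<comment> \<open>Degrees and component lengths both count edges by a property of their set of
    ends, so one transport statement serves both.\<close>
  have count: "card {e \<in> union_edges k. P (edge_ends \<tau> \<tau>' e)} =
      card {e \<in> union_edges k. P (\<phi> ` edge_ends \<sigma> \<sigma>' e)}" for P
  proof -
    have "{e \<in> union_edges k. P (edge_ends \<tau> \<tau>' e)} = \<epsilon> ` {e \<in> union_edges k. P (\<phi> ` edge_ends \<sigma> \<sigma>' e)}"
      using ends by (subst edges) auto
    moreover have "inj_on \<epsilon> {e \<in> union_edges k. P (\<phi> ` edge_ends \<sigma> \<sigma>' e)}"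
      using \<epsilon> by (auto simp: bij_betw_def intro: inj_on_subset)
    ultimately show ?thesis by (simp add: card_image)
  qed
  have deg: "union_degree k \<tau> \<tau>' (\<phi> v) = union_degree k \<sigma> \<sigma>' v" for v
    using count[of "\<lambda>x. \<phi> v \<in> x"] by (simp add: union_degree_def inj_image_mem_iff[OF inj])
  have len: "component_length k \<tau> \<tau>' (\<phi> ` C) = component_length k \<sigma> \<sigma>' C" for C
    using count[of "\<lambda>x. x \<subseteq> \<phi> ` C"] by (simp add: component_length_def inj_image_subset_iff[OF inj])
  have cyc: "is_cycle_component k \<tau> \<tau>' (\<phi> ` C) = is_cycle_component k \<sigma> \<sigma>' C" for C
    by (simp add: is_cycle_component_def deg)
  have part: "image_mset (\<lambda>C. component_length k \<tau> \<tau>' C div 2) (mset_set {C \<in> union_components k n \<tau> \<tau>'. P (is_cycle_component k \<tau> \<tau>' C)})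
      = image_mset (\<lambda>C. component_length k \<sigma> \<sigma>' C div 2) (mset_set {C \<in> union_components k n \<sigma> \<sigma>'. P (is_cycle_component k \<sigma> \<sigma>' C)})" for P
  proof -
    let ?S = "{C \<in> union_components k n \<sigma> \<sigma>'. P (is_cycle_component k \<sigma> \<sigma>' C)}"
    have "{C \<in> union_components k n \<tau> \<tau>'. P (is_cycle_component k \<tau> \<tau>' C)} = (`) \<phi> ` ?S"
      unfolding comps by (auto simp: cyc)
    moreover have "inj_on ((`) \<phi>) ?S"
      by (rule inj_onI) (simp add: inj_image_eq_iff[OF inj])
    then have "mset_set ((`) \<phi> ` ?S) = image_mset ((`) \<phi>) (mset_set ?S)"
      by (simp add: image_mset_mset_set)
    ultimately show ?thesis
      by (simp add: multiset.map_comp comp_def len)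
  qed
  show ?thesis
    unfolding cycle_path_type_def using part[of "\<lambda>b. b"] part[of Not] by simp
qed

lemma cycle_path_type_commute: "cycle_path_type k n \<sigma> \<sigma>' = cycle_path_type k n \<sigma>' \<sigma>"
proof (rule cycle_path_type_iso[where \<phi> = id and \<epsilon> = "\<lambda>(b, i). (\<not> b, i)"])
  show "bij_betw (\<lambda>(b, i). (\<not> b, i)) (union_edges k) (union_edges k)"
    by (rule bij_betw_byWitness[where f' = "\<lambda>(b, i). (\<not> b, i)"]) (auto simp: union_edges_def)
qed (auto simp: edge_ends_def)

lemma cycle_path_type_act:
  assumes "\<pi> permutes {1..k}" "\<rho> permutes {1..n}"
  shows "cycle_path_type k n (inj_act k (\<pi>, \<rho>) \<sigma>) (inj_act k (\<pi>, \<rho>) \<sigma>') = cycle_path_type k n \<sigma> \<sigma>'"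
proof (rule cycle_path_type_iso[where \<phi> = "map_sum \<pi> \<rho>" and \<epsilon> = "map_prod id \<pi>"])
  have "bij \<pi>" "bij \<rho>" using assms by (auto intro: permutes_bij)
  then show "bij (map_sum \<pi> \<rho>)"
    by (intro o_bij[of "map_sum (inv' \<pi>) (inv' \<rho>)"])
       (simp_all add: fun_eq_iff split_sum_all bij_is_inj bij_is_surj surj_f_inv_f inv_f_f)
  show "map_sum \<pi> \<rho> ` union_verts k n = union_verts k n"
    using permutes_image[OF assms(1)] permutes_image[OF assms(2)]
    by (simp add: union_verts_def Plus_def image_Un image_image) (simp flip: image_image)
  show "bij_betw (map_prod id \<pi>) (union_edges k) (union_edges k)"
    unfolding union_edges_def by (intro bij_betw_map_prod) (rule bij_betw_id permutes_imp_bij assms)+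
  fix e :: "bool \<times> nat" assume e: "e \<in> union_edges k"
  obtain b i where bi: "e = (b, i)" by fastforce
  have "\<pi> i \<in> {1..k}" using e assms(1) bi by (simp only: permutes_in_image) (auto simp: union_edges_def)
  then show "edge_ends (inj_act k (\<pi>, \<rho>) \<sigma>) (inj_act k (\<pi>, \<rho>) \<sigma>') (map_prod id \<pi> e) = map_sum \<pi> \<rho> ` edge_ends \<sigma> \<sigma>' e"
    using permutes_inverses(2)[OF assms(1)] by (simp add: bi edge_ends_def inj_act_def)
qed

section \<open>Orbits of a partial injection\<close>

text \<open>In the union of \<open>\<sigma>\<close> with the identity injection the vertices \<open>Inl i\<close> and \<open>Inr i\<close> are adjacent,
  so a component is determined by its right vertices.  These form an orbit of the partial injection
  \<open>\<sigma>\<close>: a minimal nonempty set closed under \<open>\<sigma>\<close> and its inverse.\<close>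

definition partial_orbit :: "nat set \<Rightarrow> (nat \<Rightarrow> nat) \<Rightarrow> nat set \<Rightarrow> bool" where
  "partial_orbit S f R \<longleftrightarrow> R \<noteq> {} \<and>
     (\<forall>x\<in>S. x \<in> R \<longleftrightarrow> f x \<in> R) \<and>
     (\<forall>D\<subseteq>R. D \<noteq> {} \<longrightarrow> (\<forall>x\<in>S. x \<in> D \<longleftrightarrow> f x \<in> D) \<longrightarrow> D = R)"

lemma partial_orbit_eqI:
  assumes "partial_orbit S f R" "D \<subseteq> R" "D \<noteq> {}" "\<And>x. x \<in> S \<Longrightarrow> x \<in> D \<longleftrightarrow> f x \<in> D"
  shows "D = R"
  using assms by (simp add: partial_orbit_def)

text \<open>Injectivity strips one application of \<open>f\<close> at a time from both sides. Only
  the iterates before \<open>j\<close> have to lie in \<open>S\<close>, since the last one is never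
  fed into \<open>f\<close>.\<close>

lemma funpow_cancel:
  assumes "inj_on f S" "\<And>m. m < j \<Longrightarrow> (f ^^ m) x \<in> S" "i \<le> j" "(f ^^ i) x = (f ^^ j) x"
  shows "(f ^^ (j - i)) x = x"
  using assms(2-4)
proof (induction i arbitrary: j)
  case (Suc i)
  then obtain j' where j': "j = Suc j'" by (cases j) auto
  with Suc.prems have "(f ^^ i) x = (f ^^ j') x"
    using inj_onD[OF assms(1), of "(f ^^ i) x" "(f ^^ j') x"] by (simp add: less_Suc_eq_le)
  then show ?case using Suc.IH[of j'] Suc.prems j' by auto
qed simp

text \<open>Iterating from any point never leaves \<open>R\<close>, finiteness forces a repetition,
  and by injectivity the first repetition is a return to the start. The iterates up to that time
  \<open>L\<close> are closed in both directions, so minimality makes them all of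
  \<open>R\<close>.\<close>

lemma partial_orbit_cycle:
  assumes R: "partial_orbit S f R" and fin: "finite R" and inj: "inj_on f S" and RS: "R \<subseteq> S"
  obtains p where "bij_betw p {..<card R} R" "\<And>m. m < card R \<Longrightarrow> f (p m) = p (Suc m mod card R)"
proof -
  obtain x where x: "x \<in> R" using R by (auto simp: partial_orbit_def)
  define p where "p m = (f ^^ m) x" for m
  have pR: "p m \<in> R" for m
    using x R RS by (induction m) (auto simp: p_def partial_orbit_def)
  have "\<not> inj_on p UNIV"
    using finite_imageD[of p UNIV] finite_subset[OF _ fin, of "range p"] pR by auto
  then obtain i j where ij: "i < j" "p i = p j"
    by (auto simp: inj_on_def) (metis linorder_neqE_nat)
  have cancel: "p (j - i) = x" if "i \<le> j" "p i = p j" for i j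
    using funpow_cancel[OF inj, of j x i] pR RS that unfolding p_def by blast
  define L where "L = (LEAST m. m > 0 \<and> p m = x)"
  have "\<exists>m. m > 0 \<and> p m = x" using cancel[of i j] ij by (intro exI[of _ "j - i"]) auto
  then have L: "L > 0" "p L = x" unfolding L_def by (metis (mono_tags, lifting) LeastI_ex)+
  have least: "L \<le> m" if "m > 0" "p m = x" for m
    unfolding L_def using that by (intro Least_le) auto
  have p_Suc: "p (Suc m) = f (p m)" for m by (simp add: p_def)
  have p0: "p 0 = x" by (simp add: p_def)
  have "i = j" if "i \<le> j" "j < L" "p i = p j" for i j
    using cancel[OF that(1,3)] least[of "j - i"] that by (cases "j - i = 0") auto
  then have pinj: "inj_on p {..<L}"
    by (auto simp: inj_on_def) (metis nat_le_linear)
  have step: "f (p m) = p (Suc m mod L)" if "m < L" for m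
    using that L p0 by (cases "Suc m = L") (auto simp flip: p_Suc)
  have "p ` {..<L} = R"
  proof -
    have "y \<in> p ` {..<L} \<longleftrightarrow> f y \<in> p ` {..<L}" if y: "y \<in> S" for y
    proof
      assume "y \<in> p ` {..<L}"
      then show "f y \<in> p ` {..<L}" using step L by auto
    next
      assume "f y \<in> p ` {..<L}"
      then obtain m where m: "m < L" "f y = p m" by auto
      have "\<exists>m'<L. p m = f (p m')"
      proof (cases m)
        case 0
        then show ?thesis using L p0 p_Suc[of "L - 1"] by (intro exI[of _ "L - 1"]) auto
      next
        case (Suc m')
        then show ?thesis using m p_Suc by (intro exI[of _ m']) auto
      qed
      then show "y \<in> p ` {..<L}" using m inj_onD[OF inj, of y] y pR RS by auto
    qed
    moreover have "p ` {..<L} \<subseteq> R" "p ` {..<L} \<noteq> {}" using pR L by auto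
    ultimately show ?thesis by (intro partial_orbit_eqI[OF R])
  qed
  with pinj have bij: "bij_betw p {..<L} R" by (simp add: bij_betw_def)
  then have "card R = L" using bij_betw_same_card by fastforce
  with bij step that show ?thesis by auto
qed

lemma partial_orbit_path:
  assumes R: "partial_orbit S f R" and fin: "finite R" and inj: "inj_on f S"
    and not_cyc: "\<not> R \<subseteq> S \<inter> f ` S"
  obtains p where "bij_betw p {..card (R \<inter> S)} R" "p (card (R \<inter> S)) \<notin> S"
    "\<And>m. m < card (R \<inter> S) \<Longrightarrow> p m \<in> S \<and> f (p m) = p (Suc m)"
proof -
  have "\<exists>x\<in>R. x \<notin> f ` S"
  proof (rule ccontr)
    assume "\<not> (\<exists>x\<in>R. x \<notin> f ` S)"
    then have "f ` (R \<inter> S) = R"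
      using R unfolding partial_orbit_def by auto
    then have "card (R \<inter> S) = card R"
      using card_image[OF inj_on_subset[OF inj], of "R \<inter> S"] by simp
    then have "R \<inter> S = R" using card_subset_eq[OF fin] by blast
    with \<open>\<not> (\<exists>x\<in>R. x \<notin> f ` S)\<close> not_cyc show False by blast
  qed
  then obtain x where x: "x \<in> R" "x \<notin> f ` S" by blast
  define p where "p m = (f ^^ m) x" for m
  have p_Suc: "p (Suc m) = f (p m)" for m by (simp add: p_def)
  have p0: "p 0 = x" by (simp add: p_def)
  have pR: "p m \<in> R" if "\<And>i. i < m \<Longrightarrow> p i \<in> S" for m
    using that
  proof (induction m)
    case (Suc m)
    then show ?case using R by (auto simp: partial_orbit_def p_Suc)
  qed (simp add: p0 x)
  \<comment> \<open>A coincidence would cancel down to a return to \<open>x\<close> and so give the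
    source a preimage.\<close>
  have distinct: "i = j" if inS: "\<And>m. m < j \<Longrightarrow> p m \<in> S" and le: "i \<le> j" and eq: "p i = p j" for i j
  proof (rule ccontr)
    assume "i \<noteq> j"
    then obtain d where d: "j - i = Suc d" using le by (metis Suc_pred diff_is_0_eq le_antisym neq0_conv)
    have "p (j - i) = x" using funpow_cancel[OF inj, of j x i] inS le eq unfolding p_def by blast
    then have "f (p d) = x" by (simp add: d p_Suc)
    moreover have "p d \<in> S" using d inS[of d] by simp
    ultimately show False using x by blast
  qed
  have "\<exists>m. p m \<notin> S"
  proof (rule ccontr)
    assume all: "\<not> (\<exists>m. p m \<notin> S)"
    then have "inj p" using distinct by (auto simp: inj_on_def) (metis nat_le_linear)
    then show False using finite_imageD[of p UNIV] finite_subset[OF _ fin, of "range p"] pR all by auto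
  qed
  define L where "L = (LEAST m. p m \<notin> S)"
  have L: "p L \<notin> S" unfolding L_def using \<open>\<exists>m. p m \<notin> S\<close> by (rule LeastI_ex)
  have inS: "p m \<in> S" if "m < L" for m
    using not_less_Least[of m "\<lambda>m. p m \<notin> S"] that unfolding L_def by blast
  have "i = j" if "i \<le> j" "j \<le> L" "p i = p j" for i j
    using distinct[of j i] inS that by auto
  then have pinj: "inj_on p {..L}"
    by (auto simp: inj_on_def) (metis nat_le_linear)
  have "p ` {..L} = R"
  proof -
    have "y \<in> p ` {..L} \<longleftrightarrow> f y \<in> p ` {..L}" if y: "y \<in> S" for y
    proof
      assume "y \<in> p ` {..L}"
      then obtain m where m: "m \<le> L" "y = p m" by auto
      then have "m < L" using L y by (cases "m = L") auto
      then show "f y \<in> p ` {..L}" using m p_Suc[of m] by (intro image_eqI[of _ _ "Suc m"]) auto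
    next
      assume "f y \<in> p ` {..L}"
      then obtain m where m: "m \<le> L" "f y = p m" by auto
      then obtain m' where "m = Suc m'" using x y p0 by (cases m) auto
      then show "y \<in> p ` {..L}" using m inj_onD[OF inj, of y "p m'"] y inS[of m'] p_Suc[of m'] by auto
    qed
    moreover have "p ` {..L} \<subseteq> R" "p ` {..L} \<noteq> {}" using pR inS by auto
    ultimately show ?thesis by (intro partial_orbit_eqI[OF R])
  qed
  with pinj have bij: "bij_betw p {..L} R" by (simp add: bij_betw_def)
  have "p ` {..<L} = R \<inter> S"
    using \<open>p ` {..L} = R\<close> inS L by (auto simp: le_less)
  moreover have "inj_on p {..<L}" using pinj by (rule inj_on_subset) auto
  ultimately have "card (R \<inter> S) = L" by (metis card_image card_lessThan)
  with bij L inS p_Suc that show ?thesis by auto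
qed

lemma bij_betw_transfer:
  assumes "bij_betw p M R" "bij_betw p' M R'"
  obtains h where "bij_betw h R R'" "\<And>m. m \<in> M \<Longrightarrow> h (p m) = p' m"
proof
  show "bij_betw (p' \<circ> the_inv_into M p) R R'"
    by (rule bij_betw_trans[OF bij_betw_the_inv_into[OF assms(1)] assms(2)])
  show "(p' \<circ> the_inv_into M p) (p m) = p' m" if "m \<in> M" for m
    using that assms(1) by (simp add: the_inv_into_f_f bij_betw_def)
qed

text \<open>Both kinds of orbit have a numbering in which \<open>f\<close> is the successor, cyclic
  or not, and \<open>h\<close> matches equal numbers. Membership in \<open>S\<close> is tracked
  because the permutation glued from these maps has to preserve \<open>{1..k}\<close>.\<close>

lemma partial_orbit_iso:
  assumes R: "partial_orbit S f R" "finite R" "inj_on f S"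
    and R': "partial_orbit S f' R'" "finite R'" "inj_on f' S"
    and card: "card (R \<inter> S) = card (R' \<inter> S)"
    and type: "R \<subseteq> S \<inter> f ` S \<longleftrightarrow> R' \<subseteq> S \<inter> f' ` S"
  obtains h where "bij_betw h R R'"
    "\<And>x. x \<in> R \<Longrightarrow> h x \<in> S \<longleftrightarrow> x \<in> S" "\<And>x. x \<in> R \<Longrightarrow> x \<in> S \<Longrightarrow> h (f x) = f' (h x)"
proof (cases "R \<subseteq> S \<inter> f ` S")
  case True
  have sub: "R \<subseteq> S" "R' \<subseteq> S" using True type by auto
  then have card': "card R = card R'" using card by (simp add: Int_absorb2)
  obtain p where p: "bij_betw p {..<card R} R" "\<And>m. m < card R \<Longrightarrow> f (p m) = p (Suc m mod card R)"
    using partial_orbit_cycle[OF R sub(1)] by blast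
  obtain p' where p': "bij_betw p' {..<card R} R'" "\<And>m. m < card R \<Longrightarrow> f' (p' m) = p' (Suc m mod card R)"
    using partial_orbit_cycle[OF R' sub(2)] card' by metis
  obtain h where h: "bij_betw h R R'" "\<And>m. m \<in> {..<card R} \<Longrightarrow> h (p m) = p' m"
    using bij_betw_transfer[OF p(1) p'(1)] by blast
  show ?thesis
  proof (rule that[OF h(1)])
    fix x assume x: "x \<in> R"
    then show "h x \<in> S \<longleftrightarrow> x \<in> S" using h(1) sub bij_betwE by blast
    obtain m where m: "x = p m" "m < card R"
      using x p(1) by (auto simp: bij_betw_def)
    \<comment> \<open>The values of \<open>h\<close> are known only on the numbers below
      \<open>card R\<close>, so the successor has to be seen to be one of them.\<close>
    then have "Suc m mod card R < card R" by (intro mod_less_divisor) auto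
    with m h(2) p(2) p'(2) show "h (f x) = f' (h x)" by simp
  qed
next
  case False
  let ?L = "card (R \<inter> S)"
  obtain p where p: "bij_betw p {..?L} R" "p ?L \<notin> S" "\<And>m. m < ?L \<Longrightarrow> p m \<in> S \<and> f (p m) = p (Suc m)"
    using partial_orbit_path[OF R False] by blast
  obtain p' where p': "bij_betw p' {..?L} R'" "p' ?L \<notin> S" "\<And>m. m < ?L \<Longrightarrow> p' m \<in> S \<and> f' (p' m) = p' (Suc m)"
    using partial_orbit_path[OF R'] False type card by metis
  obtain h where h: "bij_betw h R R'" "\<And>m. m \<in> {..?L} \<Longrightarrow> h (p m) = p' m"
    using bij_betw_transfer[OF p(1) p'(1)] by blast
  show ?thesis
  proof (rule that[OF h(1)])
    fix x assume x: "x \<in> R"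
    obtain m where m: "x = p m" "m \<le> ?L"
      using x p(1) by (auto simp: bij_betw_def)
    then show "h x \<in> S \<longleftrightarrow> x \<in> S" using h(2)[of m] p(2) p(3)[of m] p'(2) p'(3)[of m] by (cases "m = ?L") auto
    assume "x \<in> S"
    then have "m < ?L" using m p(2) by (cases "m = ?L") auto
    then show "h (f x) = f' (h x)" using m h(2)[of m] h(2)[of "Suc m"] p(3)[of m] p'(3)[of m] by simp
  qed
qed

section \<open>Components of the union with the identity injection\<close>

definition right_part :: "(nat + nat) set \<Rightarrow> nat set" where
  "right_part C = {j. Inr j \<in> C}"

context
  fixes k n :: nat and \<sigma> :: "nat \<Rightarrow> nat" and e
  assumes kn: "k \<le> n" and \<sigma>: "\<sigma> \<in> injections k n"
  defines "e \<equiv> id_injection k"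
begin

private lemma inj: "inj_on \<sigma> {1..k}" and range: "i \<in> {1..k} \<Longrightarrow> \<sigma> i \<in> {1..n}"
  using \<sigma> by (auto simp: injections_def)

private lemma adj: "union_adjacency k \<sigma> e =
  (\<Union>i\<in>{1..k}. {(Inl i, Inr i), (Inr i, Inl i), (Inl i, Inr (\<sigma> i)), (Inr (\<sigma> i), Inl i)})"
  by (auto simp: union_adjacency_def union_edges_def edge_ends_def e_def id_injection_def doubleton_eq_iff
      split: if_splits)

private lemma sym_adj: "sym ((union_adjacency k \<sigma> e)\<^sup>*)"
  by (rule sym_rtrancl) (auto simp: sym_def adj)

private lemma comp_eq:
  assumes "C \<in> union_components k n \<sigma> e" "v \<in> C"
  shows "C = (union_adjacency k \<sigma> e)\<^sup>* `` {v}"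
proof -
  obtain u where u: "C = (union_adjacency k \<sigma> e)\<^sup>* `` {u}"
    using assms(1) by (auto simp: union_components_def)
  then have "(u, v) \<in> (union_adjacency k \<sigma> e)\<^sup>*" "(v, u) \<in> (union_adjacency k \<sigma> e)\<^sup>*"
    using assms(2) symD[OF sym_adj] by auto
  then show ?thesis unfolding u by (auto intro: rtrancl_trans)
qed

private lemma comp_closed:
  assumes "C \<in> union_components k n \<sigma> e" "(u, v) \<in> union_adjacency k \<sigma> e"
  shows "u \<in> C \<longleftrightarrow> v \<in> C"
proof
  show "u \<in> C \<Longrightarrow> v \<in> C" using comp_eq[OF assms(1), of u] assms(2) by auto
  have "(v, u) \<in> union_adjacency k \<sigma> e" using assms(2) by (auto simp: adj)
  then show "v \<in> C \<Longrightarrow> u \<in> C" using comp_eq[OF assms(1), of v] by auto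
qed

private lemma comp_left:
  assumes "C \<in> union_components k n \<sigma> e" "i \<in> {1..k}"
  shows "Inl i \<in> C \<longleftrightarrow> i \<in> right_part C" "Inl i \<in> C \<longleftrightarrow> \<sigma> i \<in> right_part C"
proof -
  have "(Inl i, Inr i) \<in> union_adjacency k \<sigma> e" "(Inl i, Inr (\<sigma> i)) \<in> union_adjacency k \<sigma> e"
    using assms(2) unfolding adj by blast+
  from this[THEN comp_closed[OF assms(1)]]
  show "Inl i \<in> C \<longleftrightarrow> i \<in> right_part C" "Inl i \<in> C \<longleftrightarrow> \<sigma> i \<in> right_part C"
    by (simp_all add: right_part_def)
qed

private lemma comp_verts:
  assumes "C \<in> union_components k n \<sigma> e"
  shows "C \<subseteq> union_verts k n"
proof -
  obtain u where u: "u \<in> union_verts k n" "C = (union_adjacency k \<sigma> e)\<^sup>* `` {u}"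
    using assms by (auto simp: union_components_def)
  have "v \<in> union_verts k n" if "(u, v) \<in> (union_adjacency k \<sigma> e)\<^sup>*" for v
    using that u(1) by induction (use kn range in \<open>auto simp: adj union_verts_def\<close>)
  then show ?thesis using u(2) by auto
qed

text \<open>Every left vertex \<open>i\<close> is joined to the right vertices \<open>i\<close> and
  \<open>\<sigma> i\<close>, which gives closure in both directions and a right vertex in every
  component. For minimality, a closed set \<open>D\<close> together with its left counterparts is
  closed under adjacency, so it contains the component of each of its points.\<close>

lemma right_part_partial_orbit:
  assumes C: "C \<in> union_components k n \<sigma> e"
  shows "partial_orbit {1..k} \<sigma> (right_part C)"
  unfolding partial_orbit_def
proof (intro conjI allI impI ballI)
  obtain u where u: "u \<in> C" "u \<in> union_verts k n" using C by (auto simp: union_components_def)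
  then show "right_part C \<noteq> {}"
    using comp_left(1)[OF C] by (cases u) (auto simp: right_part_def union_verts_def)
  show "x \<in> right_part C \<longleftrightarrow> \<sigma> x \<in> right_part C" if "x \<in> {1..k}" for x
    using comp_left[OF C that] by simp
  fix D assume D: "D \<subseteq> right_part C" "D \<noteq> {}" "\<forall>x\<in>{1..k}. x \<in> D \<longleftrightarrow> \<sigma> x \<in> D"
  then obtain d where d: "d \<in> D" by auto
  then have "Inr d \<in> C" using D(1) by (auto simp: right_part_def)
  have "v \<in> Inr ` D \<union> Inl ` (D \<inter> {1..k})" if "(Inr d, v) \<in> (union_adjacency k \<sigma> e)\<^sup>*" for v
    using that
  proof induction
    case (step y z)
    then show ?case using D(3) by (auto simp: adj)
  qed (simp add: d)
  then have "C \<subseteq> Inr ` D \<union> Inl ` (D \<inter> {1..k})"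
    using comp_eq[OF C \<open>Inr d \<in> C\<close>] by auto
  then show "D = right_part C" using D(1) by (auto simp: right_part_def)
qed

lemma right_part_subset: "C \<in> union_components k n \<sigma> e \<Longrightarrow> right_part C \<subseteq> {1..n}"
  using comp_verts by (fastforce simp: right_part_def union_verts_def)

lemma right_part_disjoint:
  assumes "C \<in> union_components k n \<sigma> e" "C' \<in> union_components k n \<sigma> e" "C \<noteq> C'"
  shows "right_part C \<inter> right_part C' = {}"
proof (rule ccontr)
  assume "right_part C \<inter> right_part C' \<noteq> {}"
  then obtain j where "Inr j \<in> C" "Inr j \<in> C'" by (auto simp: right_part_def)
  then show False using comp_eq assms by blast
qed

lemma right_part_cover: "(\<Union>C\<in>union_components k n \<sigma> e. right_part C) = {1..n}"
proof
  show "{1..n} \<subseteq> (\<Union>C\<in>union_components k n \<sigma> e. right_part C)"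
    by (auto simp: union_components_def union_verts_def right_part_def)
qed (use right_part_subset in blast)

text \<open>Edges are counted at their left ends: the left vertices of the component are indexed by
  \<open>right_part C \<inter> {1..k}\<close>, and each carries one edge of either
  injection.\<close>

lemma component_length_right_part:
  assumes C: "C \<in> union_components k n \<sigma> e"
  shows "component_length k \<sigma> e C = 2 * card (right_part C \<inter> {1..k})"
proof -
  have "{x \<in> union_edges k. edge_ends \<sigma> e x \<subseteq> C} = UNIV \<times> (right_part C \<inter> {1..k})"
    using comp_left[OF C] 
    by (auto simp: union_edges_def edge_ends_def e_def id_injection_def right_part_def split: if_splits)
  then show ?thesis by (simp add: component_length_def card_cartesian_product)
qed

text \<open>Left vertices always have degree 2, so only the right ones decide. The right vertex
  \<open>j\<close> meets an edge of the identity injection exactly when \<open>j\<close> is in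
  \<open>{1..k}\<close> and an edge of \<sigma> exactly when it is a value of \<sigma>.\<close>

lemma is_cycle_component_right_part:
  assumes C: "C \<in> union_components k n \<sigma> e"
  shows "is_cycle_component k \<sigma> e C \<longleftrightarrow> right_part C \<subseteq> {1..k} \<inter> \<sigma> ` {1..k}"
proof -
  have left: "union_degree k \<sigma> e (Inl i) = 2" if "i \<in> {1..k}" for i
  proof -
    have "{x \<in> union_edges k. Inl i \<in> edge_ends \<sigma> e x} = {(False, i), (True, i)}"
      using that by (auto simp: union_edges_def edge_ends_def)
    then show ?thesis by (simp add: union_degree_def)
  qed
  have right: "union_degree k \<sigma> e (Inr j) = 2 \<longleftrightarrow> j \<in> {1..k} \<inter> \<sigma> ` {1..k}" for j
  proof -
    let ?E = "{x \<in> union_edges k. Inr j \<in> edge_ends \<sigma> e x}"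
    have E: "?E = {(False, i) | i. i \<in> {1..k} \<and> \<sigma> i = j} \<union> (if j \<in> {1..k} then {(True, j)} else {})"
      by (auto simp: union_edges_def edge_ends_def e_def id_injection_def split: if_splits)
    show ?thesis
    proof (cases "j \<in> \<sigma> ` {1..k}")
      case True
      then obtain i where i: "i \<in> {1..k}" "\<sigma> i = j" by auto
      then have "?E = (if j \<in> {1..k} then {(False, i), (True, j)} else {(False, i)})"
      proof -
        have "{(False, i) | i. i \<in> {1..k} \<and> \<sigma> i = j} = {(False, i)}"
          using i inj_onD[OF inj] by blast
        then show ?thesis unfolding E by simp
      qed
      then show ?thesis using True by (auto simp: union_degree_def)
    next
      case False
      then have "?E = (if j \<in> {1..k} then {(True, j)} else {})"
      proof -
        have "{(False, i) | i. i \<in> {1..k} \<and> \<sigma> i = j} = {}"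
          using False by blast
        then show ?thesis unfolding E by (simp only: Un_empty_left)
      qed
      then show ?thesis using False by (auto simp: union_degree_def)
    qed
  qed
  have "is_cycle_component k \<sigma> e C \<longleftrightarrow> (\<forall>j\<in>right_part C. union_degree k \<sigma> e (Inr j) = 2)"
  proof -
    have "union_degree k \<sigma> e v = 2" if "v \<in> C" "\<forall>j\<in>right_part C. union_degree k \<sigma> e (Inr j) = 2" for v
      using that comp_verts[OF C] left by (cases v) (auto simp: union_verts_def right_part_def)
    then show ?thesis by (auto simp: is_cycle_component_def right_part_def)
  qed
  then show ?thesis using right by auto
qed

end

lemma finite_union_components: "finite (union_components k n \<sigma> \<sigma>')"
  by (simp add: union_components_def union_verts_def)

text \<open>Equal types match the components by kind and length, and the isomorphisms of the matched
  orbits glue to a permutation \<open>h\<close> of \<open>{1..n}\<close> that preserves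
  \<open>{1..k}\<close> and carries \<sigma> to \<sigma>'. Together with its restriction to
  \<open>{1..k}\<close> it forms the required element of \<open>K\<close>.\<close>

lemma sphere_conjugate:
  assumes kn: "k \<le> n" and \<sigma>: "\<sigma> \<in> injections k n" and \<sigma>': "\<sigma>' \<in> injections k n"
    and type: "cycle_path_type k n \<sigma> (id_injection k) = cycle_path_type k n \<sigma>' (id_injection k)"
  obtains h where "h \<in> gelfand_K k n" "inj_act k h \<sigma> = \<sigma>'"
proof -
  let ?e = "id_injection k"
  let ?X = "union_components k n \<sigma> ?e" and ?X' = "union_components k n \<sigma>' ?e"
  let ?cyc = "is_cycle_component k \<sigma> ?e" and ?cyc' = "is_cycle_component k \<sigma>' ?e"
  let ?len = "\<lambda>C. component_length k \<sigma> ?e C div 2" and ?len' = "\<lambda>C. component_length k \<sigma>' ?e C div 2"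
  have inj: "inj_on \<sigma> {1..k}" "inj_on \<sigma>' {1..k}" using \<sigma> \<sigma>' by (auto simp: injections_def)
  obtain \<beta>1 where \<beta>1: "bij_betw \<beta>1 {C \<in> ?X. ?cyc C} {C \<in> ?X'. ?cyc' C}"
    "\<And>C. C \<in> {C \<in> ?X. ?cyc C} \<Longrightarrow> ?len' (\<beta>1 C) = ?len C"
    using image_mset_mset_set_eq_bij[of "{C \<in> ?X. ?cyc C}" "{C \<in> ?X'. ?cyc' C}" ?len ?len'] type
    by (auto simp: cycle_path_type_def finite_union_components)
  obtain \<beta>2 where \<beta>2: "bij_betw \<beta>2 {C \<in> ?X. \<not> ?cyc C} {C \<in> ?X'. \<not> ?cyc' C}"
    "\<And>C. C \<in> {C \<in> ?X. \<not> ?cyc C} \<Longrightarrow> ?len' (\<beta>2 C) = ?len C"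
    using image_mset_mset_set_eq_bij[of "{C \<in> ?X. \<not> ?cyc C}" "{C \<in> ?X'. \<not> ?cyc' C}" ?len ?len'] type
    by (auto simp: cycle_path_type_def finite_union_components)
  define \<beta> where "\<beta> C = (if ?cyc C then \<beta>1 C else \<beta>2 C)" for C
  have "bij_betw \<beta> {C \<in> ?X. ?cyc C} {C \<in> ?X'. ?cyc' C}"
    using \<beta>1(1) by (subst bij_betw_cong[of _ _ \<beta>1]) (auto simp: \<beta>_def)
  moreover have "bij_betw \<beta> {C \<in> ?X. \<not> ?cyc C} {C \<in> ?X'. \<not> ?cyc' C}"
    using \<beta>2(1) by (subst bij_betw_cong[of _ _ \<beta>2]) (auto simp: \<beta>_def)
  ultimately have "bij_betw \<beta> ({C \<in> ?X. ?cyc C} \<union> {C \<in> ?X. \<not> ?cyc C}) ({C \<in> ?X'. ?cyc' C} \<union> {C \<in> ?X'. \<not> ?cyc' C})"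
    by (rule bij_betw_combine) auto
  moreover have "{C \<in> ?X. ?cyc C} \<union> {C \<in> ?X. \<not> ?cyc C} = ?X" "{C \<in> ?X'. ?cyc' C} \<union> {C \<in> ?X'. \<not> ?cyc' C} = ?X'"
    by auto
  ultimately have bij\<beta>: "bij_betw \<beta> ?X ?X'" by simp
  have cyc\<beta>: "?cyc' (\<beta> C) \<longleftrightarrow> ?cyc C" and len\<beta>: "?len' (\<beta> C) = ?len C" if "C \<in> ?X" for C
    using that \<beta>1 \<beta>2 bij_betwE[OF \<beta>1(1)] bij_betwE[OF \<beta>2(1)] by (auto simp: \<beta>_def)
  have "\<exists>h. bij_betw h (right_part C) (right_part (\<beta> C)) \<and>
      (\<forall>x\<in>right_part C. (h x \<in> {1..k} \<longleftrightarrow> x \<in> {1..k}) \<and> (x \<in> {1..k} \<longrightarrow> h (\<sigma> x) = \<sigma>' (h x)))"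
    if C: "C \<in> ?X" for C
  proof -
    have C': "\<beta> C \<in> ?X'" using C bij\<beta> bij_betwE by blast
    have fin: "finite (right_part C)" "finite (right_part (\<beta> C))"
      using right_part_subset[OF kn \<sigma> C] right_part_subset[OF kn \<sigma>' C'] finite_subset by blast+
    show ?thesis
    proof (rule partial_orbit_iso[of "{1..k}" \<sigma> "right_part C" \<sigma>' "right_part (\<beta> C)"])
      show "card (right_part C \<inter> {1..k}) = card (right_part (\<beta> C) \<inter> {1..k})"
        using len\<beta>[OF C] component_length_right_part[OF kn \<sigma> C] component_length_right_part[OF kn \<sigma>' C'] by simp
      show "right_part C \<subseteq> {1..k} \<inter> \<sigma> ` {1..k} \<longleftrightarrow> right_part (\<beta> C) \<subseteq> {1..k} \<inter> \<sigma>' ` {1..k}"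
        using cyc\<beta>[OF C] is_cycle_component_right_part[OF kn \<sigma> C] is_cycle_component_right_part[OF kn \<sigma>' C'] by simp
    qed (use fin inj right_part_partial_orbit[OF kn \<sigma> C] right_part_partial_orbit[OF kn \<sigma>' C'] in blast)+
  qed
  then obtain H where H: "\<And>C. C \<in> ?X \<Longrightarrow> bij_betw (H C) (right_part C) (right_part (\<beta> C))"
    and Hk: "\<And>C x. C \<in> ?X \<Longrightarrow> x \<in> right_part C \<Longrightarrow> H C x \<in> {1..k} \<longleftrightarrow> x \<in> {1..k}"
    and H\<sigma>: "\<And>C x. C \<in> ?X \<Longrightarrow> x \<in> right_part C \<Longrightarrow> x \<in> {1..k} \<Longrightarrow> H C (\<sigma> x) = \<sigma>' (H C x)"
    by metis
  \<comment> \<open>The right parts are disjoint and cover \<open>{1..n}\<close>, so the component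
    of a right vertex is well defined and the local bijections \<open>H C\<close> can be
    glued.\<close>
  define comp where "comp x = (THE C. C \<in> ?X \<and> x \<in> right_part C)" for x
  have comp: "comp x = C" if "C \<in> ?X" "x \<in> right_part C" for x C
    unfolding comp_def using that right_part_disjoint[OF kn \<sigma>] by (intro the_equality) blast+
  define h where "h x = (if x \<in> {1..n} then H (comp x) x else x)" for x
  have hH: "h x = H C x" if "C \<in> ?X" "x \<in> right_part C" for x C
    using comp[OF that] that right_part_subset[OF kn \<sigma> that(1)] by (auto simp: h_def)
  have "bij_betw h (\<Union>C\<in>?X. right_part C) (\<Union>C\<in>?X. right_part (\<beta> C))"
  proof (rule bij_betw_UNION_disjoint)
    show "disjoint_family_on (\<lambda>C. right_part (\<beta> C)) ?X"
      unfolding disjoint_family_on_def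
    proof (intro ballI impI)
      fix C D assume "C \<in> ?X" "D \<in> ?X" "C \<noteq> D"
      then have "\<beta> C \<in> ?X'" "\<beta> D \<in> ?X'" "\<beta> C \<noteq> \<beta> D"
        using bij\<beta> by (auto simp: bij_betw_def inj_on_def)
      then show "right_part (\<beta> C) \<inter> right_part (\<beta> D) = {}" by (rule right_part_disjoint[OF kn \<sigma>'])
    qed
    show "bij_betw h (right_part C) (right_part (\<beta> C))" if "C \<in> ?X" for C
      using H[OF that] hH[OF that] bij_betw_cong[of "right_part C" h "H C"] by blast
  qed
  moreover have "(\<Union>C\<in>?X. right_part (\<beta> C)) = (\<Union>C\<in>?X'. right_part C)"
    using bij\<beta> by (metis bij_betw_def image_image)
  ultimately have "bij_betw h {1..n} {1..n}"
    using right_part_cover[OF kn \<sigma>] right_part_cover[OF kn \<sigma>'] by simp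
  then have hn: "h permutes {1..n}"
    by (intro bij_imp_permutes) (auto simp: h_def)
  have ex: "\<exists>C\<in>?X. x \<in> right_part C" if "x \<in> {1..n}" for x
    using that right_part_cover[OF kn \<sigma>] by auto
  have hk: "h x \<in> {1..k} \<longleftrightarrow> x \<in> {1..k}" if "x \<in> {1..n}" for x
    using ex[OF that] hH Hk by metis
  have h\<sigma>: "h (\<sigma> x) = \<sigma>' (h x)" if x: "x \<in> {1..k}" for x
  proof -
    obtain C where C: "C \<in> ?X" "x \<in> right_part C" using ex[of x] x kn by auto
    then have "\<sigma> x \<in> right_part C"
      using right_part_partial_orbit[OF kn \<sigma> C(1)] x by (auto simp: partial_orbit_def)
    then show ?thesis using hH[OF C(1)] C H\<sigma>[OF C x] by simp
  qed
  \<comment> \<open>Since \<open>h\<close> preserves \<open>{1..k}\<close>, it splits into a part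
    \<alpha> on \<open>{1..k}\<close> and a part \<open>b\<close> on the complement; this is the
    factorization required of the second coordinate of an element of \<open>K\<close>.\<close>
  define \<alpha> where "\<alpha> x = (if x \<in> {1..k} then h x else x)" for x
  define b where "b x = (if x \<in> {1..k} then x else h x)" for x
  have sub: "{1..k} \<subseteq> {1..n}" "{k+1..n} \<subseteq> {1..n}" using kn by auto
  have "\<alpha> permutes {1..k}"
  proof (rule bij_imp_permutes)
    have "inj_on h {1..k}" using permutes_inj[OF hn] by (rule inj_on_subset) auto
    moreover have "h ` {1..k} \<subseteq> {1..k}" using hk sub by blast
    ultimately have "bij_betw h {1..k} {1..k}" by (simp add: bij_betw_def endo_inj_surj)
    then show "bij_betw \<alpha> {1..k} {1..k}" by (subst bij_betw_cong[of _ _ h]) (auto simp: \<alpha>_def)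
  qed (auto simp: \<alpha>_def)
  moreover have "b permutes {k+1..n}"
  proof (rule bij_imp_permutes)
    have "inj_on h {k+1..n}" using permutes_inj[OF hn] by (rule inj_on_subset) auto
    moreover have "h ` {k+1..n} \<subseteq> {k+1..n}"
    proof
      fix y assume "y \<in> h ` {k+1..n}"
      then obtain x where x: "y = h x" "x \<in> {k+1..n}" by auto
      then have "y \<in> {1..n}" "y \<notin> {1..k}"
        using hk[of x] permutes_in_image[OF hn, of x] by auto
      then show "y \<in> {k+1..n}" by auto
    qed
    ultimately have "bij_betw h {k+1..n} {k+1..n}" by (simp add: bij_betw_def endo_inj_surj)
    then show "bij_betw b {k+1..n} {k+1..n}" by (subst bij_betw_cong[of _ _ h]) (auto simp: b_def)
    show "b x = x" if "x \<notin> {k+1..n}" for x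
      using that by (cases "x \<in> {1..n}") (auto simp: b_def h_def)
  qed
  moreover have "\<alpha> \<circ> b = h"
  proof
    fix x
    have "h x \<notin> {1..k}" if "x \<notin> {1..k}"
      using that hk[of x] by (cases "x \<in> {1..n}") (auto simp: h_def)
    then show "(\<alpha> \<circ> b) x = h x" by (auto simp: \<alpha>_def b_def)
  qed
  ultimately have "(\<alpha>, h) \<in> gelfand_K k n"
    by (auto simp: gelfand_K_def)
  moreover have "inj_act k (\<alpha>, h) \<sigma> = \<sigma>'"
  proof
    fix i
    show "inj_act k (\<alpha>, h) \<sigma> i = \<sigma>' i"
    proof (cases "i \<in> {1..k}")
      case True
      then have i: "inv' \<alpha> i \<in> {1..k}" using permutes_inv[OF \<open>\<alpha> permutes {1..k}\<close>] by (simp only: permutes_in_image)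
      moreover have "h (inv' \<alpha> i) = i"
        using i permutes_inverses(1)[OF \<open>\<alpha> permutes {1..k}\<close>, of i] by (simp add: \<alpha>_def)
      ultimately show ?thesis using True h\<sigma>[of "inv' \<alpha> i"] by (simp add: inj_act_def)
    next
      case False
      \<comment> \<open>Injections are extensional: outside \<open>{1..k}\<close> both sides take
        the default value.\<close>
      then have "\<sigma>' i = undefined" using \<sigma>' by (auto simp: injections_def PiE_def extensional_def)
      with False show ?thesis by (simp add: inj_act_def del: atLeastAtMost_iff)
    qed
  qed
  ultimately show ?thesis using that by blast
qed

section \<open>Tableaux and column rearrangements\<close>

lemma finite_diagram: "finite (diagram lam)"
proof -
  have "diagram lam = (SIGMA i:{..<length lam}. {..<lam ! i})" by (auto simp: diagram_def)
  then show ?thesis by simp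
qed

lemma card_diagram: "card (diagram lam) = sum_list lam"
proof -
  have "diagram lam = (SIGMA i:{..<length lam}. {..<lam ! i})" by (auto simp: diagram_def)
  then show ?thesis by (simp add: sum_list_sum_nth atLeast0LessThan)
qed

lemma diagram_up:
  assumes "sorted_wrt (\<ge>) lam" "(i, j) \<in> diagram lam" "i' \<le> i"
  shows "(i', j) \<in> diagram lam"
proof (cases "i' = i")
  case False
  then have "lam ! i \<le> lam ! i'"
    using assms sorted_wrt_nth_less[OF assms(1), of i' i] by (auto simp: diagram_def)
  then show ?thesis using assms False by (auto simp: diagram_def)
qed (use assms in simp)

lemma is_tableau_inj: "is_tableau lam t \<Longrightarrow> inj_on t (diagram lam)"
  and is_tableau_image: "is_tableau lam t \<Longrightarrow> t ` diagram lam = {1..sum_list lam}"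
  by (auto simp: is_tableau_def bij_betw_def)

lemma is_tableau_comp:
  "is_tableau lam t \<Longrightarrow> \<pi> permutes {1..sum_list lam} \<Longrightarrow> is_tableau lam (\<pi> \<circ> t)"
  unfolding is_tableau_def using bij_betw_trans permutes_imp_bij by blast

lemma tableau_permutation:
  assumes "is_tableau lam t" "is_tableau lam t'"
  obtains \<pi> where "\<pi> permutes {1..sum_list lam}" "\<And>c. c \<in> diagram lam \<Longrightarrow> \<pi> (t c) = t' c"
proof -
  obtain h where h: "bij_betw h {1..sum_list lam} {1..sum_list lam}"
      "\<And>c. c \<in> diagram lam \<Longrightarrow> h (t c) = t' c"
    using assms bij_betw_transfer unfolding is_tableau_def by metis
  define \<pi> where "\<pi> x = (if x \<in> {1..sum_list lam} then h x else x)" for x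
  have "\<pi> permutes {1..sum_list lam}"
    by (rule bij_imp_permutes) (use h(1) bij_betw_cong[of "{1..sum_list lam}" \<pi> h] in \<open>auto simp: \<pi>_def\<close>)
  moreover have "\<pi> (t c) = t' c" if "c \<in> diagram lam" for c
    using h(2)[OF that] is_tableau_image[OF assms(1)] that by (auto simp: \<pi>_def)
  ultimately show ?thesis using that by blast
qed

lemma tabloid_of_cong: "(\<And>c. c \<in> diagram lam \<Longrightarrow> t c = t' c) \<Longrightarrow> tabloid_of lam t = tabloid_of lam t'"
  unfolding tabloid_of_def by (intro ext image_cong) auto

lemma tabloid_act_tabloid_of: "tabloid_act \<pi> (tabloid_of lam t) = tabloid_of lam (\<pi> \<circ> t)"
  by (simp add: tabloid_act_def tabloid_of_def image_comp)

lemma tabloid_act_comp: "tabloid_act (\<pi> \<circ> \<rho>) T = tabloid_act \<pi> (tabloid_act \<rho> T)"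
  by (simp add: tabloid_act_def image_comp)

lemma tabloid_act_tabloids:
  "\<pi> permutes {1..sum_list lam} \<Longrightarrow> T \<in> tabloids lam \<Longrightarrow> tabloid_act \<pi> T \<in> tabloids lam"
  unfolding tabloids_def using tabloid_act_tabloid_of is_tableau_comp by blast

lemma finite_tabloids: "finite (tabloids lam)"
proof (rule finite_subset)
  show "tabloids lam \<subseteq> tabloid_of lam ` (diagram lam \<rightarrow>\<^sub>E {1..sum_list lam})"
  proof
    fix T assume "T \<in> tabloids lam"
    then obtain t where t: "T = tabloid_of lam t" "is_tableau lam t" by (auto simp: tabloids_def)
    then have "restrict t (diagram lam) \<in> diagram lam \<rightarrow>\<^sub>E {1..sum_list lam}"
      using is_tableau_image[OF t(2)] by (auto simp: restrict_PiE_iff)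
    moreover have "T = tabloid_of lam (restrict t (diagram lam))"
      unfolding t(1) by (rule tabloid_of_cong) simp
    ultimately show "T \<in> tabloid_of lam ` (diagram lam \<rightarrow>\<^sub>E {1..sum_list lam})" by blast
  qed
  show "finite (tabloid_of lam ` (diagram lam \<rightarrow>\<^sub>E {1..sum_list lam}))"
    by (intro finite_imageI finite_PiE finite_diagram) simp
qed

lemma mem_tabloid_of:
  assumes "is_tableau lam t" "c \<in> diagram lam"
  shows "t c \<in> tabloid_of lam t i \<longleftrightarrow> fst c = i"
  unfolding tabloid_of_def using inj_on_image_mem_iff[OF is_tableau_inj[OF assms(1)] assms(2)] assms(2)
  by (metis (mono_tags, lifting) mem_Collect_eq subsetI)

lemma row_index_tabloid_of:
  assumes "is_tableau lam t" "c \<in> diagram lam"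
  shows "row_index (tabloid_of lam t) (t c) = fst c"
  unfolding row_index_def using mem_tabloid_of[OF assms] by auto

lemma row_index_act:
  assumes "inj \<pi>"
  shows "row_index (tabloid_act \<pi> T) (\<pi> x) = row_index T x"
  by (simp add: row_index_def tabloid_act_def inj_image_mem_iff[OF assms])

lemma tabloid_of_eqI:
  assumes "is_tableau lam t" "is_tableau lam t'"
    and "\<And>x. x \<in> {1..sum_list lam} \<Longrightarrow> row_index (tabloid_of lam t) x = row_index (tabloid_of lam t') x"
  shows "tabloid_of lam t = tabloid_of lam t'"
proof -
  have "tabloid_of lam t i = {x \<in> {1..sum_list lam}. row_index (tabloid_of lam t) x = i}"
    if "is_tableau lam t" for t i
  proof -
    have "{x \<in> {1..sum_list lam}. row_index (tabloid_of lam t) x = i} = t ` {c \<in> diagram lam. fst c = i}"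
      unfolding is_tableau_image[OF that, symmetric] using row_index_tabloid_of[OF that] by auto
    then show ?thesis by (simp add: tabloid_of_def)
  qed
  with assms show ?thesis by (auto simp: fun_eq_iff)
qed

section \<open>Column stabilizers\<close>

lemma column_stabilizer_permutes: "\<pi> \<in> column_stabilizer lam t \<Longrightarrow> \<pi> permutes {1..sum_list lam}"
  by (simp add: column_stabilizer_def sym_group_carrier)

lemma finite_column_stabilizer: "finite (column_stabilizer lam t)"
  by (rule finite_subset[OF _ finite_permutations[of "{1..sum_list lam}"]])
     (blast intro: column_stabilizer_permutes, simp)

lemma column_stabilizerE:
  assumes "\<pi> \<in> column_stabilizer lam t" "c \<in> diagram lam"
  obtains c' where "c' \<in> diagram lam" "\<pi> (t c) = t c'" "snd c' = snd c"
proof -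
  have "\<pi> (t c) \<in> \<pi> ` column_entries lam t (snd c)"
    using assms(2) by (auto simp: column_entries_def)
  then have "\<pi> (t c) \<in> column_entries lam t (snd c)"
    using assms(1) by (simp add: column_stabilizer_def)
  with that show ?thesis by (auto simp: column_entries_def)
qed

lemma column_stabilizerI:
  assumes "\<pi> permutes {1..sum_list lam}"
    and "\<And>c. c \<in> diagram lam \<Longrightarrow> \<exists>c'\<in>diagram lam. \<pi> (t c) = t c' \<and> snd c' = snd c"
  shows "\<pi> \<in> column_stabilizer lam t"
proof -
  have "\<pi> ` column_entries lam t j = column_entries lam t j" for j
  proof (rule endo_inj_surj)
    show "finite (column_entries lam t j)" by (simp add: column_entries_def finite_diagram)
    show "\<pi> ` column_entries lam t j \<subseteq> column_entries lam t j"
      using assms(2) by (fastforce simp: column_entries_def)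
    show "inj_on \<pi> (column_entries lam t j)"
      using permutes_inj[OF assms(1)] by (rule inj_on_subset) auto
  qed
  with assms(1) show ?thesis by (simp add: column_stabilizer_def sym_group_carrier)
qed

lemma column_stabilizer_id: "id \<in> column_stabilizer lam t"
  by (simp add: column_stabilizer_def sym_group_carrier permutes_id)

lemma column_stabilizer_comp:
  assumes "\<pi> \<in> column_stabilizer lam t" "\<rho> \<in> column_stabilizer lam t"
  shows "\<pi> \<circ> \<rho> \<in> column_stabilizer lam t"
proof -
  have "(\<pi> \<circ> \<rho>) ` A = A" if "\<pi> ` A = A" "\<rho> ` A = A" for A
    using that by (simp only: image_comp[symmetric])
  with assms show ?thesis
    by (auto simp only: column_stabilizer_def sym_group_carrier mem_Collect_eq intro: permutes_compose)
qed

lemma column_stabilizer_inv: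
  assumes "\<pi> \<in> column_stabilizer lam t"
  shows "inv' \<pi> \<in> column_stabilizer lam t"
proof -
  have \<pi>: "\<pi> permutes {1..sum_list lam}" using assms by (rule column_stabilizer_permutes)
  have "inv' \<pi> ` column_entries lam t j = column_entries lam t j" for j
  proof -
    have "inv' \<pi> ` (\<pi> ` column_entries lam t j) = column_entries lam t j"
      by (rule image_inv_f_f[OF permutes_inj[OF \<pi>]])
    then show ?thesis using assms by (simp add: column_stabilizer_def)
  qed
  with \<pi> show ?thesis by (simp add: column_stabilizer_def sym_group_carrier permutes_inv)
qed

lemma bij_column_stabilizer:
  assumes "\<pi> \<in> column_stabilizer lam t"
  shows "bij_betw (\<lambda>\<rho>. \<pi> \<circ> \<rho>) (column_stabilizer lam t) (column_stabilizer lam t)"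
    and "bij_betw (\<lambda>\<rho>. \<rho> \<circ> \<pi>) (column_stabilizer lam t) (column_stabilizer lam t)"
proof -
  have \<pi>: "\<pi> permutes {1..sum_list lam}" using assms by (rule column_stabilizer_permutes)
  note inv = permutes_inv_o[OF \<pi>]
  show "bij_betw (\<lambda>\<rho>. \<pi> \<circ> \<rho>) (column_stabilizer lam t) (column_stabilizer lam t)"
    by (rule bij_betw_byWitness[where f' = "\<lambda>\<rho>. inv' \<pi> \<circ> \<rho>"])
       (use assms column_stabilizer_inv[OF assms] in \<open>auto simp: inv o_assoc intro: column_stabilizer_comp\<close>)
  show "bij_betw (\<lambda>\<rho>. \<rho> \<circ> \<pi>) (column_stabilizer lam t) (column_stabilizer lam t)"
    by (rule bij_betw_byWitness[where f' = "\<lambda>\<rho>. \<rho> \<circ> inv' \<pi>"])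
       (use assms column_stabilizer_inv[OF assms] in \<open>auto simp: inv comp_assoc intro: column_stabilizer_comp\<close>)
qed

lemma bij_column_stabilizer_conj:
  assumes \<rho>: "\<rho> permutes {1..sum_list lam}"
  shows "bij_betw (\<lambda>\<pi>. \<rho> \<circ> \<pi> \<circ> inv' \<rho>) (column_stabilizer lam t) (column_stabilizer lam (\<rho> \<circ> t))"
proof -
  have entries: "column_entries lam (\<rho> \<circ> t) j = \<rho> ` column_entries lam t j" for \<rho> t j
    by (simp add: column_entries_def image_comp)
  have conj: "\<rho> \<circ> \<pi> \<circ> inv' \<rho> \<in> column_stabilizer lam (\<rho> \<circ> t)"
    if "\<pi> \<in> column_stabilizer lam t" "\<rho> permutes {1..sum_list lam}" for \<pi> \<rho> t
  proof -
    have "(\<rho> \<circ> \<pi> \<circ> inv' \<rho>) ` \<rho> ` column_entries lam t j = \<rho> ` column_entries lam t j" for j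
    proof -
      have "(\<rho> \<circ> \<pi> \<circ> inv' \<rho>) ` \<rho> ` A = \<rho> ` \<pi> ` A" for A
      proof -
        have "(\<rho> \<circ> \<pi> \<circ> inv' \<rho>) \<circ> \<rho> = \<rho> \<circ> \<pi>" by (simp add: comp_assoc permutes_inv_o(2)[OF that(2)])
        then show ?thesis by (simp only: image_comp)
      qed
      moreover have "\<pi> ` column_entries lam t j = column_entries lam t j"
        using that(1) by (simp add: column_stabilizer_def)
      ultimately show ?thesis by (simp only:)
    qed
    moreover have "\<rho> \<circ> \<pi> \<circ> inv' \<rho> permutes {1..sum_list lam}"
      by (rule permutes_compose[OF permutes_inv[OF that(2)] permutes_compose[OF column_stabilizer_permutes[OF that(1)] that(2)]])
    ultimately show ?thesis
      unfolding column_stabilizer_def sym_group_carrier entries by blast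
  qed
  note inv = permutes_inv_o[OF \<rho>] permutes_inv_inv[OF \<rho>]
  have cancel: "inv' \<rho> \<circ> (\<rho> \<circ> t) = t" by (simp add: o_assoc inv)
  show ?thesis
  proof (rule bij_betw_byWitness[where f' = "\<lambda>\<pi>. inv' \<rho> \<circ> \<pi> \<circ> \<rho>"])
    show "(\<lambda>\<pi>. \<rho> \<circ> \<pi> \<circ> inv' \<rho>) ` column_stabilizer lam t \<subseteq> column_stabilizer lam (\<rho> \<circ> t)"
      using conj \<rho> by blast
    show "(\<lambda>\<pi>. inv' \<rho> \<circ> \<pi> \<circ> \<rho>) ` column_stabilizer lam (\<rho> \<circ> t) \<subseteq> column_stabilizer lam t"
      using conj[of _ "\<rho> \<circ> t", OF _ permutes_inv[OF \<rho>]] unfolding cancel inv by blast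
    show "\<forall>\<pi>\<in>column_stabilizer lam t. inv' \<rho> \<circ> (\<rho> \<circ> \<pi> \<circ> inv' \<rho>) \<circ> \<rho> = \<pi>"
      using permutes_inverses[OF \<rho>] by (auto simp: fun_eq_iff)
    show "\<forall>\<pi>\<in>column_stabilizer lam (\<rho> \<circ> t). \<rho> \<circ> (inv' \<rho> \<circ> \<pi> \<circ> \<rho>) \<circ> inv' \<rho> = \<pi>"
      using permutes_inverses[OF \<rho>] by (auto simp: fun_eq_iff)
  qed
qed

text \<open>Let \<open>r c\<close> be the row of \<open>t'\<close> holding the entry \<open>t c\<close>.  In every column of \<open>t\<close>, at most as many
  cells have \<open>r c < i\<close> as have row index less than \<open>i\<close>.  Summed over the columns both counts
  give the size of the first \<open>i\<close> rows, so they agree in each column, and \<open>c \<mapsto> (r c, snd c)\<close>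
  permutes the diagram.\<close>

lemma column_rearrangement:
  assumes lam: "sorted_wrt (\<ge>) lam" and t: "is_tableau lam t" and t': "is_tableau lam t'"
    and distinct: "\<And>c d. c \<in> diagram lam \<Longrightarrow> d \<in> diagram lam \<Longrightarrow> snd c = snd d \<Longrightarrow>
      row_index (tabloid_of lam t') (t c) = row_index (tabloid_of lam t') (t d) \<Longrightarrow> c = d"
  obtains \<pi> where "\<pi> \<in> column_stabilizer lam t" "tabloid_act \<pi> (tabloid_of lam t') = tabloid_of lam t"
proof -
  let ?D = "diagram lam"
  define r where "r c = row_index (tabloid_of lam t') (t c)" for c
  have D: "finite ?D" by (rule finite_diagram)
  \<comment> \<open>The cell \<open>\<theta> c\<close> is where \<open>t'\<close> holds the entry
    \<open>t c\<close>, so that \<open>r c\<close> is its row.\<close>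
  obtain \<theta> where \<theta>: "bij_betw \<theta> ?D ?D" "\<And>c. c \<in> ?D \<Longrightarrow> t' (\<theta> c) = t c"
  proof
    show "bij_betw (inv_into ?D t' \<circ> t) ?D ?D"
      using t t' bij_betw_inv_into bij_betw_trans unfolding is_tableau_def by blast
    show "t' ((inv_into ?D t' \<circ> t) c) = t c" if "c \<in> ?D" for c
      using that is_tableau_image[OF t] is_tableau_image[OF t'] by (auto intro!: f_inv_into_f)
  qed
  have r\<theta>: "r c = fst (\<theta> c)" if "c \<in> ?D" for c
    using row_index_tabloid_of[OF t', of "\<theta> c"] \<theta> that bij_betwE[OF \<theta>(1)] by (auto simp: r_def)
  have inj_r: "inj_on r {c \<in> ?D. P c \<and> snd c = j}" for P j
    using distinct by (auto simp: inj_on_def r_def)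
  let ?a = "\<lambda>i j. card {c \<in> ?D. r c < i \<and> snd c = j}" and ?b = "\<lambda>i j. card {c \<in> ?D. fst c < i \<and> snd c = j}"
  have le: "?a i j \<le> ?b i j" for i j
  \<comment> \<open>If column \<open>j\<close> reaches row \<open>i\<close>, exactly
    \<open>i\<close> of its cells lie above that row, and at most \<open>i\<close> cells can have
    distinct values of \<open>r\<close> below \<open>i\<close>. Otherwise the right-hand side
    already counts the whole column.\<close>
  proof (cases "(i, j) \<in> ?D")
    case True
    then have "{c \<in> ?D. fst c < i \<and> snd c = j} = (\<lambda>x. (x, j)) ` {..<i}"
      using diagram_up[OF lam True] by force
    then have b: "?b i j = i" by (simp add: card_image inj_on_def)
    have "?a i j = card (r ` {c \<in> ?D. r c < i \<and> snd c = j})"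
      by (rule card_image[symmetric, OF inj_r])
    also have "\<dots> \<le> card {..<i}" by (intro card_mono) auto
    finally show ?thesis using b by simp
  next
    case False
    then have "fst c < i" if "c \<in> ?D" "snd c = j" for c
      using diagram_up[OF lam, of "fst c" j i] that by (metis not_less prod.collapse)
    then show ?thesis using D by (intro card_mono) auto
  qed
  have split: "(\<Sum>j\<in>snd ` ?D. card {c \<in> ?D. P c \<and> snd c = j}) = card {c \<in> ?D. P c}" for P
    using sum.group[of "{c \<in> ?D. P c}" "snd ` ?D" snd "\<lambda>_. 1::nat"] D by (simp add: conj_assoc image_subset_iff)
  have tot: "(\<Sum>j\<in>snd ` ?D. ?a i j) = (\<Sum>j\<in>snd ` ?D. ?b i j)" for i
  proof -
    have "\<theta> ` {c \<in> ?D. r c < i} = {c \<in> ?D. fst c < i}"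
    proof (intro equalityI subsetI)
      fix d assume "d \<in> {c \<in> ?D. fst c < i}"
      then have "d \<in> \<theta> ` ?D" "fst d < i" by (simp_all add: bij_betw_imp_surj_on[OF \<theta>(1)])
      then show "d \<in> \<theta> ` {c \<in> ?D. r c < i}" using r\<theta> by auto
    qed (use r\<theta> bij_betwE[OF \<theta>(1)] in auto)
    moreover have "card (\<theta> ` {c \<in> ?D. r c < i}) = card {c \<in> ?D. r c < i}"
      by (rule card_image, rule inj_on_subset[OF bij_betw_imp_inj_on[OF \<theta>(1)]]) auto
    ultimately have "card {c \<in> ?D. r c < i} = card {c \<in> ?D. fst c < i}"
      by (simp only:)
    then show ?thesis by (simp only: split)
  qed
  have eq: "?a i j = ?b i j" if "j \<in> snd ` ?D" for i j
    by (rule sum_mono_inv[OF tot]) (use that le D in auto)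
  define \<psi> where "\<psi> c = (r c, snd c)" for c
  have \<psi>D: "\<psi> c \<in> ?D" if c: "c \<in> ?D" for c
  proof (rule ccontr)
    \<comment> \<open>If the cell is missing, its column ends above row \<open>r c\<close>. The
      equality of counts then puts every cell \<open>d\<close> of that column in the set
      \<open>r d < r c\<close>, including \<open>c\<close> itself.\<close>
    assume no: "\<psi> c \<notin> ?D"
    let ?col = "{d \<in> ?D. snd d = snd c}"
    have "fst d < r c" if "d \<in> ?col" for d
    proof (rule ccontr)
      assume "\<not> fst d < r c"
      then have "r c \<le> fst d" by simp
      moreover have "(fst d, snd c) \<in> ?D" using that by (cases d) auto
      ultimately show False using diagram_up[OF lam] no by (simp add: \<psi>_def)
    qed
    then have "{d \<in> ?D. fst d < r c \<and> snd d = snd c} = ?col" by auto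
    then have "card {d \<in> ?D. r d < r c \<and> snd d = snd c} = card ?col"
      using eq[of "snd c" "r c"] c by auto
    then have "{d \<in> ?D. r d < r c \<and> snd d = snd c} = ?col"
      using D by (intro card_subset_eq) auto
    then show False using c by auto
  qed
  have "inj_on \<psi> ?D" using distinct by (auto simp: inj_on_def \<psi>_def r_def)
  then have bij\<psi>: "bij_betw \<psi> ?D ?D"
    using \<psi>D D by (simp add: bij_betw_def endo_inj_surj image_subset_iff)
  then have "is_tableau lam (t \<circ> \<psi>)"
    using t bij_betw_trans unfolding is_tableau_def by blast
  then obtain \<pi> where \<pi>: "\<pi> permutes {1..sum_list lam}"
    and "\<And>c. c \<in> ?D \<Longrightarrow> \<pi> (t c) = (t \<circ> \<psi>) c"
    using tableau_permutation[OF t, of "t \<circ> \<psi>"] by blast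
  then have \<pi>t: "\<And>c. c \<in> ?D \<Longrightarrow> \<pi> (t c) = t (\<psi> c)" by simp
  show ?thesis
  proof
    show "\<pi> \<in> column_stabilizer lam t"
      by (rule column_stabilizerI[OF \<pi>]) (use \<pi>t \<psi>D in \<open>auto simp: \<psi>_def\<close>)
    have "tabloid_of lam (\<pi> \<circ> t') = tabloid_of lam t"
    proof (rule tabloid_of_eqI[OF is_tableau_comp[OF t' \<pi>] t])
      fix x assume "x \<in> {1..sum_list lam}"
      then obtain d where d: "d \<in> ?D" "x = t d" using is_tableau_image[OF t] by blast
      then obtain c where c: "c \<in> ?D" "d = \<psi> c" using bij_betw_imp_surj_on[OF bij\<psi>] by blast
      have "row_index (tabloid_of lam (\<pi> \<circ> t')) x = r c"
        using row_index_act[OF permutes_inj[OF \<pi>], of "tabloid_of lam t'" "t c"] \<pi>t[OF c(1)] d c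
        by (simp add: tabloid_act_tabloid_of r_def)
      also have "\<dots> = row_index (tabloid_of lam t) x"
        using row_index_tabloid_of[OF t d(1)] d(2) c(2) by (simp add: \<psi>_def)
      finally show "row_index (tabloid_of lam (\<pi> \<circ> t')) x = row_index (tabloid_of lam t) x" .
    qed
    then show "tabloid_act \<pi> (tabloid_of lam t') = tabloid_of lam t"
      by (simp add: tabloid_act_tabloid_of)
  qed
qed

section \<open>The tableaux s and t\<close>

lemma row_tableau_is_tableau: "is_tableau mu (row_tableau mu)"
proof -
  let ?S = "\<lambda>i. sum_list (take i mu)"
  have S_Suc: "?S (Suc i) = ?S i + mu ! i" if "i < length mu" for i
    using that by (simp add: take_Suc_conv_app_nth)
  have S_mono: "?S i \<le> ?S j" if "i \<le> j" for i j
    by (metis le_add1 le_add_diff_inverse sum_list_append take_add that)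
  have S_le: "?S i \<le> sum_list mu" for i
    by (metis append_take_drop_id le_add1 sum_list_append)
  have inj: "inj_on (row_tableau mu) (diagram mu)"
  proof (rule inj_onI, clarify)
    fix i j i' j' assume D: "(i, j) \<in> diagram mu" "(i', j') \<in> diagram mu"
      and eq: "row_tableau mu (i, j) = row_tableau mu (i', j')"
    have "\<not> i < i'" using D eq S_Suc[of i] S_mono[of "Suc i" i'] by (auto simp: diagram_def row_tableau_def)
    moreover have "\<not> i' < i" using D eq S_Suc[of i'] S_mono[of "Suc i'" i] by (auto simp: diagram_def row_tableau_def)
    ultimately have "i = i'" by simp
    with eq show "i = i' \<and> j = j'" by (simp add: row_tableau_def)
  qed
  have "row_tableau mu ` diagram mu \<subseteq> {1..sum_list mu}"
  proof clarify
    fix i j assume "(i, j) \<in> diagram mu"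
    then show "row_tableau mu (i, j) \<in> {1..sum_list mu}"
      using S_Suc[of i] S_le[of "Suc i"] by (auto simp: diagram_def row_tableau_def)
  qed
  then have "row_tableau mu ` diagram mu = {1..sum_list mu}"
    by (rule card_subset_eq[rotated]) (simp_all add: card_image[OF inj] card_diagram)
  with inj show ?thesis by (simp add: is_tableau_def bij_betw_def)
qed

text \<open>Cells of a horizontal strip lie in different columns, so the column order is strict and
  the counts in \<open>strip_tableau\<close> are distinct. Each count includes the cell itself, so
  the labels start right after \<open>sum_list mu\<close>.\<close>

lemma strip_tableau_is_tableau:
  assumes "horizontal_strip lam mu"
  shows "is_tableau lam (strip_tableau lam mu)"
proof -
  let ?t = "strip_tableau lam mu" and ?N = "skew_diagram lam mu"
  have sub: "diagram mu \<subseteq> diagram lam" and injs: "inj_on snd ?N"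
    using assms by (auto simp: horizontal_strip_def)
  have N: "finite ?N" "?N \<inter> diagram mu = {}" "diagram lam = diagram mu \<union> ?N"
    using sub finite_diagram[of lam] by (auto simp: skew_diagram_def)
  have cardN: "card ?N + sum_list mu = sum_list lam"
    using card_Un_disjoint[of "diagram mu" ?N] N finite_diagram[of mu] card_diagram by (metis Int_commute add.commute)
  let ?r = "\<lambda>c. card {c' \<in> ?N. snd c' \<le> snd c}"
  have rank_less: "?r c < ?r d" if "c \<in> ?N" "d \<in> ?N" "snd c < snd d" for c d
  proof (rule psubset_card_mono)
    have "d \<in> {c' \<in> ?N. snd c' \<le> snd d}" "d \<notin> {c' \<in> ?N. snd c' \<le> snd c}" using that by auto
    then show "{c' \<in> ?N. snd c' \<le> snd c} \<subset> {c' \<in> ?N. snd c' \<le> snd d}" using that(3) by force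
  qed (use N(1) in simp)
  have "inj_on ?r ?N"
  proof (rule inj_onI)
    fix c d assume cd: "c \<in> ?N" "d \<in> ?N" "?r c = ?r d"
    then have "snd c = snd d"
      using rank_less[OF cd(1,2)] rank_less[OF cd(2,1)] by (cases "snd c" "snd d" rule: linorder_cases) simp_all
    then show "c = d" using injs cd by (auto dest: inj_onD)
  qed
  moreover have tN: "?t c = sum_list mu + ?r c" if "c \<in> ?N" for c
    using that N(2) by (auto simp: strip_tableau_def)
  ultimately have injN: "inj_on ?t ?N"
    by (simp add: inj_on_def)
  have "?t ` ?N \<subseteq> {sum_list mu + 1..sum_list lam}"
  proof
    fix x assume "x \<in> ?t ` ?N"
    then obtain c where c: "c \<in> ?N" "x = sum_list mu + ?r c" using tN by blast
    have "c \<in> {c' \<in> ?N. snd c' \<le> snd c}" using c(1) by simp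
    then have "?r c > 0" using N(1) card_gt_0_iff by fastforce
    moreover have "?r c \<le> card ?N" using N(1) by (intro card_mono) auto
    ultimately show "x \<in> {sum_list mu + 1..sum_list lam}" using c(2) cardN by simp
  qed
  moreover have "card (?t ` ?N) = card {sum_list mu + 1..sum_list lam}"
    using cardN card_image[OF injN] by simp
  ultimately have bijN: "bij_betw ?t ?N {sum_list mu + 1..sum_list lam}"
    unfolding bij_betw_def by (intro conjI card_subset_eq injN) auto
  have bij_mu: "bij_betw ?t (diagram mu) {1..sum_list mu}"
    using row_tableau_is_tableau[of mu] bij_betw_cong[of "diagram mu" ?t "row_tableau mu"]
    by (simp add: is_tableau_def strip_tableau_def)
  have "bij_betw ?t (diagram mu \<union> ?N) ({1..sum_list mu} \<union> {sum_list mu + 1..sum_list lam})"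
    by (rule bij_betw_combine[OF bij_mu bijN]) auto
  moreover have "{1..sum_list mu} \<union> {sum_list mu + 1..sum_list lam} = {1..sum_list lam}"
    using cardN by auto
  ultimately show ?thesis using N(3) by (simp add: is_tableau_def)
qed

section \<open>Column antisymmetrizers and Schur's lemma for Specht modules\<close>

lemma gelfand_G_group: "group (gelfand_G k n)"
  unfolding gelfand_G_def by (intro DirProd_group sym_group_is_group)

lemma gelfand_G_carrier:
  "(\<pi>, \<rho>) \<in> carrier (gelfand_G k n) \<longleftrightarrow> \<pi> permutes {1..k} \<and> \<rho> permutes {1..n}"
  by (simp add: gelfand_G_def sym_group_carrier)

lemma gelfand_G_mult: "(\<pi>, \<rho>) \<otimes>\<^bsub>gelfand_G k n\<^esub> (\<pi>', \<rho>') = (\<pi> \<circ> \<pi>', \<rho> \<circ> \<rho>')"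
  by (simp add: gelfand_G_def sym_group_mult)

lemma gelfand_G_one: "\<one>\<^bsub>gelfand_G k n\<^esub> = (id, id)"
  by (simp add: gelfand_G_def sym_group_one)

lemma gelfand_G_inv:
  "\<pi> permutes {1..k} \<Longrightarrow> \<rho> permutes {1..n} \<Longrightarrow> inv\<^bsub>gelfand_G k n\<^esub> (\<pi>, \<rho>) = (inv' \<pi>, inv' \<rho>)"
  unfolding gelfand_G_def
  by (subst inv_DirProd[OF sym_group_is_group sym_group_is_group]) (simp_all add: sym_group_carrier)

lemma finite_gelfand_G: "finite (carrier (gelfand_G k n))"
  by (simp add: gelfand_G_def sym_group_def finite_permutations)

abbreviation tabloid_rep :: "nat list \<Rightarrow> (nat \<Rightarrow> nat) \<Rightarrow> (tabloid \<Rightarrow> complex) \<Rightarrow> tabloid \<Rightarrow> complex" where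
  "tabloid_rep lam \<equiv> perm_rep (sym_group (sum_list lam)) tabloid_act (tabloids lam)"

lemma perm_action_tabloids: "perm_action (sym_group (sum_list lam)) tabloid_act (tabloids lam)"
proof -
  interpret group "sym_group (sum_list lam)" by (rule sym_group_is_group)
  show ?thesis
    by unfold_locales
       (auto simp: sym_group_def finite_permutations finite_tabloids tabloid_act_comp
          intro: tabloid_act_tabloids, simp_all add: tabloid_act_def)
qed

lemma perm_action_tensor:
  "perm_action (gelfand_G (sum_list mu) (sum_list lam))
     (\<lambda>(\<pi>, \<rho>) (T, U). (tabloid_act \<pi> T, tabloid_act \<rho> U)) (tabloids mu \<times> tabloids lam)"
proof -
  interpret group "gelfand_G (sum_list mu) (sum_list lam)" by (rule gelfand_G_group)
  show ?thesis
  proof unfold_locales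
    show "finite (carrier (gelfand_G (sum_list mu) (sum_list lam)))" by (rule finite_gelfand_G)
    show "finite (tabloids mu \<times> tabloids lam)" by (simp add: finite_tabloids)
  qed (clarify, simp only: gelfand_G_carrier gelfand_G_mult gelfand_G_one prod.case tabloid_act_comp mem_Sigma_iff
        tabloid_act_tabloids simp_thms; simp add: tabloid_act_def)+
qed

lemma sign_permutes_comp:
  assumes "\<pi> permutes A" "\<rho> permutes A" "finite A"
  shows "sign (\<pi> \<circ> \<rho>) = sign \<pi> * sign \<rho>"
  using assms by (metis permutation_permutes sign_compose)

text \<open>The signed column sum, usually written \<open>\<kappa>\<^sub>t\<close>, acting on the
  tabloid module. It is defined on all functions, since Schur's lemma will need its values outside
  the Specht module.\<close>

definition alternator :: "nat list \<Rightarrow> tableau \<Rightarrow> (tabloid \<Rightarrow> complex) \<Rightarrow> tabloid \<Rightarrow> complex" where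
  "alternator lam t f = (\<Sum>\<pi>\<in>column_stabilizer lam t. cscale (of_int (sign \<pi>)) (tabloid_rep lam \<pi> f))"

context
  fixes lam :: "nat list"
begin

interpretation perm_action "sym_group (sum_list lam)" tabloid_act "tabloids lam"
  by (rule perm_action_tabloids)

lemma tabloid_rep_comp:
  assumes "\<pi> permutes {1..sum_list lam}" "\<rho> permutes {1..sum_list lam}"
  shows "tabloid_rep lam \<pi> (tabloid_rep lam \<rho> f) = tabloid_rep lam (\<pi> \<circ> \<rho>) f"
  using rep_mult[of \<pi> \<rho> f] assms by (simp add: sym_group_carrier sym_group_mult)

lemma tabloid_of_tabloids: "is_tableau lam t \<Longrightarrow> tabloid_of lam t \<in> tabloids lam"
  by (auto simp: tabloids_def)

lemma tabloid_rep_delta: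
  assumes "\<pi> permutes {1..sum_list lam}" "T \<in> tabloids lam"
  shows "tabloid_rep lam \<pi> (delta T) = delta (tabloid_act \<pi> T)"
  using rep_delta assms by (simp add: sym_group_carrier)

lemma polytabloid_sum:
  "polytabloid lam t = (\<Sum>\<pi>\<in>column_stabilizer lam t. cscale (of_int (sign \<pi>)) (delta (tabloid_of lam (\<pi> \<circ> t))))"
  by (rule ext) (auto simp: polytabloid_def sum_fun_apply delta_def intro!: sum.cong)

lemma polytabloid_alternator:
  assumes "is_tableau lam t"
  shows "polytabloid lam t = alternator lam t (delta (tabloid_of lam t))"
  unfolding polytabloid_sum alternator_def
  by (intro sum.cong refl)
     (simp only: tabloid_rep_delta[OF column_stabilizer_permutes[of _ _ t] tabloid_of_tabloids[OF assms]] tabloid_act_tabloid_of)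

lemma sign_sq: "of_int (sign \<pi>) * of_int (sign \<pi>) = (1 :: complex)"
  by (simp add: sign_def)

lemma tabloid_rep_alternator:
  assumes "\<sigma> \<in> column_stabilizer lam t"
  shows "tabloid_rep lam \<sigma> (alternator lam t f) = cscale (of_int (sign \<sigma>)) (alternator lam t f)"
proof -
  note p = column_stabilizer_permutes
  have "tabloid_rep lam \<sigma> (alternator lam t f) =
      (\<Sum>\<pi>\<in>column_stabilizer lam t. cscale (of_int (sign \<pi>)) (tabloid_rep lam (\<sigma> \<circ> \<pi>) f))"
    unfolding alternator_def rep_sum rep_scale
    by (intro sum.cong refl) (simp only: tabloid_rep_comp[OF p[OF assms] p[of _ _ t]])
  \<comment> \<open>The sign of \<sigma> enters twice, with square 1, to expose the sign of the
    composed permutation before reindexing.\<close>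
  also have "\<dots> = (\<Sum>\<pi>\<in>column_stabilizer lam t.
      cscale (of_int (sign \<sigma>)) (cscale (of_int (sign (\<sigma> \<circ> \<pi>))) (tabloid_rep lam (\<sigma> \<circ> \<pi>) f)))"
    by (intro sum.cong refl)
       (simp add: sign_permutes_comp[OF p[OF assms] p[of _ _ t]] sign_sq mult.assoc[symmetric])
  also have "\<dots> = cscale (of_int (sign \<sigma>)) (alternator lam t f)"
    unfolding alternator_def cfun.scale_sum_right
    by (rule sum.reindex_bij_betw[OF bij_column_stabilizer(1)[OF assms]])
  finally show ?thesis .
qed

lemma alternator_tabloid_rep:
  assumes "\<sigma> \<in> column_stabilizer lam t"
  shows "alternator lam t (tabloid_rep lam \<sigma> f) = cscale (of_int (sign \<sigma>)) (alternator lam t f)"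
proof -
  note p = column_stabilizer_permutes
  have "alternator lam t (tabloid_rep lam \<sigma> f) =
      (\<Sum>\<pi>\<in>column_stabilizer lam t. cscale (of_int (sign \<pi>)) (tabloid_rep lam (\<pi> \<circ> \<sigma>) f))"
    unfolding alternator_def
    by (intro sum.cong refl) (simp only: tabloid_rep_comp[OF p[of _ _ t] p[OF assms]])
  also have "\<dots> = (\<Sum>\<pi>\<in>column_stabilizer lam t.
      cscale (of_int (sign \<sigma>)) (cscale (of_int (sign (\<pi> \<circ> \<sigma>))) (tabloid_rep lam (\<pi> \<circ> \<sigma>) f)))"
    by (intro sum.cong refl)
       (simp add: sign_permutes_comp[OF p[of _ _ t] p[OF assms]] sign_sq mult.left_commute[of "of_int (sign \<sigma>)"])
  also have "\<dots> = cscale (of_int (sign \<sigma>)) (alternator lam t f)"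
    unfolding alternator_def cfun.scale_sum_right
    by (rule sum.reindex_bij_betw[OF bij_column_stabilizer(2)[OF assms]])
  finally show ?thesis .
qed

lemma tabloid_rep_polytabloid_sign:
  assumes "is_tableau lam t" "\<sigma> \<in> column_stabilizer lam t"
  shows "tabloid_rep lam \<sigma> (polytabloid lam t) = cscale (of_int (sign \<sigma>)) (polytabloid lam t)"
  unfolding polytabloid_alternator[OF assms(1)] by (rule tabloid_rep_alternator[OF assms(2)])

lemma alternator_polytabloid:
  assumes "is_tableau lam t"
  shows "alternator lam t (polytabloid lam t) = cscale (of_nat (card (column_stabilizer lam t))) (polytabloid lam t)"
proof -
  have "alternator lam t (polytabloid lam t) = (\<Sum>\<pi>\<in>column_stabilizer lam t. polytabloid lam t)"
    unfolding alternator_def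
    by (intro sum.cong refl) (simp add: tabloid_rep_polytabloid_sign[OF assms] sign_sq)
  then show ?thesis by (simp add: fun_eq_iff sum_fun_apply)
qed

text \<open>Conjugation by \<rho> carries the column stabilizer of \<open>t\<close> to that of
  \<open>\<rho> \<circ> t\<close> and preserves signs.\<close>

lemma tabloid_rep_polytabloid:
  assumes "is_tableau lam t" "\<rho> permutes {1..sum_list lam}"
  shows "tabloid_rep lam \<rho> (polytabloid lam t) = polytabloid lam (\<rho> \<circ> t)"
proof -
  note p = column_stabilizer_permutes
  have inv: "inv' \<rho> permutes {1..sum_list lam}" "inv' \<rho> \<circ> \<rho> = id"
    using assms(2) by (auto intro: permutes_inv permutes_inv_o)
  have sgn: "sign (\<rho> \<circ> \<pi> \<circ> inv' \<rho>) = sign \<pi>" if "\<pi> \<in> column_stabilizer lam t" for \<pi>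
    using sign_permutes_comp[OF permutes_compose[OF p[OF that] assms(2)] inv(1)]
      sign_permutes_comp[OF assms(2) p[OF that]] sign_inverse[OF permutes_imp_permutation[OF _ assms(2)]]
    by (simp add: sign_def)
  have "polytabloid lam (\<rho> \<circ> t) = (\<Sum>\<pi>\<in>column_stabilizer lam t.
      cscale (of_int (sign (\<rho> \<circ> \<pi> \<circ> inv' \<rho>))) (delta (tabloid_of lam ((\<rho> \<circ> \<pi> \<circ> inv' \<rho>) \<circ> (\<rho> \<circ> t)))))"
    unfolding polytabloid_sum by (rule sum.reindex_bij_betw[OF bij_column_stabilizer_conj[OF assms(2)], symmetric])
  also have "\<dots> = (\<Sum>\<pi>\<in>column_stabilizer lam t. cscale (of_int (sign \<pi>)) (delta (tabloid_of lam (\<rho> \<circ> (\<pi> \<circ> t)))))"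
  proof (intro sum.cong refl)
    fix \<pi> assume \<pi>: "\<pi> \<in> column_stabilizer lam t"
    have "(\<rho> \<circ> \<pi> \<circ> inv' \<rho>) \<circ> (\<rho> \<circ> t) = \<rho> \<circ> (\<pi> \<circ> t)"
      using permutes_inverses(2)[OF assms(2)] by (simp add: fun_eq_iff)
    then show "cscale (of_int (sign (\<rho> \<circ> \<pi> \<circ> inv' \<rho>))) (delta (tabloid_of lam ((\<rho> \<circ> \<pi> \<circ> inv' \<rho>) \<circ> (\<rho> \<circ> t))))
        = cscale (of_int (sign \<pi>)) (delta (tabloid_of lam (\<rho> \<circ> (\<pi> \<circ> t))))"
      by (simp only: sgn[OF \<pi>])
  qed
  also have "\<dots> = tabloid_rep lam \<rho> (polytabloid lam t)"
    unfolding polytabloid_sum rep_sum rep_scale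
    by (intro sum.cong refl)
       (simp only: tabloid_rep_delta[OF assms(2) tabloid_of_tabloids[OF is_tableau_comp[OF assms(1) p[of _ _ t]]]]
         tabloid_act_tabloid_of)
  finally show ?thesis ..
qed

text \<open>If a row of \<open>T\<close> and a column of \<open>t\<close> share two entries, their transposition fixes \<open>T\<close> and makes
  the antisymmetrization vanish; otherwise \<open>T\<close> is a column rearrangement of \<open>{t}\<close>.\<close>

lemma alternator_delta:
  assumes "sorted_wrt (\<ge>) lam" "is_tableau lam t" "T \<in> tabloids lam"
  obtains c where "alternator lam t (delta T) = cscale c (polytabloid lam t)"
proof -
  obtain t' where t': "is_tableau lam t'" "T = tabloid_of lam t'"
    using assms(3) by (auto simp: tabloids_def)
  show ?thesis
  proof (cases "\<exists>c\<in>diagram lam. \<exists>d\<in>diagram lam. snd c = snd d \<and> row_index T (t c) = row_index T (t d) \<and> c \<noteq> d")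
    case True
    then obtain c d where cd: "c \<in> diagram lam" "d \<in> diagram lam" "snd c = snd d"
      "row_index T (t c) = row_index T (t d)" "c \<noteq> d" by blast
    let ?\<tau> = "transpose (t c) (t d)"
    have inN: "t c \<in> {1..sum_list lam}" "t d \<in> {1..sum_list lam}"
      using is_tableau_image[OF assms(2)] cd by blast+
    have ne: "t c \<noteq> t d" using inj_onD[OF is_tableau_inj[OF assms(2)]] cd by blast
    have perm: "?\<tau> permutes {1..sum_list lam}" by (rule permutes_swap_id[OF inN])
    have col: "?\<tau> \<in> column_stabilizer lam t"
    proof (rule column_stabilizerI[OF perm])
      fix x assume x: "x \<in> diagram lam"
      show "\<exists>c'\<in>diagram lam. ?\<tau> (t x) = t c' \<and> snd c' = snd x"
      proof (cases "x = c \<or> x = d")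
        case True
        then show ?thesis using cd by auto
      next
        case False
        then have "t x \<noteq> t c" "t x \<noteq> t d"
          using inj_on_eq_iff[OF is_tableau_inj[OF assms(2)] x] cd by auto
        then show ?thesis using x by (intro bexI[of _ x]) auto
      qed
    qed
    have "tabloid_act ?\<tau> T = T"
    proof -
      have "tabloid_of lam (?\<tau> \<circ> t') = tabloid_of lam t'"
      proof (rule tabloid_of_eqI[OF is_tableau_comp[OF t'(1) perm] t'(1)])
        fix x assume "x \<in> {1..sum_list lam}"
        have "row_index (tabloid_act ?\<tau> T) (?\<tau> (?\<tau> x)) = row_index T (?\<tau> x)"
          by (rule row_index_act[OF permutes_inj[OF perm]])
        moreover have "row_index T (?\<tau> x) = row_index T x"
          using cd(4) by (auto simp: transpose_def)
        ultimately show "row_index (tabloid_of lam (?\<tau> \<circ> t')) x = row_index (tabloid_of lam t') x"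
          by (simp add: t'(2) tabloid_act_tabloid_of)
      qed
      then show ?thesis by (simp add: t'(2) tabloid_act_tabloid_of)
    qed
    then have "alternator lam t (delta T) = cscale (of_int (sign ?\<tau>)) (alternator lam t (delta T))"
      using alternator_tabloid_rep[OF col, of "delta T"] tabloid_rep_delta[OF perm assms(3)] by simp
    then have "alternator lam t (delta T) = cscale 0 (polytabloid lam t)"
      using ne by (auto simp: fun_eq_iff sign_swap_id eq_neg_iff_add_eq_0)
    then show ?thesis by (rule that)
  next
    case False
    then obtain \<pi> where \<pi>: "\<pi> \<in> column_stabilizer lam t" "tabloid_act \<pi> T = tabloid_of lam t"
      using column_rearrangement[OF assms(1,2) t'(1)] t'(2) by metis
    have "polytabloid lam t = cscale (of_int (sign \<pi>)) (alternator lam t (delta T))"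
      using alternator_tabloid_rep[OF \<pi>(1), of "delta T"]
        tabloid_rep_delta[OF column_stabilizer_permutes[OF \<pi>(1)] assms(3)]
      by (simp add: polytabloid_alternator[OF assms(2)] \<pi>(2))
    then have "cscale (of_int (sign \<pi>)) (polytabloid lam t) = alternator lam t (delta T)"
      by (simp add: sign_sq)
    then show ?thesis using that by metis
  qed
qed

lemma polytabloid_free_space: "is_tableau lam t \<Longrightarrow> polytabloid lam t \<in> free_space (tabloids lam)"
  unfolding polytabloid_alternator alternator_def
  by (intro cfun.subspace_sum[OF free_space_subspace] cfun.subspace_scale[OF free_space_subspace] rep_free_space)

end

lemma polytabloid_cong:
  assumes "\<And>c. c \<in> diagram lam \<Longrightarrow> t c = t' c"
  shows "polytabloid lam t = polytabloid lam t'"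
proof -
  have "column_entries lam t j = column_entries lam t' j" for j
    unfolding column_entries_def using assms by (intro image_cong) auto
  moreover have "tabloid_of lam (\<pi> \<circ> t) = tabloid_of lam (\<pi> \<circ> t')" for \<pi>
    by (rule tabloid_of_cong) (simp add: assms)
  ultimately show ?thesis by (simp add: polytabloid_def column_stabilizer_def)
qed

section \<open>Tensor products of Specht modules\<close>

definition ftensor :: "('x \<Rightarrow> complex) \<Rightarrow> ('y \<Rightarrow> complex) \<Rightarrow> 'x \<times> 'y \<Rightarrow> complex" where
  "ftensor f h = (\<lambda>(x, y). f x * h y)"

lemma ftensor_add_left: "ftensor (f + f') h = ftensor f h + ftensor f' h"
  and ftensor_add_right: "ftensor f (h + h') = ftensor f h + ftensor f h'"
  and ftensor_scale_left: "ftensor (cscale c f) h = cscale c (ftensor f h)"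
  and ftensor_scale_right: "ftensor f (cscale c h) = cscale c (ftensor f h)"
  and ftensor_zero_left: "ftensor 0 h = 0"
  and ftensor_zero_right: "ftensor f 0 = 0"
  by (auto simp: ftensor_def fun_eq_iff algebra_simps)

lemma ftensor_sum:
  "ftensor (\<Sum>a\<in>A. f a) (\<Sum>b\<in>B. h b) = (\<Sum>a\<in>A. \<Sum>b\<in>B. ftensor (f a) (h b))"
  by (rule ext) (auto simp: ftensor_def sum_fun_apply sum_product)

lemma ftensor_delta: "ftensor (delta x) (delta y) = delta (x, y)"
  by (auto simp: ftensor_def delta_def fun_eq_iff)

abbreviation polytensor :: "nat list \<Rightarrow> nat list \<Rightarrow> tableau \<Rightarrow> tableau \<Rightarrow> tabloid \<times> tabloid \<Rightarrow> complex" where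
  "polytensor mu lam s t \<equiv> ftensor (polytabloid mu s) (polytabloid lam t)"

text \<open>Bilinearity replaces the two factors one after the other by polytabloids. Linear
  statements about the module then need checking only at pairs of polytabloids, on which the group
  acts by relabelling the tableaux.\<close>

lemma specht_tensor_span:
  "specht_tensor mu lam = cfun.span {polytensor mu lam s t | s t. is_tableau mu s \<and> is_tableau lam t}"
    (is "_ = cfun.span ?B")
proof
  have 1: "ftensor f (polytabloid lam t) \<in> cfun.span ?B" if "f \<in> specht mu" "is_tableau lam t" for f t
  proof -
    have "cfun.subspace {f. ftensor f (polytabloid lam t) \<in> cfun.span ?B}"
      by (rule cfun.subspaceI)
         (auto simp: ftensor_zero_left ftensor_add_left ftensor_scale_left cfun.span_zero cfun.span_add cfun.span_scale
           simp del: plus_fun_apply)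
    moreover have "{polytabloid mu s | s. is_tableau mu s} \<subseteq> {f. ftensor f (polytabloid lam t) \<in> cfun.span ?B}"
      using that(2) by (auto intro!: cfun.span_base)
    ultimately show ?thesis using cfun.span_minimal that(1) unfolding specht_def by blast
  qed
  have 2: "ftensor f h \<in> cfun.span ?B" if "f \<in> specht mu" "h \<in> specht lam" for f h
  proof -
    have "cfun.subspace {h. ftensor f h \<in> cfun.span ?B}"
      by (rule cfun.subspaceI)
         (auto simp: ftensor_zero_right ftensor_add_right ftensor_scale_right cfun.span_zero cfun.span_add cfun.span_scale)
    moreover have "{polytabloid lam t | t. is_tableau lam t} \<subseteq> {h. ftensor f h \<in> cfun.span ?B}"
      using 1[OF that(1)] by auto
    ultimately show ?thesis using cfun.span_minimal that(2) unfolding specht_def by blast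
  qed
  have eq: "specht_tensor mu lam = cfun.span {ftensor f h | f h. f \<in> specht mu \<and> h \<in> specht lam}"
    by (simp add: specht_tensor_def ftensor_def)
  show "specht_tensor mu lam \<subseteq> cfun.span ?B"
    unfolding eq using 2 by (intro cfun.span_minimal cfun.subspace_span) auto
  show "cfun.span ?B \<subseteq> specht_tensor mu lam"
    unfolding eq specht_def by (intro cfun.span_mono) (auto intro: cfun.span_base)
qed

lemma tensor_rep_ftensor:
  assumes "\<pi> permutes {1..sum_list mu}" "\<rho> permutes {1..sum_list lam}"
  shows "tensor_rep mu lam (\<pi>, \<rho>) (ftensor f h) = ftensor (tabloid_rep mu \<pi> f) (tabloid_rep lam \<rho> h)"
  using assms by (auto simp: tensor_rep_def perm_rep_def ftensor_def gelfand_G_inv sym_group_carrier fun_eq_iff)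

context
  fixes mu lam :: "nat list"
  assumes mu: "sorted_wrt (\<ge>) mu" and lam: "sorted_wrt (\<ge>) lam"
begin

interpretation perm_action "gelfand_G (sum_list mu) (sum_list lam)"
  "\<lambda>(\<pi>, \<rho>) (T, U). (tabloid_act \<pi> T, tabloid_act \<rho> U)" "tabloids mu \<times> tabloids lam"
  rewrites "perm_rep (gelfand_G (sum_list mu) (sum_list lam))
    (\<lambda>(\<pi>, \<rho>) (T, U). (tabloid_act \<pi> T, tabloid_act \<rho> U)) (tabloids mu \<times> tabloids lam) = tensor_rep mu lam"
  by (rule perm_action_tensor) (simp add: tensor_rep_def)

lemma specht_tensor_free_space: "specht_tensor mu lam \<subseteq> free_space (tabloids mu \<times> tabloids lam)"
proof -
  have "polytensor mu lam s t \<in> free_space (tabloids mu \<times> tabloids lam)"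
    if "is_tableau mu s" "is_tableau lam t" for s t
    using polytabloid_free_space[OF that(1)] polytabloid_free_space[OF that(2)]
    by (auto simp: free_space_def ftensor_def)
  then show ?thesis
    unfolding specht_tensor_span by (intro cfun.span_minimal free_space_subspace) auto
qed

lemma tensor_rep_polytensor:
  assumes "is_tableau mu s" "is_tableau lam t"
    "\<pi> permutes {1..sum_list mu}" "\<rho> permutes {1..sum_list lam}"
  shows "tensor_rep mu lam (\<pi>, \<rho>) (polytensor mu lam s t) = polytensor mu lam (\<pi> \<circ> s) (\<rho> \<circ> t)"
  using assms by (simp add: tensor_rep_ftensor tabloid_rep_polytabloid)

lemma specht_tensor_subrep:
  "subrep (gelfand_G (sum_list mu) (sum_list lam)) (tensor_rep mu lam) (specht_tensor mu lam)"
  unfolding subrep_def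
proof (intro conjI ballI)
  show sub: "cfun.subspace (specht_tensor mu lam)"
    unfolding specht_tensor_def by (rule cfun.subspace_span)
  fix g f assume g: "g \<in> carrier (gelfand_G (sum_list mu) (sum_list lam))" and f: "f \<in> specht_tensor mu lam"
  obtain \<pi> \<rho> where \<pi>\<rho>: "g = (\<pi>, \<rho>)" "\<pi> permutes {1..sum_list mu}" "\<rho> permutes {1..sum_list lam}"
    using g by (cases g) (auto simp: gelfand_G_carrier)
  have zero: "tensor_rep mu lam g 0 = 0"
    using rep_scale[of g 0 0] by (simp only: cfun.scale_zero_left)
  have "cfun.subspace {f. tensor_rep mu lam g f \<in> specht_tensor mu lam}"
    by (rule cfun.subspaceI)
       (simp_all only: mem_Collect_eq rep_add rep_scale zero cfun.subspace_0[OF sub] cfun.subspace_add[OF sub]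
         cfun.subspace_scale[OF sub])
  moreover have "{polytensor mu lam s t | s t. is_tableau mu s \<and> is_tableau lam t}
      \<subseteq> {f. tensor_rep mu lam g f \<in> specht_tensor mu lam}"
    using \<pi>\<rho> is_tableau_comp
    by (auto simp: tensor_rep_polytensor specht_tensor_span intro!: cfun.span_base) metis
  ultimately show "tensor_rep mu lam g f \<in> specht_tensor mu lam"
    using f cfun.span_minimal unfolding specht_tensor_span by blast
qed

text \<open>\<open>T\<close> commutes with the product \<kappa> of the two antisymmetrizers,
  \<open>e\<close> is an eigenvector of \<kappa> with nonzero eigenvalue, and \<kappa> has the line
  through \<open>e\<close> as its range, so \<open>T e\<close> is on that line. \<open>T\<close> has
  to act on the whole permutation module because \<kappa> is applied to \<open>T e\<close> before
  that vector is known to lie in the Specht module.\<close>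

lemma specht_tensor_schur:
  assumes add: "\<And>f f'. T (f + f') = T f + T f'" and scale: "\<And>c f. T (cscale c f) = cscale c (T f)"
    and free: "\<And>f. f \<in> free_space (tabloids mu \<times> tabloids lam) \<Longrightarrow> T f \<in> free_space (tabloids mu \<times> tabloids lam)"
    and comm: "\<And>g f. g \<in> carrier (gelfand_G (sum_list mu) (sum_list lam)) \<Longrightarrow>
      f \<in> free_space (tabloids mu \<times> tabloids lam) \<Longrightarrow> T (tensor_rep mu lam g f) = tensor_rep mu lam g (T f)"
  shows "\<exists>c. \<forall>f\<in>specht_tensor mu lam. T f = cscale c f"
proof -
  let ?X = "tabloids mu \<times> tabloids lam"
  define s where "s = row_tableau mu"
  define t where "t = row_tableau lam"
  have s: "is_tableau mu s" and t: "is_tableau lam t"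
    unfolding s_def t_def by (rule row_tableau_is_tableau)+
  let ?A = "column_stabilizer mu s" and ?B = "column_stabilizer lam t"
  define e where "e = polytensor mu lam s t"
  have e: "e \<in> free_space ?X"
  proof (rule subsetD[OF specht_tensor_free_space])
    show "e \<in> specht_tensor mu lam"
      unfolding specht_tensor_span e_def by (rule cfun.span_base) (use s t in blast)
  qed
  define \<kappa> where "\<kappa> F = (\<Sum>a\<in>?A. \<Sum>b\<in>?B. cscale (of_int (sign a) * of_int (sign b)) (tensor_rep mu lam (a, b) F))" for F
  have \<kappa>_tensor: "\<kappa> (ftensor f h) = ftensor (alternator mu s f) (alternator lam t h)" for f h
    unfolding \<kappa>_def alternator_def ftensor_sum
    by (intro sum.cong refl)
       (simp add: tensor_rep_ftensor[OF column_stabilizer_permutes[of _ _ s] column_stabilizer_permutes[of _ _ t]]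
         ftensor_scale_left ftensor_scale_right)
  have \<kappa>_e: "\<kappa> e = cscale (of_nat (card ?A) * of_nat (card ?B)) e"
    by (simp add: e_def \<kappa>_tensor alternator_polytabloid s t ftensor_scale_left ftensor_scale_right)
  have \<kappa>_add: "\<kappa> (f + f') = \<kappa> f + \<kappa> f'" for f f'
    by (simp add: \<kappa>_def rep_add sum.distrib cfun.scale_right_distrib)
  have \<kappa>_scale: "\<kappa> (cscale c f) = cscale c (\<kappa> f)" for c f
    by (simp add: \<kappa>_def rep_scale cfun.scale_sum_right mult.commute mult.left_commute)
  have \<kappa>_multiple: "\<exists>c. \<kappa> F = cscale c e" if F: "F \<in> free_space ?X" for F
  proof -
    have "cfun.subspace {F. \<exists>c. \<kappa> F = cscale c e}"
    proof (rule cfun.subspaceI)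
      show "0 \<in> {F. \<exists>c. \<kappa> F = cscale c e}"
        using \<kappa>_scale[of 0 0] by (intro CollectI exI[of _ 0]) (simp only: cfun.scale_zero_left)
      show "f + f' \<in> {F. \<exists>c. \<kappa> F = cscale c e}"
        if mem: "f \<in> {F. \<exists>c. \<kappa> F = cscale c e}" "f' \<in> {F. \<exists>c. \<kappa> F = cscale c e}" for f f'
      proof -
        obtain d d' where "\<kappa> f = cscale d e" "\<kappa> f' = cscale d' e" using mem by blast
        then show ?thesis by (intro CollectI exI[of _ "d + d'"]) (simp only: \<kappa>_add cfun.scale_left_distrib)
      qed
      show "cscale c f \<in> {F. \<exists>c. \<kappa> F = cscale c e}" if mem: "f \<in> {F. \<exists>c. \<kappa> F = cscale c e}" for c f
      proof -
        obtain d where "\<kappa> f = cscale d e" using mem by blast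
        then show ?thesis by (intro CollectI exI[of _ "c * d"]) (simp only: \<kappa>_scale cfun.scale_scale)
      qed
    qed
    moreover have "delta ` ?X \<subseteq> {F. \<exists>c. \<kappa> F = cscale c e}"
    proof clarify
      fix S U assume "S \<in> tabloids mu" "U \<in> tabloids lam"
      obtain c where c: "alternator mu s (delta S) = cscale c (polytabloid mu s)"
        using alternator_delta[OF mu s \<open>S \<in> tabloids mu\<close>] by blast
      obtain d where d: "alternator lam t (delta U) = cscale d (polytabloid lam t)"
        using alternator_delta[OF lam t \<open>U \<in> tabloids lam\<close>] by blast
      from c d have "\<kappa> (delta (S, U)) = cscale (c * d) e"
        by (simp add: \<kappa>_tensor ftensor_scale_left ftensor_scale_right e_def flip: ftensor_delta)
      then show "\<exists>c. \<kappa> (delta (S, U)) = cscale c e" by blast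
    qed
    ultimately have "cfun.span (delta ` ?X) \<subseteq> {F. \<exists>c. \<kappa> F = cscale c e}"
      by (intro cfun.span_minimal)
    then show ?thesis using free_space_span[OF finite_points] F by blast
  qed
  have T0: "T 0 = 0" using scale[of 0 0] by (simp only: cfun.scale_zero_left)
  have T_sum: "T (\<Sum>i\<in>I. f i) = (\<Sum>i\<in>I. T (f i))" for I :: "(nat \<Rightarrow> nat) set" and f
    by (induction I rule: infinite_finite_induct) (simp_all only: T0 add sum.infinite sum.empty sum.insert simp_thms)
  have T\<kappa>: "T (\<kappa> e) = \<kappa> (T e)"
    unfolding \<kappa>_def T_sum scale
    by (intro sum.cong refl)
       (simp only: comm[OF gelfand_G_carrier[THEN iffD2, OF conjI[OF column_stabilizer_permutes[of _ _ s]
         column_stabilizer_permutes[of _ _ t]]] e])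
  obtain d where d: "\<kappa> (T e) = cscale d e" using \<kappa>_multiple[OF free[OF e]] by blast
  \<comment> \<open>The eigenvalue of \<kappa> at \<open>e\<close>: every signed term of the double
    sum returns \<open>e\<close> itself.\<close>
  define N where "N = (of_nat (card ?A) * of_nat (card ?B) :: complex)"
  have "N \<noteq> 0"
    using column_stabilizer_id[of mu s] column_stabilizer_id[of lam t]
    by (auto simp: N_def card_eq_0_iff finite_column_stabilizer)
  have "cscale N (T e) = cscale d e"
    using T\<kappa> d by (simp only: \<kappa>_e scale N_def)
  then have Te: "T e = cscale (d / N) e"
    using \<open>N \<noteq> 0\<close> by (auto simp: fun_eq_iff field_simps)
  \<comment> \<open>All polytensors are translates of \<open>e\<close>, so commuting with the group
    spreads the scalar found at \<open>e\<close>.\<close>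
  have gen: "T (polytensor mu lam s' t') = cscale (d / N) (polytensor mu lam s' t')"
    if s': "is_tableau mu s'" and t': "is_tableau lam t'" for s' t'
  proof -
    obtain \<pi> where \<pi>: "\<pi> permutes {1..sum_list mu}" "\<And>c. c \<in> diagram mu \<Longrightarrow> \<pi> (s c) = s' c"
      using tableau_permutation[OF s s'] by blast
    obtain \<rho> where \<rho>: "\<rho> permutes {1..sum_list lam}" "\<And>c. c \<in> diagram lam \<Longrightarrow> \<rho> (t c) = t' c"
      using tableau_permutation[OF t t'] by blast
    have "polytabloid mu s' = polytabloid mu (\<pi> \<circ> s)" "polytabloid lam t' = polytabloid lam (\<rho> \<circ> t)"
      by (rule polytabloid_cong, simp add: \<pi> \<rho>)+
    then have eq: "polytensor mu lam s' t' = tensor_rep mu lam (\<pi>, \<rho>) e"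
      by (simp add: e_def tensor_rep_polytensor[OF s t \<pi>(1) \<rho>(1)])
    show ?thesis
      unfolding eq using \<pi>(1) \<rho>(1) e by (simp add: comm gelfand_G_carrier Te rep_scale)
  qed
  have "cfun.subspace {f. T f = cscale (d / N) f}"
    by (rule cfun.subspaceI)
       (simp_all only: mem_Collect_eq T0 add scale cfun.scale_zero_right cfun.scale_right_distrib
         cfun.scale_scale mult.commute)
  then have "specht_tensor mu lam \<subseteq> {f. T f = cscale (d / N) f}"
    unfolding specht_tensor_span using gen by (intro cfun.span_minimal) auto
  then show ?thesis by blast
qed

end

section \<open>Injections as a homogeneous space\<close>

lemma extend_injection:
  assumes "finite A" "S \<subseteq> A" "inj_on f S" "f ` S \<subseteq> A"
  obtains \<rho> where "\<rho> permutes A" "\<And>x. x \<in> S \<Longrightarrow> \<rho> x = f x"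
proof -
  have "card (A - S) = card (A - f ` S)"
    using assms by (simp add: card_Diff_subset finite_subset card_image)
  then obtain g where g: "bij_betw g (A - S) (A - f ` S)"
    using assms(1) by (meson finite_Diff finite_same_card_bij)
  define \<rho> where "\<rho> x = (if x \<in> S then f x else if x \<in> A then g x else x)" for x
  have "bij_betw \<rho> S (f ` S)"
    using assms(3) bij_betw_cong[of S \<rho> f] by (simp add: \<rho>_def inj_on_imp_bij_betw)
  moreover have "bij_betw \<rho> (A - S) (A - f ` S)"
    using g bij_betw_cong[of "A - S" \<rho> g] by (simp add: \<rho>_def)
  ultimately have "bij_betw \<rho> (S \<union> (A - S)) (f ` S \<union> (A - f ` S))"
    by (rule bij_betw_combine) auto
  then have "bij_betw \<rho> A A"
    using assms(2,4) by (simp add: Un_absorb1)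
  then have "\<rho> permutes A"
    using assms(2) by (intro bij_imp_permutes) (auto simp: \<rho>_def)
  with that show ?thesis by (simp add: \<rho>_def)
qed

lemma id_injection_in: "k \<le> n \<Longrightarrow> id_injection k \<in> injections k n"
  by (auto simp: id_injection_def injections_def inj_on_def)

lemma finite_injections: "finite (injections k n)"
  by (rule finite_subset[of _ "{1..k} \<rightarrow>\<^sub>E {1..n}"]) (auto simp: injections_def intro: finite_PiE)

lemma perm_action_injections: "perm_action (gelfand_G k n) (inj_act k) (injections k n)"
proof -
  interpret group "gelfand_G k n" by (rule gelfand_G_group)
  show ?thesis
  proof unfold_locales
    show "finite (carrier (gelfand_G k n))" by (rule finite_gelfand_G)
    show "finite (injections k n)" by (rule finite_injections)
    fix \<sigma> assume \<sigma>: "\<sigma> \<in> injections k n"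
    show "inj_act k \<one>\<^bsub>gelfand_G k n\<^esub> \<sigma> = \<sigma>"
      using \<sigma> by (auto simp: gelfand_G_one inj_act_def injections_def PiE_def extensional_restrict)
    fix g assume g: "g \<in> carrier (gelfand_G k n)"
    obtain \<pi> \<rho> where \<pi>\<rho>: "g = (\<pi>, \<rho>)" "\<pi> permutes {1..k}" "\<rho> permutes {1..n}"
      using g by (cases g) (auto simp: gelfand_G_carrier)
    note inv\<pi> = permutes_inv[OF \<pi>\<rho>(2)]
    show "inj_act k g \<sigma> \<in> injections k n"
    proof -
      have "\<rho> (\<sigma> (inv' \<pi> i)) \<in> {1..n}" if "i \<in> {1..k}" for i
      proof -
        have "inv' \<pi> i \<in> {1..k}" using that by (simp only: permutes_in_image[OF inv\<pi>])
        then have "\<sigma> (inv' \<pi> i) \<in> {1..n}" using \<sigma> by (auto simp: injections_def)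
        then show ?thesis by (simp only: permutes_in_image[OF \<pi>\<rho>(3)])
      qed
      moreover have "inj_on (\<rho> \<circ> \<sigma> \<circ> inv' \<pi>) {1..k}"
      proof (intro comp_inj_on)
        show "inj_on (inv' \<pi>) {1..k}" using permutes_inj[OF inv\<pi>] by (rule inj_on_subset) simp
        show "inj_on \<sigma> (inv' \<pi> ` {1..k})"
          using \<sigma> by (simp only: permutes_image[OF inv\<pi>]) (simp add: injections_def)
        show "inj_on \<rho> (\<sigma> ` inv' \<pi> ` {1..k})" using permutes_inj[OF \<pi>\<rho>(3)] by (rule inj_on_subset) simp
      qed
      ultimately show ?thesis
        by (simp add: injections_def inj_act_def \<pi>\<rho>(1) restrict_PiE_iff inj_on_restrict_eq del: atLeastAtMost_iff)
    qed
    fix h assume h: "h \<in> carrier (gelfand_G k n)"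
    obtain \<pi>' \<rho>' where \<pi>\<rho>': "h = (\<pi>', \<rho>')" "\<pi>' permutes {1..k}" "\<rho>' permutes {1..n}"
      using h by (cases h) (auto simp: gelfand_G_carrier)
    have inv: "inv' (\<pi> \<circ> \<pi>') = inv' \<pi>' \<circ> inv' \<pi>"
      by (rule o_inv_distrib[OF permutes_bij[OF \<pi>\<rho>(2)] permutes_bij[OF \<pi>\<rho>'(2)]])
    have "inv' \<pi> i \<in> {1..k}" if "i \<in> {1..k}" for i
      using that by (simp only: permutes_in_image[OF inv\<pi>])
    then show "inj_act k (g \<otimes>\<^bsub>gelfand_G k n\<^esub> h) \<sigma> = inj_act k g (inj_act k h \<sigma>)"
      by (auto simp: \<pi>\<rho>(1) \<pi>\<rho>'(1) gelfand_G_mult inj_act_def inv fun_eq_iff)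
  qed
qed

section \<open>The stabilizer of the identity injection and its double cosets\<close>

context
  fixes k n :: nat
  assumes kn: "k \<le> n"
begin

interpretation inj: perm_action "gelfand_G k n" "inj_act k" "injections k n"
  rewrites "perm_rep (gelfand_G k n) (inj_act k) (injections k n) = inj_rep k n"
  by (rule perm_action_injections) (simp add: inj_rep_def)

text \<open>Fixing the identity injection says that the two coordinates agree on
  \<open>{1..k}\<close>; what is left of \<rho> after undoing \<pi> then moves only the larger
  points. Membership in \<open>K\<close> becomes an orbit computation in this way.\<close>

lemma gelfand_K_stabilizer:
  assumes g: "g \<in> carrier (gelfand_G k n)"
  shows "g \<in> gelfand_K k n \<longleftrightarrow> inj_act k g (id_injection k) = id_injection k"
proof -
  obtain \<pi> \<rho> where \<pi>\<rho>: "g = (\<pi>, \<rho>)" "\<pi> permutes {1..k}" "\<rho> permutes {1..n}"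
    using g by (cases g) (auto simp: gelfand_G_carrier)
  have inv: "inv' \<pi> i \<in> {1..k}" if "i \<in> {1..k}" for i
    using that by (simp only: permutes_in_image[OF permutes_inv[OF \<pi>\<rho>(2)]])
  show ?thesis
  proof
    assume "g \<in> gelfand_K k n"
    then obtain b where b: "\<rho> = \<pi> \<circ> b" "b permutes {k+1..n}"
      by (auto simp: gelfand_K_def \<pi>\<rho>(1))
    have "\<rho> (inv' \<pi> i) = i" if "i \<in> {1..k}" for i
    proof -
      have "b (inv' \<pi> i) = inv' \<pi> i"
        by (rule permutes_not_in[OF b(2)]) (use inv[OF that] in auto)
      then show ?thesis using permutes_inverses(1)[OF \<pi>\<rho>(2)] by (simp add: b(1))
    qed
    then show "inj_act k g (id_injection k) = id_injection k"
      using inv by (auto simp: inj_act_def \<pi>\<rho>(1) id_injection_def fun_eq_iff)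
  next
    assume stab: "inj_act k g (id_injection k) = id_injection k"
    have \<rho>\<pi>: "\<rho> j = \<pi> j" if j: "j \<in> {1..k}" for j
    proof -
      have "\<pi> j \<in> {1..k}" using j by (simp only: permutes_in_image[OF \<pi>\<rho>(2)])
      with j show ?thesis
        using fun_cong[OF stab, of "\<pi> j"] permutes_inverses(2)[OF \<pi>\<rho>(2), of j]
        by (simp add: inj_act_def \<pi>\<rho>(1) id_injection_def)
    qed
    define b where "b = inv' \<pi> \<circ> \<rho>"
    have "\<pi> permutes {1..n}" using \<pi>\<rho>(2) by (rule permutes_subset) (use kn in auto)
    then have "b permutes {1..n}"
      unfolding b_def using \<pi>\<rho>(3) by (intro permutes_compose permutes_inv)
    moreover have "b j = j" if "j \<in> {1..k}" for j
      using \<rho>\<pi>[OF that] permutes_inverses(2)[OF \<pi>\<rho>(2)] by (simp add: b_def)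
    ultimately have "b permutes {k+1..n}"
      by (rule permutes_superset) auto
    moreover have "\<rho> = \<pi> \<circ> b"
      using permutes_inverses(1)[OF \<pi>\<rho>(2)] by (simp add: b_def fun_eq_iff)
    ultimately show "g \<in> gelfand_K k n"
      using \<pi>\<rho> by (auto simp: gelfand_K_def)
  qed
qed

lemma gelfand_K_carrier: "gelfand_K k n \<subseteq> carrier (gelfand_G k n)"
proof
  fix g assume "g \<in> gelfand_K k n"
  then obtain a b where ab: "g = (a, a \<circ> b)" "a permutes {1..k}" "b permutes {k+1..n}"
    by (auto simp: gelfand_K_def)
  have "a permutes {1..n}" "b permutes {1..n}"
    by (rule permutes_subset[OF ab(2)], use kn in simp, rule permutes_subset[OF ab(3)], simp)
  then show "g \<in> carrier (gelfand_G k n)"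
    using ab by (simp only: gelfand_G_carrier permutes_compose simp_thms)
qed

lemma gelfand_K_fix: "h \<in> gelfand_K k n \<Longrightarrow> inj_act k h (id_injection k) = id_injection k"
  using gelfand_K_stabilizer gelfand_K_carrier by blast

lemma gelfand_K_subgroup: "subgroup (gelfand_K k n) (gelfand_G k n)"
proof (rule inj.subgroupI)
  note e = id_injection_in[OF kn]
  show "gelfand_K k n \<subseteq> carrier (gelfand_G k n)" by (rule gelfand_K_carrier)
  show "gelfand_K k n \<noteq> {}"
    using gelfand_K_stabilizer[OF inj.one_closed] inj.act_one[OF e] by blast
  show "inv\<^bsub>gelfand_G k n\<^esub> g \<in> gelfand_K k n" if "g \<in> gelfand_K k n" for g
  proof -
    have g: "g \<in> carrier (gelfand_G k n)" using that gelfand_K_carrier by blast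
    show ?thesis
      using inj.act_inv[OF g e] gelfand_K_fix[OF that] gelfand_K_stabilizer[OF inj.inv_closed[OF g]] by simp
  qed
  show "g \<otimes>\<^bsub>gelfand_G k n\<^esub> h \<in> gelfand_K k n" if "g \<in> gelfand_K k n" "h \<in> gelfand_K k n" for g h
  proof -
    have gh: "g \<in> carrier (gelfand_G k n)" "h \<in> carrier (gelfand_G k n)"
      using that gelfand_K_carrier by blast+
    show ?thesis
      using inj.act_mult[OF gh e] gelfand_K_fix[OF that(1)] gelfand_K_fix[OF that(2)]
        gelfand_K_stabilizer[OF inj.m_closed[OF gh]] by simp
  qed
qed

lemma injections_transitive:
  assumes "\<sigma> \<in> injections k n"
  obtains g where "g \<in> carrier (gelfand_G k n)" "inj_act k g (id_injection k) = \<sigma>"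
proof -
  obtain \<rho> where \<rho>: "\<rho> permutes {1..n}" "\<And>x. x \<in> {1..k} \<Longrightarrow> \<rho> x = \<sigma> x"
  proof (rule extend_injection)
    show "inj_on \<sigma> {1..k}" "\<sigma> ` {1..k} \<subseteq> {1..n}" using assms by (auto simp: injections_def)
  qed (use kn in auto)
  have "inj_act k (id, \<rho>) (id_injection k) i = \<sigma> i" for i
  proof (cases "i \<in> {1..k}")
    case True
    then show ?thesis using \<rho>(2)[OF True] by (simp add: inj_act_def id_injection_def)
  next
    case False
    then have "\<sigma> i = undefined" using assms by (auto simp: injections_def PiE_def extensional_def)
    with False show ?thesis by (simp add: inj_act_def del: atLeastAtMost_iff)
  qed
  then have "inj_act k (id, \<rho>) (id_injection k) = \<sigma>" ..
  moreover have "(id, \<rho>) \<in> carrier (gelfand_G k n)"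
    using \<rho>(1) by (simp only: gelfand_G_carrier permutes_id simp_thms)
  ultimately show ?thesis by (rule that[rotated])
qed

lemma cycle_path_type_gelfand_act:
  assumes "g \<in> carrier (gelfand_G k n)"
  shows "cycle_path_type k n (inj_act k g \<sigma>) (inj_act k g \<sigma>') = cycle_path_type k n \<sigma> \<sigma>'"
  using assms cycle_path_type_act by (cases g) (simp add: gelfand_G_carrier)

text \<open>Translating by \<open>g\<close> turns the pair of \<open>g\<inverse> e\<close> and
  \<open>e\<close> into the pair of \<open>e\<close> and \<open>g e\<close>, and types ignore order,
  so \<open>g e\<close> and \<open>g\<inverse> e\<close> lie in one sphere. Some \<open>h\<close> in
  \<open>K\<close> maps the first to the second. Then \<open>g h g\<close> fixes \<open>e\<close>,
  hence lies in \<open>K\<close>, and its inverse is the right factor sought.\<close>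

lemma gelfand_symmetric:
  assumes g: "g \<in> carrier (gelfand_G k n)"
  shows "\<exists>h\<in>gelfand_K k n. \<exists>h'\<in>gelfand_K k n.
    inv\<^bsub>gelfand_G k n\<^esub> g = h \<otimes>\<^bsub>gelfand_G k n\<^esub> g \<otimes>\<^bsub>gelfand_G k n\<^esub> h'"
proof -
  let ?e = "id_injection k" and ?G = "gelfand_G k n"
  note e = id_injection_in[OF kn]
  have ig: "inv\<^bsub>?G\<^esub> g \<in> carrier ?G" using g by simp
  have "cycle_path_type k n (inj_act k (inv\<^bsub>?G\<^esub> g) ?e) ?e = cycle_path_type k n ?e (inj_act k g ?e)"
    using cycle_path_type_gelfand_act[OF g, of "inj_act k (inv\<^bsub>?G\<^esub> g) ?e" ?e] inj.act_inv'[OF g e] by simp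
  then have "cycle_path_type k n (inj_act k g ?e) ?e = cycle_path_type k n (inj_act k (inv\<^bsub>?G\<^esub> g) ?e) ?e"
    using cycle_path_type_commute by metis
  then obtain h where h: "h \<in> gelfand_K k n" "inj_act k h (inj_act k g ?e) = inj_act k (inv\<^bsub>?G\<^esub> g) ?e"
    using sphere_conjugate[OF kn inj.act_closed[OF g e] inj.act_closed[OF ig e]] by blast
  have hc: "h \<in> carrier ?G" using h(1) gelfand_K_carrier by blast
  let ?m = "g \<otimes>\<^bsub>?G\<^esub> (h \<otimes>\<^bsub>?G\<^esub> g)"
  have "inj_act k ?m ?e = ?e"
    using g hc e h(2) by (simp add: inj.act_mult inj.act_closed)
  then have m: "?m \<in> gelfand_K k n" using gelfand_K_stabilizer g hc by simp
  have "inv\<^bsub>?G\<^esub> g = h \<otimes>\<^bsub>?G\<^esub> g \<otimes>\<^bsub>?G\<^esub> inv\<^bsub>?G\<^esub> ?m"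
    using g hc by (simp add: inj.inv_mult_group inj.m_assoc) (simp add: inj.m_assoc[symmetric])
  then show ?thesis
    using h(1) subgroup.m_inv_closed[OF gelfand_K_subgroup m] by blast
qed

lemma sphere_subset: "injection_sphere k n \<tau> \<subseteq> injections k n"
  by (auto simp: injection_sphere_def)

lemma sum_sphere_act:
  assumes h: "h \<in> gelfand_K k n"
  shows "(\<Sum>\<sigma>\<in>injection_sphere k n \<tau>. f (inj_act k h \<sigma>)) = (\<Sum>\<sigma>\<in>injection_sphere k n \<tau>. f \<sigma>)"
proof (rule sum.reindex_bij_betw)
  have closed: "inj_act k h \<sigma> \<in> injection_sphere k n \<tau>"
    if "h \<in> gelfand_K k n" "\<sigma> \<in> injection_sphere k n \<tau>" for h \<sigma>
  proof -
    have hc: "h \<in> carrier (gelfand_G k n)" using that(1) gelfand_K_carrier by blast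
    show ?thesis
      using that(2) cycle_path_type_gelfand_act[OF hc, of \<sigma> "id_injection k"] gelfand_K_fix[OF that(1)] inj.act_closed[OF hc]
      by (simp add: injection_sphere_def)
  qed
  have hc: "h \<in> carrier (gelfand_G k n)" using h gelfand_K_carrier by blast
  show "bij_betw (inj_act k h) (injection_sphere k n \<tau>) (injection_sphere k n \<tau>)"
  proof (rule bij_betw_byWitness[where f' = "inj_act k (inv\<^bsub>gelfand_G k n\<^esub> h)"])
    show "inj_act k h ` injection_sphere k n \<tau> \<subseteq> injection_sphere k n \<tau>"
      using closed[OF h] by blast
    show "inj_act k (inv\<^bsub>gelfand_G k n\<^esub> h) ` injection_sphere k n \<tau> \<subseteq> injection_sphere k n \<tau>"
      using closed[OF subgroup.m_inv_closed[OF gelfand_K_subgroup h]] by blast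
  qed (use sphere_subset inj.act_inv[OF hc] inj.act_inv'[OF hc] in blast)+
qed

end

section \<open>The covering map and its value at the identity injection\<close>

definition cover_map :: "nat \<Rightarrow> nat \<Rightarrow> nat list \<Rightarrow> nat list \<Rightarrow> (tabloid \<times> tabloid \<Rightarrow> complex) \<Rightarrow> (nat \<Rightarrow> nat) \<Rightarrow> complex" where
  "cover_map k n mu lam F = (\<lambda>\<sigma>. if \<sigma> \<in> injections k n
     then \<Sum>y\<in>tabloids mu \<times> tabloids lam. F y * cover_indicator k (fst y) (snd y) \<sigma> else 0)"

lemma cover_map_add: "cover_map k n mu lam (F + F') = cover_map k n mu lam F + cover_map k n mu lam F'"
  by (auto simp: cover_map_def fun_eq_iff sum.distrib algebra_simps)

lemma cover_map_scale: "cover_map k n mu lam (cscale c F) = cscale c (cover_map k n mu lam F)"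
  by (auto simp: cover_map_def fun_eq_iff sum_distrib_left algebra_simps)

lemma cover_map_zero: "cover_map k n mu lam 0 = 0"
  by (auto simp: cover_map_def fun_eq_iff)

lemma cover_map_sum: "cover_map k n mu lam (\<Sum>i\<in>I. f i) = (\<Sum>i\<in>I. cover_map k n mu lam (f i))"
  by (induction I rule: infinite_finite_induct)
     (simp_all only: sum.infinite sum.empty sum.insert cover_map_zero cover_map_add simp_thms)

lemma cover_map_free_space: "cover_map k n mu lam F \<in> free_space (injections k n)"
  by (simp add: cover_map_def free_space_def)

lemma cover_map_delta:
  assumes "S \<in> tabloids mu" "T \<in> tabloids lam" "\<sigma> \<in> injections k n"
  shows "cover_map k n mu lam (delta (S, T)) \<sigma> = cover_indicator k S T \<sigma>"
proof -
  have "cover_map k n mu lam (delta (S, T)) \<sigma> =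
      (\<Sum>y\<in>tabloids mu \<times> tabloids lam. if y = (S, T) then cover_indicator k S T \<sigma> else 0)"
    using assms(3) unfolding cover_map_def by (auto simp: delta_def intro!: sum.cong)
  also have "\<dots> = cover_indicator k S T \<sigma>"
    using assms by (subst sum.delta) (auto simp: finite_tabloids)
  finally show ?thesis .
qed

lemma covers_act:
  assumes "\<pi> permutes {1..k}" "\<rho> permutes {1..n}"
  shows "covers k (tabloid_act \<pi> S) (tabloid_act \<rho> T) (inj_act k (\<pi>, \<rho>) \<sigma>) \<longleftrightarrow> covers k S T \<sigma>"
proof -
  have row: "row_index (tabloid_act \<pi> S) (\<pi> j) = row_index S j" for j
    by (rule row_index_act[OF permutes_inj[OF assms(1)]])
  have row': "row_index (tabloid_act \<rho> T) (\<rho> j) = row_index T j" for j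
    by (rule row_index_act[OF permutes_inj[OF assms(2)]])
  have "covers k (tabloid_act \<pi> S) (tabloid_act \<rho> T) (inj_act k (\<pi>, \<rho>) \<sigma>) \<longleftrightarrow>
      (\<forall>i\<in>\<pi> ` {1..k}. row_index (tabloid_act \<pi> S) i = row_index (tabloid_act \<rho> T) (\<rho> (\<sigma> (inv' \<pi> i))))"
    unfolding permutes_image[OF assms(1)] by (simp add: covers_def inj_act_def)
  also have "\<dots> \<longleftrightarrow> covers k S T \<sigma>"
    using permutes_inverses(2)[OF assms(1)] by (simp add: covers_def row row')
  finally show ?thesis .
qed

text \<open>Covering the identity injection keeps every entry up to \<open>k\<close> in its row, and
  \<pi> keeps it in its column, so these entries are fixed. Each column has at most one further
  cell, so the remaining entries have nowhere to go.\<close>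

lemma strip_diagonal:
  assumes "horizontal_strip lam mu" "\<pi> \<in> column_stabilizer lam (strip_tableau lam mu)"
    and cov: "covers (sum_list mu) (tabloid_of mu (row_tableau mu))
      (tabloid_of lam (\<pi> \<circ> strip_tableau lam mu)) (id_injection (sum_list mu))"
  shows "\<pi> = id"
proof -
  let ?s = "row_tableau mu" and ?t = "strip_tableau lam mu"
  have s: "is_tableau mu ?s" by (rule row_tableau_is_tableau)
  have t: "is_tableau lam ?t" by (rule strip_tableau_is_tableau[OF assms(1)])
  have \<pi>: "\<pi> permutes {1..sum_list lam}" by (rule column_stabilizer_permutes[OF assms(2)])
  have \<pi>t: "is_tableau lam (\<pi> \<circ> ?t)" by (rule is_tableau_comp[OF t \<pi>])
  have sub: "diagram mu \<subseteq> diagram lam" and strip: "inj_on snd (skew_diagram lam mu)"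
    using assms(1) by (auto simp: horizontal_strip_def)
  have t_mu: "?t c = ?s c" if "c \<in> diagram mu" for c
    using that by (simp add: strip_tableau_def)
  have fix_mu: "\<pi> (?t c) = ?t c" if c: "c \<in> diagram mu" for c
  proof -
    have "?t c \<in> (\<pi> \<circ> ?t) ` diagram lam"
      using is_tableau_image[OF \<pi>t] is_tableau_image[OF t] c sub by blast
    \<comment> \<open>The cell \<open>d\<close> is where \<open>\<pi> \<circ> t\<close> shows the
      entry \<open>t c\<close>. It shares the column of \<open>c\<close> because \<pi> preserves
      columns and the row of \<open>c\<close> by the covering condition.\<close>
    then obtain d where d: "d \<in> diagram lam" "\<pi> (?t d) = ?t c" by auto
    obtain d' where d': "d' \<in> diagram lam" "\<pi> (?t d) = ?t d'" "snd d' = snd d"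
      using column_stabilizerE[OF assms(2) d(1)] by blast
    have "d' = c" using d(2) d'(1,2) c sub inj_onD[OF is_tableau_inj[OF t], of d' c] by auto
    have "?s c \<in> {1..sum_list mu}" using is_tableau_image[OF s] c by blast
    then have "row_index (tabloid_of mu ?s) (?s c) = row_index (tabloid_of lam (\<pi> \<circ> ?t)) (?s c)"
      using cov by (simp add: covers_def id_injection_def)
    moreover have "row_index (tabloid_of lam (\<pi> \<circ> ?t)) (?s c) = fst d"
      using row_index_tabloid_of[OF \<pi>t d(1)] d(2) t_mu[OF c] by simp
    ultimately have "fst c = fst d" using row_index_tabloid_of[OF s c] by simp
    then have "d = c" using d'(3) \<open>d' = c\<close> by (simp add: prod_eq_iff)
    with d(2) show ?thesis by simp
  qed
  have "\<pi> (?t c) = ?t c" if c: "c \<in> diagram lam" for c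
  proof (cases "c \<in> diagram mu")
    case False
    obtain c' where c': "c' \<in> diagram lam" "\<pi> (?t c) = ?t c'" "snd c' = snd c"
      using column_stabilizerE[OF assms(2) c] by blast
    have "c' \<notin> diagram mu"
    proof
      assume "c' \<in> diagram mu"
      then have "\<pi> (?t c) = \<pi> (?t c')" using fix_mu c'(2) by simp
      then have "?t c = ?t c'" using permutes_inj[OF \<pi>] by (simp add: inj_eq)
      then have "c = c'" using inj_onD[OF is_tableau_inj[OF t]] c c'(1) by blast
      with False \<open>c' \<in> diagram mu\<close> show False by simp
    qed
    then have "c' = c"
      using inj_onD[OF strip c'(3)] c c'(1) False by (simp add: skew_diagram_def)
    with c'(2) show ?thesis by simp
  qed (rule fix_mu)
  then have "\<pi> x = x" if "x \<in> {1..sum_list lam}" for x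
    using that unfolding is_tableau_image[OF t, symmetric] by blast
  then have "\<pi> x = id x" for x using permutes_not_in[OF \<pi>] by (cases "x \<in> {1..sum_list lam}") auto
  then show ?thesis ..
qed

text \<open>On the cells of \<mu> the tableau \<open>t\<close> coincides with \<open>s\<close>, and
  the entries on the strip exceed \<open>k\<close>, where \<open>a\<close> is the identity. It lets
  the pair \<open>(a, a)\<close> act on both tensor factors by column permutations.\<close>

lemma column_stabilizer_subset:
  assumes "horizontal_strip lam mu"
  shows "column_stabilizer mu (row_tableau mu) \<subseteq> column_stabilizer lam (strip_tableau lam mu)"
proof
  fix a assume a: "a \<in> column_stabilizer mu (row_tableau mu)"
  have sub: "diagram mu \<subseteq> diagram lam" using assms by (auto simp: horizontal_strip_def)
  then have le: "sum_list mu \<le> sum_list lam"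
    using card_mono[OF finite_diagram] by (metis card_diagram)
  have pa: "a permutes {1..sum_list mu}" by (rule column_stabilizer_permutes[OF a])
  have t: "is_tableau lam (strip_tableau lam mu)" by (rule strip_tableau_is_tableau[OF assms])
  show "a \<in> column_stabilizer lam (strip_tableau lam mu)"
  proof (rule column_stabilizerI)
    show "a permutes {1..sum_list lam}" by (rule permutes_subset[OF pa]) (use le in auto)
    fix c assume c: "c \<in> diagram lam"
    show "\<exists>c'\<in>diagram lam. a (strip_tableau lam mu c) = strip_tableau lam mu c' \<and> snd c' = snd c"
    proof (cases "c \<in> diagram mu")
      case True
      obtain c' where "c' \<in> diagram mu" "a (row_tableau mu c) = row_tableau mu c'" "snd c' = snd c"
        using column_stabilizerE[OF a True] by blast
      then show ?thesis using True sub by (intro bexI[of _ c']) (auto simp: strip_tableau_def)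
    next
      case False
      have "strip_tableau lam mu c \<notin> strip_tableau lam mu ` diagram mu"
        using inj_on_image_mem_iff[OF is_tableau_inj[OF t] c sub] False by simp
      moreover have "strip_tableau lam mu ` diagram mu = {1..sum_list mu}"
        unfolding is_tableau_image[OF row_tableau_is_tableau, symmetric]
        by (intro image_cong refl) (simp add: strip_tableau_def)
      ultimately have "a (strip_tableau lam mu c) = strip_tableau lam mu c"
        using permutes_not_in[OF pa] by simp
      then show ?thesis using c by blast
    qed
  qed
qed

section \<open>The spherical vector\<close>

context
  fixes k n :: nat and mu lam :: "nat list"
  assumes kn: "k \<le> n" and part_mu: "partition_of k mu" and part_lam: "partition_of n lam"
    and strip: "horizontal_strip lam mu"
begin

private abbreviation (input) "s0 \<equiv> row_tableau mu"
private abbreviation (input) "t0 \<equiv> strip_tableau lam mu"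
private abbreviation (input) "id\<^sub>k \<equiv> id_injection k"
private abbreviation (input) "\<Phi> \<equiv> cover_map k n mu lam"
text \<open>The first factor is a bare tabloid, so this vector need not lie in \<open>V\<close>; it
  is kept because its image under \<Phi> is the signed sum of the theorem term by term.\<close>

private abbreviation (input) "f0 \<equiv> ftensor (delta (tabloid_of mu s0)) (polytabloid lam t0)"

private lemma sum_mu: "sum_list mu = k" and sorted_mu: "sorted_wrt (\<ge>) mu"
  and sum_lam: "sum_list lam = n" and sorted_lam: "sorted_wrt (\<ge>) lam"
  using part_mu part_lam by (auto simp: partition_of_def)

private lemma s0_tableau: "is_tableau mu s0" by (rule row_tableau_is_tableau)

private lemma t0_tableau: "is_tableau lam t0" by (rule strip_tableau_is_tableau[OF strip])

interpretation inj: perm_action "gelfand_G k n" "inj_act k" "injections k n"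
  rewrites "perm_rep (gelfand_G k n) (inj_act k) (injections k n) = inj_rep k n"
  by (rule perm_action_injections) (simp add: inj_rep_def)

interpretation tens: subgroup_average "gelfand_G k n"
  "\<lambda>(\<pi>, \<rho>) (T, U). (tabloid_act \<pi> T, tabloid_act \<rho> U)" "tabloids mu \<times> tabloids lam" "gelfand_K k n"
  rewrites "perm_rep (gelfand_G k n)
    (\<lambda>(\<pi>, \<rho>) (T, U). (tabloid_act \<pi> T, tabloid_act \<rho> U)) (tabloids mu \<times> tabloids lam) = tensor_rep mu lam"
proof -
  show "subgroup_average (gelfand_G k n) (\<lambda>(\<pi>, \<rho>) (T, U). (tabloid_act \<pi> T, tabloid_act \<rho> U))
      (tabloids mu \<times> tabloids lam) (gelfand_K k n)"
    using perm_action_tensor[of mu lam] gelfand_K_subgroup[OF kn] sum_mu sum_lam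
    by (simp add: subgroup_average_def subgroup_average_axioms_def)
qed (simp add: tensor_rep_def sum_mu sum_lam)

lemma cover_map_rep:
  assumes g: "g \<in> carrier (gelfand_G k n)"
  shows "\<Phi> (tensor_rep mu lam g F) = inj_rep k n g (\<Phi> F)"
proof
  fix \<sigma>
  let ?Y = "tabloids mu \<times> tabloids lam"
  obtain \<pi> \<rho> where \<pi>\<rho>: "g = (\<pi>, \<rho>)" "\<pi> permutes {1..k}" "\<rho> permutes {1..n}"
    using g by (cases g) (auto simp: gelfand_G_carrier)
  let ?a = "\<lambda>(\<pi>, \<rho>) (T, U). (tabloid_act \<pi> T, tabloid_act \<rho> U)"
  show "\<Phi> (tensor_rep mu lam g F) \<sigma> = inj_rep k n g (\<Phi> F) \<sigma>"
  proof (cases "\<sigma> \<in> injections k n")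
    case True
    let ?\<sigma>' = "inj_act k (inv\<^bsub>gelfand_G k n\<^esub> g) \<sigma>"
    have \<sigma>': "?\<sigma>' \<in> injections k n" "inj_act k g ?\<sigma>' = \<sigma>"
      using True g by (simp_all add: inj.act_closed)
    have cov: "cover_indicator k (fst (?a g y)) (snd (?a g y)) \<sigma> = cover_indicator k (fst y) (snd y) ?\<sigma>'" for y
      using covers_act[OF \<pi>\<rho>(2,3), of "fst y" "snd y" ?\<sigma>'] \<sigma>'(2)
      by (cases y) (simp add: cover_indicator_def \<pi>\<rho>(1))
    have "\<Phi> (tensor_rep mu lam g F) \<sigma> =
        (\<Sum>y\<in>?Y. tensor_rep mu lam g F (?a g y) * cover_indicator k (fst (?a g y)) (snd (?a g y)) \<sigma>)"
      using True tens.sum_act[OF g, of "\<lambda>y. tensor_rep mu lam g F y * cover_indicator k (fst y) (snd y) \<sigma>"]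
      by (simp only: cover_map_def if_True)
    also have "\<dots> = (\<Sum>y\<in>?Y. F y * cover_indicator k (fst y) (snd y) ?\<sigma>')"
    proof (intro sum.cong refl)
      fix y assume y: "y \<in> ?Y"
      have "tensor_rep mu lam g F (?a g y) = F (?a (inv\<^bsub>gelfand_G k n\<^esub> g) (?a g y))"
        using tens.act_closed[OF g y] unfolding tensor_rep_def perm_rep_def sum_mu sum_lam by (simp only: if_True)
      then show "tensor_rep mu lam g F (?a g y) * cover_indicator k (fst (?a g y)) (snd (?a g y)) \<sigma> =
          F y * cover_indicator k (fst y) (snd y) ?\<sigma>'"
        by (simp only: cov tens.act_inv[OF g y])
    qed
    also have "\<dots> = inj_rep k n g (\<Phi> F) \<sigma>"
      using True \<sigma>'(1) by (simp add: inj_rep_def perm_rep_def cover_map_def)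
    finally show ?thesis .
  qed (simp add: cover_map_def inj_rep_def perm_rep_def)
qed

text \<open>By transitivity every value of \<Phi> becomes a value at the identity injection of a
  translated vector, which is where the invariant functional lives.\<close>

lemma cover_map_act:
  assumes g: "g \<in> carrier (gelfand_G k n)" and \<sigma>: "\<sigma> \<in> injections k n"
  shows "\<Phi> F (inj_act k g \<sigma>) = \<Phi> (tensor_rep mu lam (inv\<^bsub>gelfand_G k n\<^esub> g) F) \<sigma>"
proof -
  have "\<Phi> (tensor_rep mu lam (inv\<^bsub>gelfand_G k n\<^esub> g) F) \<sigma> = inj_rep k n (inv\<^bsub>gelfand_G k n\<^esub> g) (\<Phi> F) \<sigma>"
    using g by (simp add: cover_map_rep)
  also have "\<dots> = \<Phi> F (inj_act k (inv\<^bsub>gelfand_G k n\<^esub> (inv\<^bsub>gelfand_G k n\<^esub> g)) \<sigma>)"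
    using \<sigma> unfolding inj_rep_def perm_rep_def by (simp only: if_True)
  finally show ?thesis using g by simp
qed

private lemma e_in: "id\<^sub>k \<in> injections k n" by (rule id_injection_in[OF kn])

private lemma K_carrier: "h \<in> gelfand_K k n \<Longrightarrow> h \<in> carrier (gelfand_G k n)"
  by (rule tens.K_carrier)

lemma cover_map_rep_id:
  assumes "h \<in> gelfand_K k n"
  shows "\<Phi> (tensor_rep mu lam h F) id\<^sub>k = \<Phi> F id\<^sub>k"
proof -
  have ih: "inv\<^bsub>gelfand_G k n\<^esub> h \<in> gelfand_K k n"
    using subgroup.m_inv_closed[OF gelfand_K_subgroup[OF kn] assms] .
  show ?thesis
    using cover_map_act[OF K_carrier[OF ih] e_in, of F] gelfand_K_fix[OF kn ih] K_carrier[OF assms] by simp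
qed

lemma cover_map_F0:
  assumes "\<sigma> \<in> injections k n"
  shows "\<Phi> f0 \<sigma> = (\<Sum>\<pi>\<in>column_stabilizer lam t0.
    of_int (sign \<pi>) * cover_indicator k (tabloid_of mu s0) (tabloid_of lam (\<pi> \<circ> t0)) \<sigma>)"
proof -
  have "f0 = (\<Sum>\<pi>\<in>column_stabilizer lam t0.
      cscale (of_int (sign \<pi>)) (delta (tabloid_of mu s0, tabloid_of lam (\<pi> \<circ> t0))))"
    by (rule ext) (auto simp: ftensor_def polytabloid_sum sum_fun_apply sum_distrib_left delta_def intro!: sum.cong)
  then have "\<Phi> f0 \<sigma> = (\<Sum>\<pi>\<in>column_stabilizer lam t0.
      of_int (sign \<pi>) * \<Phi> (delta (tabloid_of mu s0, tabloid_of lam (\<pi> \<circ> t0))) \<sigma>)"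
    by (simp only: cover_map_sum cover_map_scale sum_fun_apply cscale_apply)
  also have "\<dots> = (\<Sum>\<pi>\<in>column_stabilizer lam t0.
    of_int (sign \<pi>) * cover_indicator k (tabloid_of mu s0) (tabloid_of lam (\<pi> \<circ> t0)) \<sigma>)"
    by (intro sum.cong refl)
       (simp only: cover_map_delta[OF tabloid_of_tabloids[OF s0_tableau] tabloid_of_tabloids[OF
          is_tableau_comp[OF t0_tableau column_stabilizer_permutes[of _ _ t0]]] assms])
  finally show ?thesis .
qed

lemma cover_map_F0_id: "\<Phi> f0 id\<^sub>k = 1"
proof -
  have "\<Phi> f0 id\<^sub>k = (\<Sum>\<pi>\<in>column_stabilizer lam t0. if \<pi> = id then 1 else 0)"
    unfolding cover_map_F0[OF e_in]
  proof (intro sum.cong refl)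
    fix \<pi> assume \<pi>: "\<pi> \<in> column_stabilizer lam t0"
    \<comment> \<open>As \<open>t\<close> extends \<open>s\<close>, each entry up to
      \<open>k\<close> is in the same row of both, so the term at the identity permutation is
      1.\<close>
    have "covers k (tabloid_of mu s0) (tabloid_of lam t0) id\<^sub>k"
    proof -
      have "row_index (tabloid_of mu s0) i = row_index (tabloid_of lam t0) i" if i: "i \<in> {1..k}" for i
      proof -
        obtain c where c: "c \<in> diagram mu" "i = s0 c"
          using i is_tableau_image[OF s0_tableau] sum_mu by blast
        then have "c \<in> diagram lam" "t0 c = i"
          using strip by (auto simp: horizontal_strip_def strip_tableau_def)
        then show ?thesis
          using row_index_tabloid_of[OF s0_tableau c(1)] row_index_tabloid_of[OF t0_tableau, of c] c(2) by simp
      qed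
      then show ?thesis by (simp add: covers_def id_injection_def)
    qed
    moreover have "\<pi> = id" if "covers k (tabloid_of mu s0) (tabloid_of lam (\<pi> \<circ> t0)) id\<^sub>k"
      using strip_diagonal[OF strip \<pi>] that by (simp add: sum_mu)
    ultimately show "of_int (sign \<pi>) * cover_indicator k (tabloid_of mu s0) (tabloid_of lam (\<pi> \<circ> t0)) id\<^sub>k
        = (if \<pi> = id then 1 else 0)"
      by (auto simp: cover_indicator_def)
  qed
  also have "\<dots> = 1"
    using column_stabilizer_id[of lam t0] by (subst sum.delta) (simp_all add: finite_column_stabilizer)
  finally show ?thesis .
qed

text \<open>Averaging \<open>f0\<close> instead of the polytensor gives a vector with value exactly
  1 at the identity injection.\<close>

definition spherical_vector :: "tabloid \<times> tabloid \<Rightarrow> complex" where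
  "spherical_vector = tens.avg f0"

text \<open>A column permutation \<open>a\<close> of \<open>s\<close> is also one of
  \<open>t\<close>, so the pair \<open>(a, a)\<close> moves the tabloid of \<open>s\<close> and
  multiplies the polytabloid of \<open>t\<close> by its sign. Summation over \<open>a\<close> thus
  produces the alternating sum in the first factor.\<close>

lemma polytensor_diagonal:
  "polytensor mu lam s0 t0 = (\<Sum>a\<in>column_stabilizer mu s0. tensor_rep mu lam (a, a) f0)"
proof -
  have "tensor_rep mu lam (a, a) f0 =
      cscale (of_int (sign a)) (ftensor (delta (tabloid_of mu (a \<circ> s0))) (polytabloid lam t0))"
    if a: "a \<in> column_stabilizer mu s0" for a
  proof -
    have aT: "a \<in> column_stabilizer lam t0" using column_stabilizer_subset[OF strip] a by blast
    note p = column_stabilizer_permutes[OF a] column_stabilizer_permutes[OF aT]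
    show ?thesis
      by (simp only: tensor_rep_ftensor[OF p] tabloid_rep_delta[OF p(1) tabloid_of_tabloids[OF s0_tableau]]
          tabloid_act_tabloid_of tabloid_rep_polytabloid_sign[OF t0_tableau aT] ftensor_scale_right)
  qed
  then have "(\<Sum>a\<in>column_stabilizer mu s0. tensor_rep mu lam (a, a) f0) =
    (\<Sum>a\<in>column_stabilizer mu s0. cscale (of_int (sign a)) (ftensor (delta (tabloid_of mu (a \<circ> s0))) (polytabloid lam t0)))"
    by (rule sum.cong[OF refl])
  also have "\<dots> = polytensor mu lam s0 t0"
    by (rule ext) (auto simp: ftensor_def polytabloid_sum[of mu] sum_fun_apply sum_distrib_left mult_ac intro!: sum.cong)
  finally show ?thesis ..
qed

text \<open>The pairs \<open>(a, a)\<close> lie in \<open>K\<close> and are absorbed by averaging,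
  so the average of the polytensor is \<open>?N\<close> times that of \<open>f0\<close>; dividing by
  \<open>?N\<close> exhibits the latter inside \<open>V\<close>.\<close>

lemma spherical_vector_in: "spherical_vector \<in> specht_tensor mu lam"
proof -
  let ?N = "of_nat (card (column_stabilizer mu s0)) :: complex"
  have diag: "(a, a) \<in> gelfand_K k n" if "a \<in> column_stabilizer mu s0" for a
    using column_stabilizer_permutes[OF that] unfolding gelfand_K_def sum_mu
    by (intro CollectI exI[of _ a] exI[of _ id]) (simp add: permutes_id)
  have "tens.avg (polytensor mu lam s0 t0) = (\<Sum>a\<in>column_stabilizer mu s0. tens.avg f0)"
    unfolding polytensor_diagonal tens.avg_sum by (intro sum.cong refl tens.avg_rep diag)
  also have "\<dots> = cscale ?N (tens.avg f0)"
    by (simp add: fun_eq_iff sum_fun_apply)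
  finally have "spherical_vector = cscale (1 / ?N) (tens.avg (polytensor mu lam s0 t0))"
    using column_stabilizer_id[of mu s0] finite_column_stabilizer[of mu s0]
    by (auto simp: spherical_vector_def card_eq_0_iff)
  moreover have "tens.avg (polytensor mu lam s0 t0) \<in> specht_tensor mu lam"
  proof (rule tens.avg_in_subrep)
    show "subrep (gelfand_G k n) (tensor_rep mu lam) (specht_tensor mu lam)"
      using specht_tensor_subrep[OF sorted_mu sorted_lam] by (simp add: sum_mu sum_lam)
    show "polytensor mu lam s0 t0 \<in> specht_tensor mu lam"
      unfolding specht_tensor_span by (rule cfun.span_base) (use s0_tableau t0_tableau in blast)
  qed
  ultimately show ?thesis
    unfolding specht_tensor_def by (simp only: cfun.span_scale)
qed

lemma F0_free: "f0 \<in> free_space (tabloids mu \<times> tabloids lam)"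
  using tabloid_of_tabloids[OF s0_tableau] polytabloid_free_space[OF t0_tableau]
  by (auto simp: free_space_def ftensor_def delta_def)

lemma cover_map_spherical_vector:
  "\<Phi> spherical_vector \<sigma> = 1 / of_nat (card (gelfand_K k n)) * (\<Sum>h\<in>gelfand_K k n. \<Phi> (tensor_rep mu lam h f0) \<sigma>)"
  by (simp only: spherical_vector_def tens.avg_def cover_map_scale cover_map_sum cscale_apply sum_fun_apply)

lemma spherical_vector_id: "\<Phi> spherical_vector id\<^sub>k = 1"
  using tens.card_K_pos by (simp add: cover_map_spherical_vector cover_map_rep_id cover_map_F0_id)

lemma spherical_vector_real: "spherical_vector x \<in> \<real>"
proof -
  have "polytabloid lam t0 U \<in> \<real>" for U
    unfolding polytabloid_def by (intro sum_in_Reals) (auto simp: sign_def)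
  then have "f0 x \<in> \<real>" for x by (cases x) (auto simp: ftensor_def delta_def)
  then have "tensor_rep mu lam h f0 x \<in> \<real>" for h by (auto simp: tensor_rep_def perm_rep_def)
  then show ?thesis
    unfolding spherical_vector_def tens.avg_def by (auto simp: sum_fun_apply intro!: sum_in_Reals)
qed

interpretation sph: spherical_module "gelfand_G k n"
  "\<lambda>(\<pi>, \<rho>) (T, U). (tabloid_act \<pi> T, tabloid_act \<rho> U)" "tabloids mu \<times> tabloids lam" "gelfand_K k n"
  "specht_tensor mu lam" "\<lambda>F. \<Phi> F id\<^sub>k" spherical_vector
  rewrites "perm_rep (gelfand_G k n)
    (\<lambda>(\<pi>, \<rho>) (T, U). (tabloid_act \<pi> T, tabloid_act \<rho> U)) (tabloids mu \<times> tabloids lam) = tensor_rep mu lam"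
proof -
  let ?a = "\<lambda>(\<pi>, \<rho>) (T, U). (tabloid_act \<pi> T, tabloid_act \<rho> U)"
  show eq: "perm_rep (gelfand_G k n) ?a (tabloids mu \<times> tabloids lam) = tensor_rep mu lam"
    by (simp add: tensor_rep_def sum_mu sum_lam)
  show "spherical_module (gelfand_G k n) ?a (tabloids mu \<times> tabloids lam) (gelfand_K k n)
      (specht_tensor mu lam) (\<lambda>F. \<Phi> F id\<^sub>k) spherical_vector"
  proof (intro spherical_module.intro tens.subgroup_average_axioms spherical_module_axioms.intro, unfold eq)
    show "subrep (gelfand_G k n) (tensor_rep mu lam) (specht_tensor mu lam)"
      using specht_tensor_subrep[OF sorted_mu sorted_lam] by (simp add: sum_mu sum_lam)
    show "specht_tensor mu lam \<subseteq> free_space (tabloids mu \<times> tabloids lam)"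
      by (rule specht_tensor_free_space[OF sorted_mu sorted_lam])
    show "\<exists>h\<in>gelfand_K k n. \<exists>h'\<in>gelfand_K k n. inv\<^bsub>gelfand_G k n\<^esub> g = h \<otimes>\<^bsub>gelfand_G k n\<^esub> g \<otimes>\<^bsub>gelfand_G k n\<^esub> h'"
      if "g \<in> carrier (gelfand_G k n)" for g
      by (rule gelfand_symmetric[OF kn that])
    show "\<exists>c. \<forall>f\<in>specht_tensor mu lam. U f = cscale c f"
      if "\<And>f f'. U (f + f') = U f + U f'" "\<And>c f. U (cscale c f) = cscale c (U f)"
        "\<And>f. f \<in> free_space (tabloids mu \<times> tabloids lam) \<Longrightarrow> U f \<in> free_space (tabloids mu \<times> tabloids lam)"
        "\<And>g f. g \<in> carrier (gelfand_G k n) \<Longrightarrow> f \<in> free_space (tabloids mu \<times> tabloids lam) \<Longrightarrow>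
          U (tensor_rep mu lam g f) = tensor_rep mu lam g (U f)" for U
      using specht_tensor_schur[OF sorted_mu sorted_lam, unfolded sum_mu sum_lam, of U] that by blast
    show "\<Phi> (f + f') id\<^sub>k = \<Phi> f id\<^sub>k + \<Phi> f' id\<^sub>k" for f f' by (simp only: cover_map_add plus_fun_apply)
    show "\<Phi> (cscale c f) id\<^sub>k = c * \<Phi> f id\<^sub>k" for c f by (simp only: cover_map_scale cscale_apply)
    show "\<Phi> (tensor_rep mu lam h f) id\<^sub>k = \<Phi> f id\<^sub>k" if "h \<in> gelfand_K k n" for h f
      by (rule cover_map_rep_id[OF that])
    show "spherical_vector \<in> specht_tensor mu lam" by (rule spherical_vector_in)
    show "tensor_rep mu lam h spherical_vector = spherical_vector" if "h \<in> gelfand_K k n" for h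
      unfolding spherical_vector_def by (rule tens.rep_avg[OF that])
    show "\<Phi> spherical_vector id\<^sub>k = 1" by (rule spherical_vector_id)
    show "spherical_vector x \<in> \<real>" for x by (rule spherical_vector_real)
  qed
qed

section \<open>The spherical function and the character table\<close>

lemma spherical_function_cover_map:
  assumes g: "g \<in> carrier (gelfand_G k n)"
  shows "spherical_function k n mu lam g = \<Phi> spherical_vector (inj_act k g id\<^sub>k)"
  unfolding cover_map_act[OF g e_in]
  using sph.average_trace[OF g] by (simp add: spherical_function_def tensor_character_def)

text \<open>A sphere is stable under \<open>K\<close>, so summing over it makes each translate by an
  element of \<open>K\<close> contribute what \<open>f0\<close> contributes.\<close>

lemma sum_sphere_spherical_vector:
  "(\<Sum>\<sigma>\<in>injection_sphere k n \<tau>. \<Phi> spherical_vector \<sigma>) = (\<Sum>\<sigma>\<in>injection_sphere k n \<tau>. \<Phi> f0 \<sigma>)"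
proof -
  let ?C = "injection_sphere k n \<tau>"
  have "(\<Sum>\<sigma>\<in>?C. \<Phi> spherical_vector \<sigma>) =
      1 / of_nat (card (gelfand_K k n)) * (\<Sum>h\<in>gelfand_K k n. \<Sum>\<sigma>\<in>?C. \<Phi> (tensor_rep mu lam h f0) \<sigma>)"
    unfolding cover_map_spherical_vector sum_distrib_left[symmetric] by (subst sum.swap) (rule refl)
  also have "(\<Sum>h\<in>gelfand_K k n. \<Sum>\<sigma>\<in>?C. \<Phi> (tensor_rep mu lam h f0) \<sigma>) =
      (\<Sum>h\<in>gelfand_K k n. \<Sum>\<sigma>\<in>?C. \<Phi> f0 \<sigma>)"
  proof (rule sum.cong[OF refl])
    fix h assume h: "h \<in> gelfand_K k n"
    have "(\<Sum>\<sigma>\<in>?C. \<Phi> (tensor_rep mu lam h f0) \<sigma>) = (\<Sum>\<sigma>\<in>?C. \<Phi> (tensor_rep mu lam h f0) (inj_act k h \<sigma>))"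
      by (rule sum_sphere_act[OF kn h, symmetric])
    also have "\<dots> = (\<Sum>\<sigma>\<in>?C. \<Phi> f0 \<sigma>)"
      using sphere_subset[OF kn, of \<tau>]
      by (intro sum.cong refl) (simp add: cover_map_act[OF K_carrier[OF h]] subset_iff tens.rep_inv_rep[OF K_carrier[OF h] F0_free])
    finally show "(\<Sum>\<sigma>\<in>?C. \<Phi> (tensor_rep mu lam h f0) \<sigma>) = (\<Sum>\<sigma>\<in>?C. \<Phi> f0 \<sigma>)" .
  qed
  finally show ?thesis using tens.card_K_pos by simp
qed

text \<open>Injections of one sphere are \<open>K\<close>-conjugate and
  \<open>spherical_vector\<close> is \<open>K\<close>-invariant. It makes the description in
  \<open>spherical_value\<close> consistent and lets the common value be replaced by the
  mean.\<close>

lemma spherical_vector_sphere: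
  assumes "\<sigma> \<in> injection_sphere k n \<tau>" "\<sigma>' \<in> injection_sphere k n \<tau>"
  shows "\<Phi> spherical_vector \<sigma> = \<Phi> spherical_vector \<sigma>'"
proof -
  have in_X: "\<sigma> \<in> injections k n" "\<sigma>' \<in> injections k n" using assms sphere_subset[OF kn] by blast+
  obtain h where h: "h \<in> gelfand_K k n" "inj_act k h \<sigma> = \<sigma>'"
    using sphere_conjugate[OF kn in_X] assms by (auto simp: injection_sphere_def)
  have "inv\<^bsub>gelfand_G k n\<^esub> h \<in> gelfand_K k n"
    by (rule subgroup.m_inv_closed[OF gelfand_K_subgroup[OF kn] h(1)])
  then show ?thesis
    using cover_map_act[OF K_carrier[OF h(1)] in_X(1), of spherical_vector] h(2) sph.v_inv by simp
qed

lemma spherical_value_eq: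
  assumes "injection_sphere k n \<tau> \<noteq> {}"
  shows "spherical_value k n mu lam \<tau> =
    1 / of_nat (card (injection_sphere k n \<tau>)) * (\<Sum>\<sigma>\<in>injection_sphere k n \<tau>. \<Phi> f0 \<sigma>)"
proof -
  let ?C = "injection_sphere k n \<tau>"
  obtain \<sigma>0 where \<sigma>0: "\<sigma>0 \<in> ?C" using assms by blast
  obtain g0 where g0: "g0 \<in> carrier (gelfand_G k n)" "inj_act k g0 id\<^sub>k = \<sigma>0"
    using injections_transitive[OF kn] \<sigma>0 sphere_subset[OF kn] by blast
  have fin: "finite ?C" using finite_subset[OF sphere_subset[OF kn] finite_injections] .
  have "spherical_value k n mu lam \<tau> = \<Phi> spherical_vector \<sigma>0"
    unfolding spherical_value_def
  proof (rule the_equality)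
    show "\<forall>g\<in>carrier (gelfand_G k n). inj_act k g id\<^sub>k \<in> ?C \<longrightarrow>
        spherical_function k n mu lam g = \<Phi> spherical_vector \<sigma>0"
      using spherical_function_cover_map spherical_vector_sphere \<sigma>0 by metis
    \<comment> \<open>Uniqueness needs a group element that actually reaches the sphere: the sphere
      is nonempty and the action transitive.\<close>
    show "z = \<Phi> spherical_vector \<sigma>0"
      if "\<forall>g\<in>carrier (gelfand_G k n). inj_act k g id\<^sub>k \<in> ?C \<longrightarrow> spherical_function k n mu lam g = z" for z
      using that g0 \<sigma>0 spherical_function_cover_map by metis
  qed
  also have "\<dots> = 1 / of_nat (card ?C) * (\<Sum>\<sigma>\<in>?C. \<Phi> spherical_vector \<sigma>0)"
    using fin assms by simp
  also have "(\<Sum>\<sigma>\<in>?C. \<Phi> spherical_vector \<sigma>0) = (\<Sum>\<sigma>\<in>?C. \<Phi> spherical_vector \<sigma>)"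
    by (rule sum.cong[OF refl spherical_vector_sphere[OF \<sigma>0]])
  finally show ?thesis by (simp only: sum_sphere_spherical_vector)
qed

text \<open>Existence is injectivity and equivariance of \<Phi>. For uniqueness, an embedding
  followed by evaluation at the identity injection is an invariant functional, hence a multiple of
  the one given by \<Phi>; equivariance and transitivity extend the proportionality to all
  injections, so both embeddings have the same image.\<close>

lemma scheme_subspace_eq: "scheme_subspace k n mu lam = \<Phi> ` specht_tensor mu lam"
  unfolding scheme_subspace_def
proof (rule the_equality)
  let ?V = "specht_tensor mu lam" and ?G = "gelfand_G k n"
  note V = sph.V_subspace
  show "\<Phi> ` ?V \<subseteq> free_space (injections k n) \<and> subrep ?G (inj_rep k n) (\<Phi> ` ?V) \<and>
      rep_iso ?G (tensor_rep mu lam) ?V (inj_rep k n) (\<Phi> ` ?V)"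
  proof (intro conjI)
    show "\<Phi> ` ?V \<subseteq> free_space (injections k n)" using cover_map_free_space by blast
    show "subrep ?G (inj_rep k n) (\<Phi> ` ?V)"
      unfolding subrep_def
    proof (intro conjI ballI)
      show "cfun.subspace (\<Phi> ` ?V)"
      proof (rule cfun.subspaceI)
        show "0 \<in> \<Phi> ` ?V" using cover_map_zero cfun.subspace_0[OF V] by (metis image_eqI)
        show "x + y \<in> \<Phi> ` ?V" if "x \<in> \<Phi> ` ?V" "y \<in> \<Phi> ` ?V" for x y
          using that cfun.subspace_add[OF V] by (auto simp only: cover_map_add[symmetric] intro!: imageI)
        show "cscale c x \<in> \<Phi> ` ?V" if "x \<in> \<Phi> ` ?V" for c x
          using that cfun.subspace_scale[OF V] by (auto simp only: cover_map_scale[symmetric] intro!: imageI)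
      qed
      show "inj_rep k n g f \<in> \<Phi> ` ?V" if "g \<in> carrier ?G" "f \<in> \<Phi> ` ?V" for g f
        using that sph.rep_in_V[OF that(1)] by (auto simp only: cover_map_rep[symmetric] intro!: imageI)
    qed
    have "inj_on \<Phi> ?V"
    proof (rule inj_onI)
      fix x y assume xy: "x \<in> ?V" "y \<in> ?V" "\<Phi> x = \<Phi> y"
      have "\<Phi> (x - y) = 0"
        using cover_map_add[of k n mu lam "x - y" y] xy(3) by (simp only: diff_add_cancel add_cancel_right_left)
      then have "\<Phi> (tensor_rep mu lam g (x - y)) id\<^sub>k = 0" if "g \<in> carrier ?G" for g
        by (simp add: cover_map_rep[OF that] inj_rep_def perm_rep_def)
      then have "x - y = 0"
        using sph.ev_separates[OF cfun.subspace_diff[OF V xy(1,2)]] by blast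
      then show "x = y" by (simp only: right_minus_eq)
    qed
    then show "rep_iso ?G (tensor_rep mu lam) ?V (inj_rep k n) (\<Phi> ` ?V)"
      unfolding rep_iso_def
      by (intro exI[of _ \<Phi>] conjI ballI allI cover_map_add cover_map_scale cover_map_rep inj_on_imp_bij_betw)
  qed
next
  let ?V = "specht_tensor mu lam" and ?G = "gelfand_G k n"
  note V = sph.V_subspace
  fix W assume W: "W \<subseteq> free_space (injections k n) \<and> subrep ?G (inj_rep k n) W \<and>
      rep_iso ?G (tensor_rep mu lam) ?V (inj_rep k n) W"
  then obtain \<phi> where bij: "bij_betw \<phi> ?V W"
    and add: "\<And>u v. u \<in> ?V \<Longrightarrow> v \<in> ?V \<Longrightarrow> \<phi> (u + v) = \<phi> u + \<phi> v"
    and scale: "\<And>c v. v \<in> ?V \<Longrightarrow> \<phi> (cscale c v) = cscale c (\<phi> v)"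
    and equiv: "\<And>g v. g \<in> carrier ?G \<Longrightarrow> v \<in> ?V \<Longrightarrow> \<phi> (tensor_rep mu lam g v) = inj_rep k n g (\<phi> v)"
    unfolding rep_iso_def by blast
  define c where "c = \<phi> spherical_vector id\<^sub>k"
  have act: "\<phi> x (inj_act k g id\<^sub>k) = \<phi> (tensor_rep mu lam (inv\<^bsub>?G\<^esub> g) x) id\<^sub>k" if "g \<in> carrier ?G" "x \<in> ?V" for g x
  proof -
    have "\<phi> (tensor_rep mu lam (inv\<^bsub>?G\<^esub> g) x) id\<^sub>k = inj_rep k n (inv\<^bsub>?G\<^esub> g) (\<phi> x) id\<^sub>k"
      using that by (simp add: equiv)
    also have "\<dots> = \<phi> x (inj_act k (inv\<^bsub>?G\<^esub> (inv\<^bsub>?G\<^esub> g)) id\<^sub>k)"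
      using e_in unfolding inj_rep_def perm_rep_def by (simp only: if_True)
    finally show ?thesis using that by simp
  qed
  have at_id: "\<phi> x id\<^sub>k = c * \<Phi> x id\<^sub>k" if "x \<in> ?V" for x
    unfolding c_def
  proof (rule sph.functional_multiple[OF that, where f = "\<lambda>x. \<phi> x id\<^sub>k"])
    show "\<phi> (x + y) id\<^sub>k = \<phi> x id\<^sub>k + \<phi> y id\<^sub>k" if "x \<in> ?V" "y \<in> ?V" for x y
      by (simp only: add[OF that] plus_fun_apply)
    show "\<phi> (cscale c x) id\<^sub>k = c * \<phi> x id\<^sub>k" if "x \<in> ?V" for c x
      by (simp only: scale[OF that] cscale_apply)
    fix h x assume h: "h \<in> gelfand_K k n" and x: "x \<in> ?V"
    have ih: "inv\<^bsub>?G\<^esub> h \<in> gelfand_K k n"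
      by (rule subgroup.m_inv_closed[OF gelfand_K_subgroup[OF kn] h])
    show "\<phi> (tensor_rep mu lam h x) id\<^sub>k = \<phi> x id\<^sub>k"
      using act[OF K_carrier[OF ih] x] gelfand_K_fix[OF kn ih] K_carrier[OF h] by simp
  qed
  have \<phi>: "\<phi> x = cscale c (\<Phi> x)" if x: "x \<in> ?V" for x
  proof
    fix \<sigma>
    show "\<phi> x \<sigma> = cscale c (\<Phi> x) \<sigma>"
    proof (cases "\<sigma> \<in> injections k n")
      case True
      obtain g where g: "g \<in> carrier ?G" "inj_act k g id\<^sub>k = \<sigma>"
        using injections_transitive[OF kn True] by blast
      then have "\<phi> x \<sigma> = c * \<Phi> (tensor_rep mu lam (inv\<^bsub>?G\<^esub> g) x) id\<^sub>k"
        using act[OF g(1) x] at_id sph.rep_in_V x by simp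
      also have "\<dots> = c * \<Phi> x \<sigma>" using cover_map_act[OF g(1) e_in, of x] g(2) by simp
      finally show ?thesis by simp
    next
      case False
      have "\<phi> x \<in> free_space (injections k n)" using W bij_betwE[OF bij] x by blast
      with False show ?thesis by (simp add: free_space_def cover_map_def)
    qed
  qed
  \<comment> \<open>Otherwise \<phi> would not separate \<open>spherical_vector\<close> from its
    multiple by 0, and injectivity would force the value 1 at the identity injection to be
    0.\<close>
  have "c \<noteq> 0"
  proof
    assume "c = 0"
    then have "\<phi> spherical_vector = \<phi> (cscale 0 spherical_vector)"
      using \<phi>[OF sph.v_in] scale[OF sph.v_in, of 0] by (simp only: cfun.scale_zero_left)
    moreover have "cscale 0 spherical_vector \<in> ?V" by (rule cfun.subspace_scale[OF V]) (rule sph.v_in)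
    ultimately have "spherical_vector = cscale 0 spherical_vector"
      using bij_betw_imp_inj_on[OF bij] sph.v_in by (simp only: inj_on_eq_iff)
    then have "\<Phi> spherical_vector id\<^sub>k = 0"
      using cover_map_scale[of k n mu lam 0 spherical_vector] by (metis cscale_apply mult_zero_left)
    then show False using spherical_vector_id by simp
  qed
  show "W = \<Phi> ` ?V"
  proof (intro equalityI subsetI)
    fix w assume "w \<in> W"
    then obtain x where x: "x \<in> ?V" "w = \<phi> x" using bij_betw_imp_surj_on[OF bij] by blast
    then have "w = \<Phi> (cscale c x)" by (simp only: \<phi> cover_map_scale)
    then show "w \<in> \<Phi> ` ?V" using cfun.subspace_scale[OF V x(1)] by blast
  next
    fix w assume "w \<in> \<Phi> ` ?V"
    then obtain x where x: "x \<in> ?V" "w = \<Phi> x" by blast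
    have cx: "cscale (1 / c) x \<in> ?V" by (rule cfun.subspace_scale[OF V x(1)])
    have "\<phi> (cscale (1 / c) x) = w"
      using \<open>c \<noteq> 0\<close> by (simp add: \<phi>[OF cx] cover_map_scale x(2))
    then show "w \<in> W" using bij_betwE[OF bij] cx by blast
  qed
qed

text \<open>Types are invariant under the group, so the sphere around the translate of the identity
  injection is carried back to the sphere around the identity injection itself, at the cost of
  translating \<open>x\<close>.\<close>

lemma scheme_operator_act:
  assumes g: "g \<in> carrier (gelfand_G k n)"
  shows "scheme_operator k n \<tau> (\<Phi> x) (inj_act k g id\<^sub>k) =
    (\<Sum>\<sigma>\<in>injection_sphere k n \<tau>. \<Phi> (tensor_rep mu lam (inv\<^bsub>gelfand_G k n\<^esub> g) x) \<sigma>)"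
proof -
  let ?X = "injections k n"
  have "scheme_operator k n \<tau> (\<Phi> x) (inj_act k g id\<^sub>k) =
      (\<Sum>\<sigma>\<in>?X. scheme_matrix k n \<tau> (inj_act k g id\<^sub>k) \<sigma> * \<Phi> x \<sigma>)"
    using inj.act_closed[OF g e_in] by (simp only: scheme_operator_def if_True)
  also have "\<dots> = (\<Sum>\<sigma>\<in>?X. scheme_matrix k n \<tau> (inj_act k g id\<^sub>k) (inj_act k g \<sigma>) * \<Phi> x (inj_act k g \<sigma>))"
    by (rule inj.sum_act[OF g, symmetric])
  also have "\<dots> = (\<Sum>\<sigma>\<in>?X. if cycle_path_type k n \<sigma> id\<^sub>k = \<tau>
      then \<Phi> (tensor_rep mu lam (inv\<^bsub>gelfand_G k n\<^esub> g) x) \<sigma> else 0)"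
    by (intro sum.cong refl)
       (simp add: scheme_matrix_def cycle_path_type_gelfand_act[OF kn g] cycle_path_type_commute[of k n id\<^sub>k] cover_map_act[OF g])
  also have "\<dots> = (\<Sum>\<sigma>\<in>injection_sphere k n \<tau>. \<Phi> (tensor_rep mu lam (inv\<^bsub>gelfand_G k n\<^esub> g) x) \<sigma>)"
    unfolding injection_sphere_def by (rule sum.inter_filter[OF finite_injections, symmetric])
  finally show ?thesis .
qed

text \<open>Summation over a sphere is an invariant functional on \<open>V\<close>, hence its value
  at \<open>spherical_vector\<close> times evaluation at the identity injection; applied to
  translates of \<open>x\<close> this is the eigenvalue equation.\<close>

lemma scheme_operator_cover_map:
  assumes x: "x \<in> specht_tensor mu lam"
  shows "scheme_operator k n \<tau> (\<Phi> x) = cscale (\<Sum>\<sigma>\<in>injection_sphere k n \<tau>. \<Phi> f0 \<sigma>) (\<Phi> x)"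
proof
  fix \<sigma>
  let ?G = "gelfand_G k n" and ?C = "injection_sphere k n \<tau>"
  have sum_eq: "(\<Sum>\<sigma>\<in>?C. \<Phi> y \<sigma>) = (\<Sum>\<sigma>\<in>?C. \<Phi> f0 \<sigma>) * \<Phi> y id\<^sub>k" if "y \<in> specht_tensor mu lam" for y
    unfolding sum_sphere_spherical_vector[symmetric]
  proof (rule sph.functional_multiple[OF that, where f = "\<lambda>y. \<Sum>\<sigma>\<in>?C. \<Phi> y \<sigma>"])
    show "(\<Sum>\<sigma>\<in>?C. \<Phi> (x + y) \<sigma>) = (\<Sum>\<sigma>\<in>?C. \<Phi> x \<sigma>) + (\<Sum>\<sigma>\<in>?C. \<Phi> y \<sigma>)" for x y
      by (simp only: cover_map_add plus_fun_apply sum.distrib)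
    show "(\<Sum>\<sigma>\<in>?C. \<Phi> (cscale c x) \<sigma>) = c * (\<Sum>\<sigma>\<in>?C. \<Phi> x \<sigma>)" for c x
      by (simp only: cover_map_scale cscale_apply sum_distrib_left)
    fix h x assume h: "h \<in> gelfand_K k n" and x: "x \<in> specht_tensor mu lam"
    have "x \<in> free_space (tabloids mu \<times> tabloids lam)" using x sph.V_free by blast
    then have "(\<Sum>\<sigma>\<in>?C. \<Phi> (tensor_rep mu lam h x) (inj_act k h \<sigma>)) = (\<Sum>\<sigma>\<in>?C. \<Phi> x \<sigma>)"
      using sphere_subset[OF kn, of \<tau>]
      by (intro sum.cong refl) (simp add: cover_map_act[OF K_carrier[OF h]] subset_iff tens.rep_inv_rep[OF K_carrier[OF h]])
    then show "(\<Sum>\<sigma>\<in>?C. \<Phi> (tensor_rep mu lam h x) \<sigma>) = (\<Sum>\<sigma>\<in>?C. \<Phi> x \<sigma>)"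
      by (simp only: sum_sphere_act[OF kn h])
  qed
  show "scheme_operator k n \<tau> (\<Phi> x) \<sigma> = cscale (\<Sum>\<sigma>\<in>?C. \<Phi> f0 \<sigma>) (\<Phi> x) \<sigma>"
  proof (cases "\<sigma> \<in> injections k n")
    case True
    obtain g where g: "g \<in> carrier ?G" "inj_act k g id\<^sub>k = \<sigma>"
      using injections_transitive[OF kn True] by blast
    have ig: "inv\<^bsub>?G\<^esub> g \<in> carrier ?G" using g(1) by simp
    have "scheme_operator k n \<tau> (\<Phi> x) \<sigma> = (\<Sum>\<sigma>\<in>?C. \<Phi> f0 \<sigma>) * \<Phi> (tensor_rep mu lam (inv\<^bsub>?G\<^esub> g) x) id\<^sub>k"
      using scheme_operator_act[OF g(1), of \<tau> x] g(2) sum_eq[OF sph.rep_in_V[OF ig x]] by simp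
    also have "\<dots> = (\<Sum>\<sigma>\<in>?C. \<Phi> f0 \<sigma>) * \<Phi> x \<sigma>"
      using cover_map_act[OF g(1) e_in, of x] g(2) by simp
    finally show ?thesis by simp
  qed (simp add: scheme_operator_def cover_map_def)
qed

lemma character_table_eq:
  "character_table k n mu lam \<tau> = (\<Sum>\<sigma>\<in>injection_sphere k n \<tau>. \<Phi> f0 \<sigma>)"
  unfolding character_table_def scheme_subspace_eq
proof (rule the_equality)
  show "\<forall>f\<in>\<Phi> ` specht_tensor mu lam. scheme_operator k n \<tau> f = cscale (\<Sum>\<sigma>\<in>injection_sphere k n \<tau>. \<Phi> f0 \<sigma>) f"
    using scheme_operator_cover_map by blast
  \<comment> \<open>The eigenvalue is determined because \<Phi> sends
    \<open>spherical_vector\<close> to a function with value 1 at the identity injection.\<close>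
  fix c assume "\<forall>f\<in>\<Phi> ` specht_tensor mu lam. scheme_operator k n \<tau> f = cscale c f"
  then have "cscale c (\<Phi> spherical_vector) = cscale (\<Sum>\<sigma>\<in>injection_sphere k n \<tau>. \<Phi> f0 \<sigma>) (\<Phi> spherical_vector)"
    using scheme_operator_cover_map[OF sph.v_in, of \<tau>] sph.v_in by (metis imageI)
  from fun_cong[OF this, of id\<^sub>k] show "c = (\<Sum>\<sigma>\<in>injection_sphere k n \<tau>. \<Phi> f0 \<sigma>)"
    by (simp add: spherical_vector_id)
qed

lemma sum_sphere_F0:
  "(\<Sum>\<sigma>\<in>injection_sphere k n \<tau>. \<Phi> f0 \<sigma>) =
    (\<Sum>\<sigma>\<in>injection_sphere k n \<tau>. \<Sum>\<pi>\<in>column_stabilizer lam t0.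
      of_int (sign \<pi>) * cover_indicator k (tabloid_of mu s0) (tabloid_of lam (\<pi> \<circ> t0)) \<sigma>)"
  using sphere_subset[OF kn] by (intro sum.cong refl cover_map_F0) blast

end

theorem theorem4p6:
  fixes k n :: nat and mu lam :: "nat list" and \<gamma> \<rho> :: "nat multiset"
  assumes "1 \<le> k" and "k \<le> n"
    and "partition_of k mu" and "partition_of n lam"
    and "horizontal_strip lam mu"
    and "injection_sphere k n (\<gamma>, \<rho>) \<noteq> {}"
  shows "spherical_value k n mu lam (\<gamma>, \<rho>) =
           1 / of_nat (card (injection_sphere k n (\<gamma>, \<rho>))) *
           (\<Sum>\<sigma>\<in>injection_sphere k n (\<gamma>, \<rho>). \<Sum>\<pi>\<in>column_stabilizer lam (strip_tableau lam mu).
              of_int (sign \<pi>) *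
              cover_indicator k (tabloid_of mu (row_tableau mu)) (tabloid_of lam (\<pi> \<circ> strip_tableau lam mu)) \<sigma>)
       \<and> character_table k n mu lam (\<gamma>, \<rho>) =
           (\<Sum>\<sigma>\<in>injection_sphere k n (\<gamma>, \<rho>). \<Sum>\<pi>\<in>column_stabilizer lam (strip_tableau lam mu).
              of_int (sign \<pi>) *
              cover_indicator k (tabloid_of mu (row_tableau mu)) (tabloid_of lam (\<pi> \<circ> strip_tableau lam mu)) \<sigma>)"
  unfolding sum_sphere_F0[OF assms(2-5), symmetric]
  by (intro conjI spherical_value_eq character_table_eq assms)

end
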